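(* Let $\mathcal A$ be the fundamental alcove of the affine Weyl group associated with an irreducible crystallographic root system $\Phi$ spanning $V$, with positive system $\Phi^+$. The function $$H(x)=\prod_{\alpha\in\Phi^+}\sin(\pi\langle x,\alpha\rangle)$$ is an eigenfunction for the Laplacian with Dirichlet boundary conditions on $\mathcal A$. Since $H$ is positive on $\mathcal A$, it is the principal eigenfunction. Further, each eigenfunction of the Laplacian with Dirichlet boundary conditions on $\mathcal A$ is divisible by $H$ in the ring of trigonometric polynomials.
   Context: $V$ is a finite-dimensional real Euclidean space with inner product $\langle\cdot,\cdot\rangle$, and $\mathcal A=\{x\in V:0<\langle x,\alpha\rangle<1\ \forall\alpha\in\Phi^+\}$, a bounded domain. The ring of trigonometric polynomials consists of the finite complex linear combinations of functions $x\mapsto e^{i\langle\xi,x\rangle}$, $\xi\in V$. It is a known result (Bérard) that the eigenfunctions for the Dirichlet Laplacian on $\mathcal A$ are $f_p(x)=\sum_{w\in W}\varepsilon(w)\exp(2\pi i\langle x,wp\rangle)$, $p\in\mathcal P\cap\mathcal C$, where $W$ is the Weyl group of $\Phi$, $\varepsilon(w)=\det w$, $\mathcal P=\{x\in V:\langle\alpha^\vee,x\rangle\in\mathbb{Z}\ \forall\alpha\in\Phi\}$, $\alpha^\vee=2\alpha/\langle\alpha,\alpha\rangle$, and $\mathcal C=\{x:\langle\alpha,x\rangle>0\ \forall\alpha\in\Phi^+\}$; they form a complete system, so that every eigenfunction is a finite linear combination of the $f_p$ with the same eigenvalue. *)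

theory Defs
  imports "HOL-Analysis.Analysis"
begin

definition root_reflection :: "'a::euclidean_space \<Rightarrow> 'a \<Rightarrow> 'a" where
  "root_reflection \<alpha> x = x - (2 * (x \<bullet> \<alpha>) / (\<alpha> \<bullet> \<alpha>)) *\<^sub>R \<alpha>"

text \<open>Root systems are finite and reduced; that the roots span the space is a separate hypothesis.\<close>

definition root_system :: "'a::euclidean_space set \<Rightarrow> bool" where
  "root_system \<Phi> \<longleftrightarrow>
     finite \<Phi> \<and> 0 \<notin> \<Phi> \<and>
     (\<forall>\<alpha>\<in>\<Phi>. \<Phi> \<inter> range (\<lambda>c. c *\<^sub>R \<alpha>) = {\<alpha>, - \<alpha>}) \<and>
     (\<forall>\<alpha>\<in>\<Phi>. root_reflection \<alpha> ` \<Phi> = \<Phi>)"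

definition crystallographic :: "'a::euclidean_space set \<Rightarrow> bool" where
  "crystallographic \<Phi> \<longleftrightarrow> (\<forall>\<alpha>\<in>\<Phi>. \<forall>\<beta>\<in>\<Phi>. 2 * (\<alpha> \<bullet> \<beta>) / (\<alpha> \<bullet> \<alpha>) \<in> \<int>)"

definition irreducible_root_system :: "'a::euclidean_space set \<Rightarrow> bool" where
  "irreducible_root_system \<Phi> \<longleftrightarrow>
     \<Phi> \<noteq> {} \<and>
     \<not> (\<exists>\<Phi>1 \<Phi>2. \<Phi>1 \<noteq> {} \<and> \<Phi>2 \<noteq> {} \<and> \<Phi>1 \<union> \<Phi>2 = \<Phi> \<and> \<Phi>1 \<inter> \<Phi>2 = {} \<and>
          (\<forall>\<alpha>\<in>\<Phi>1. \<forall>\<beta>\<in>\<Phi>2. \<alpha> \<bullet> \<beta> = 0))"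

definition positive_system :: "'a::euclidean_space set \<Rightarrow> 'a set \<Rightarrow> bool" where
  "positive_system \<Phi> P \<longleftrightarrow>
     (\<exists>v. (\<forall>\<alpha>\<in>\<Phi>. \<alpha> \<bullet> v \<noteq> 0) \<and> P = {\<alpha>\<in>\<Phi>. \<alpha> \<bullet> v > 0})"

definition alcove :: "'a::euclidean_space set \<Rightarrow> 'a set" where
  "alcove P = {x. \<forall>\<alpha>\<in>P. 0 < x \<bullet> \<alpha> \<and> x \<bullet> \<alpha> < 1}"

definition sine_product :: "'a::euclidean_space set \<Rightarrow> 'a \<Rightarrow> real" where
  "sine_product P x = (\<Prod>\<alpha>\<in>P. sin (pi * (x \<bullet> \<alpha>)))"

definition partial_deriv :: "'a::euclidean_space \<Rightarrow> ('a \<Rightarrow> complex) \<Rightarrow> 'a \<Rightarrow> complex" where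
  "partial_deriv b f x = frechet_derivative f (at x) b"

definition C2_on :: "'a::euclidean_space set \<Rightarrow> ('a \<Rightarrow> complex) \<Rightarrow> bool" where
  "C2_on S f \<longleftrightarrow>
     f differentiable_on S \<and>
     (\<forall>b\<in>Basis. partial_deriv b f differentiable_on S \<and>
       (\<forall>c\<in>Basis. continuous_on S (partial_deriv c (partial_deriv b f))))"

definition laplacian :: "('a::euclidean_space \<Rightarrow> complex) \<Rightarrow> 'a \<Rightarrow> complex" where
  "laplacian f x = (\<Sum>b\<in>Basis. partial_deriv b (partial_deriv b f) x)"

text \<open>Classical Dirichlet eigenfunctions on an open set \<open>A\<close>: only the values on the
  closure of \<open>A\<close> matter. Eigenvalues are those of the negative Laplacian, and are not
  assumed to be real.\<close>

definition dirichlet_eigenpair ::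
  "'a::euclidean_space set \<Rightarrow> complex \<Rightarrow> ('a \<Rightarrow> complex) \<Rightarrow> bool" where
  "dirichlet_eigenpair A \<mu> u \<longleftrightarrow>
     continuous_on (closure A) u \<and> C2_on A u \<and>
     (\<forall>x\<in>frontier A. u x = 0) \<and>
     (\<exists>x\<in>A. u x \<noteq> 0) \<and>
     (\<forall>x\<in>A. - laplacian u x = \<mu> * u x)"

definition dirichlet_eigenfunction ::
  "'a::euclidean_space set \<Rightarrow> ('a \<Rightarrow> complex) \<Rightarrow> bool" where
  "dirichlet_eigenfunction A u \<longleftrightarrow> (\<exists>\<mu>. dirichlet_eigenpair A \<mu> u)"

definition principal_dirichlet_eigenfunction ::
  "'a::euclidean_space set \<Rightarrow> ('a \<Rightarrow> complex) \<Rightarrow> bool" where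
  "principal_dirichlet_eigenfunction A u \<longleftrightarrow>
     (\<exists>l::real. dirichlet_eigenpair A (of_real l) u \<and>
        (\<forall>\<mu> v. dirichlet_eigenpair A \<mu> v \<longrightarrow> l \<le> Re \<mu>))"

definition trig_polynomials :: "('a::euclidean_space \<Rightarrow> complex) set" where
  "trig_polynomials =
     {f. \<exists>S c. finite S \<and> f = (\<lambda>x. \<Sum>\<xi>\<in>S. c \<xi> * exp (\<i> * of_real (\<xi> \<bullet> x)))}"

definition trig_dvd ::
  "('a::euclidean_space \<Rightarrow> complex) \<Rightarrow> ('a \<Rightarrow> complex) \<Rightarrow> bool" where
  "trig_dvd f g \<longleftrightarrow>
     f \<in> trig_polynomials \<and> g \<in> trig_polynomials \<and>
     (\<exists>h\<in>trig_polynomials. g = (\<lambda>x. f x * h x))"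

end

theory Submission
  imports Defs
begin

text \<open>Let \<open>v\<close> be an eigenfunction with eigenvalue \<open>\<mu>\<close>. No regularity of \<open>v\<close> at the boundary is
  available, so Fourier coefficients cannot be integrated by parts. Instead, \<open>v\<close> is approximated
  uniformly on the closed alcove by trigonometric polynomials \<open>p\<close> that are antisymmetric under the
  affine Weyl group (Stone--Weierstrass; invariant functions separate points because the closed
  alcove meets every orbit once). The heat flow of \<open>p\<close> vanishes on the boundary, so by the parabolic
  maximum principle it stays as close to \<open>exp (- \<mu> t) v\<close> as \<open>p\<close> was to \<open>v\<close>. Comparing Fourier
  coefficients, only frequencies with \<open>|\<xi>|\<^sup>2 = \<mu>\<close> survive in the limit: \<open>v\<close> is an antisymmetric
  trigonometric polynomial.

  Such a polynomial vanishes on all reflection hyperplanes, hence is divisible by every factor of \<open>H\<close>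
  in turn. The Laplacian of \<open>H\<close> is antisymmetric too, and the quotient by \<open>H\<close> has no frequency
  but \<open>0\<close>, so \<open>H\<close> is an eigenfunction and its frequencies lie on one sphere. If \<open>v = H g\<close> has its
  frequencies inside that ball, the frequencies of \<open>H\<close> lie in the convex hull of those of \<open>v\<close> and so,
  by strict convexity, among them. This bounds \<open>\<mu>\<close> from below, and applied to \<open>g - c\<close> it shows that
  equality forces \<open>v = c H\<close>.\<close>

section \<open>Trigonometric polynomials\<close>

text \<open>Uniform bounds must pass to Fourier coefficients; this is done algebraically, by
  averaging twisted translates until a single frequency is left, without integrals. That the closed
  alcove meets every orbit once rests on folding galleries: one that returns to its own alcove can
  be shortened until it is trivial, so no nontrivial motion preserves an alcove; simple roots and
  length functions do not enter. Separation of orbits needs the coroot lattice to be its own double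
  dual; a linearly independent set of coroots is enlarged by one torsion vector at a time.

  Independence of characters serves three times: for divisibility by a sine, for the double dual,
  and for invariants that separate points. The passage to the limit is made at heat time 1, where
  the factor \<open>exp (- |\<xi>|^2)\<close>, summable over the lattice of admissible frequencies,
  makes tails uniformly small. The part usually played by the Weyl vector is taken by the support
  function \<open>width\<close> of a zonotope, evaluated in generic directions so that top
  frequencies never cancel.\<close>

definition trig_sum :: "('a::euclidean_space \<Rightarrow> complex) \<Rightarrow> 'a \<Rightarrow> complex" where
  "trig_sum c x = (\<Sum>\<xi> | c \<xi> \<noteq> 0. c \<xi> * cis (\<xi> \<bullet> x))"

text \<open>The choice is harmless: \<open>coef_eqI\<close> shows that a trigonometric polynomial
  has only one finitely supported coefficient function.\<close>

definition coef :: "('a::euclidean_space \<Rightarrow> complex) \<Rightarrow> 'a \<Rightarrow> complex" where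
  "coef f = (SOME c. finite {\<xi>. c \<xi> \<noteq> 0} \<and> f = trig_sum c)"

text \<open>Artin's independence of characters, in a form that allows different indices to give the
  same character on \<open>\<Gamma>\<close>: only the sum over a class of coinciding indices must
  vanish. Restricting exponentials to a family of hyperplanes or to a lattice requires this
  form.\<close>

lemma char_indep:
  fixes ch :: "'i \<Rightarrow> 'b::ab_semigroup_add \<Rightarrow> complex" and a :: "'i \<Rightarrow> complex"
  assumes "finite I"
    and \<Gamma>: "\<And>x y. x \<in> \<Gamma> \<Longrightarrow> y \<in> \<Gamma> \<Longrightarrow> x + y \<in> \<Gamma>"
    and mult: "\<And>i x y. i \<in> I \<Longrightarrow> x \<in> \<Gamma> \<Longrightarrow> y \<in> \<Gamma> \<Longrightarrow> ch i (x + y) = ch i x * ch i y"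
    and z: "z \<in> \<Gamma>" "ch i0 z \<noteq> 0"
    and zero: "\<And>x. x \<in> \<Gamma> \<Longrightarrow> (\<Sum>i\<in>I. a i * ch i x) = 0"
  shows "(\<Sum>i | i \<in> I \<and> (\<forall>x\<in>\<Gamma>. ch i x = ch i0 x). a i) = 0"
  using assms(1) mult zero
proof (induction "card I" arbitrary: I a rule: less_induct)
  case less
  show ?case
  proof (cases "\<forall>i\<in>I. \<forall>x\<in>\<Gamma>. ch i x = ch i0 x")
    case True
    then have eq: "{i. i \<in> I \<and> (\<forall>x\<in>\<Gamma>. ch i x = ch i0 x)} = I" by auto
    have "(\<Sum>i\<in>I. a i) * ch i0 z = (\<Sum>i\<in>I. a i * ch i z)"
      unfolding sum_distrib_right by (rule sum.cong) (use True z in auto)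
    then show ?thesis using less.prems(3)[OF z(1)] z(2) eq by simp
  next
    case False
    then obtain j y where j: "j \<in> I" "y \<in> \<Gamma>" "ch j y \<noteq> ch i0 y" by auto
    \<comment> \<open>The relation translated by \<open>y\<close> minus \<open>ch j y\<close> times
      the relation: index \<open>j\<close> drops out, while the class of \<open>i0\<close>, which
      does not contain \<open>j\<close>, is multiplied by the nonzero number
      \<open>ch i0 y - ch j y\<close>.\<close>
    define b where "b i = a i * (ch i y - ch j y)" for i
    let ?C = "\<lambda>I. {i. i \<in> I \<and> (\<forall>x\<in>\<Gamma>. ch i x = ch i0 x)}"
    have C: "?C (I - {j}) = ?C I" using j by auto
    have "(\<Sum>i\<in>?C (I - {j}). b i) = 0"
    proof (rule less.hyps)
      show "card (I - {j}) < card I" using j(1) less.prems(1) by (meson card_Diff1_less)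
      fix x assume x: "x \<in> \<Gamma>"
      have "(\<Sum>i\<in>I - {j}. b i * ch i x) = (\<Sum>i\<in>I. b i * ch i x)"
        using j(1) less.prems(1) by (simp add: sum.remove b_def)
      also have "\<dots> = (\<Sum>i\<in>I. a i * ch i (x + y)) - ch j y * (\<Sum>i\<in>I. a i * ch i x)"
        unfolding sum_distrib_left sum_subtractf[symmetric]
        by (rule sum.cong) (use less.prems(2) x j in \<open>auto simp: b_def algebra_simps\<close>)
      also have "\<dots> = 0" using less.prems(3) \<Gamma> x j by simp
      finally show "(\<Sum>i\<in>I - {j}. b i * ch i x) = 0" .
    qed (use less.prems in auto)
    moreover have "(\<Sum>i\<in>?C I. b i) = (\<Sum>i\<in>?C I. a i) * (ch i0 y - ch j y)"
      unfolding sum_distrib_right by (rule sum.cong) (use j in \<open>auto simp: b_def\<close>)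
    ultimately show ?thesis using j(3) C by simp
  qed
qed

text \<open>Averaging the sum with \<open>cis (- (\<xi> \<bullet> y))\<close> times its translate by
  \<open>y\<close> keeps the bound and the coefficient at \<open>\<xi>\<close>, and multiplies the
  one at \<open>\<eta>\<close> by \<open>(1 + cis ((\<eta> - \<xi>) \<bullet> y)) / 2\<close>. For
  phase \<open>pi\<close> this factor is zero, so the other frequencies are removed one at a
  time.\<close>

lemma coef_le_sup:
  fixes c :: "'a::euclidean_space \<Rightarrow> complex"
  assumes "finite S" "\<xi> \<in> S"
    and "\<And>x. norm (\<Sum>\<eta>\<in>S. c \<eta> * cis (\<eta> \<bullet> x)) \<le> M"
  shows "norm (c \<xi>) \<le> M"
  using assms
proof (induction "card S" arbitrary: S c rule: less_induct)
  case less
  show ?case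
  proof (cases "S = {\<xi>}")
    case True
    then show ?thesis using less.prems(3)[of 0] by simp
  next
    case False
    then obtain \<eta> where \<eta>: "\<eta> \<in> S" "\<eta> \<noteq> \<xi>" using less.prems(2) by auto
    define y where "y = (pi / ((\<eta> - \<xi>) \<bullet> (\<eta> - \<xi>))) *\<^sub>R (\<eta> - \<xi>)"
    have y: "(\<eta> - \<xi>) \<bullet> y = pi" using \<eta> by (simp add: y_def)
    define b where "b \<zeta> = c \<zeta> * (1 + cis ((\<zeta> - \<xi>) \<bullet> y)) / 2" for \<zeta>
    have b\<eta>: "b \<eta> = 0" using y by (simp add: b_def)
    have "norm (b \<xi>) \<le> M"
    proof (rule less.hyps)
      show "card (S - {\<eta>}) < card S" using \<eta>(1) less.prems(1) by (meson card_Diff1_less)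
      fix x
      have "(\<Sum>\<zeta>\<in>S - {\<eta>}. b \<zeta> * cis (\<zeta> \<bullet> x)) = (\<Sum>\<zeta>\<in>S. b \<zeta> * cis (\<zeta> \<bullet> x))"
        using \<eta>(1) less.prems(1) by (simp add: sum.remove b\<eta>)
      also have "\<dots> = ((\<Sum>\<zeta>\<in>S. c \<zeta> * cis (\<zeta> \<bullet> x)) + cis (- (\<xi> \<bullet> y)) * (\<Sum>\<zeta>\<in>S. c \<zeta> * cis (\<zeta> \<bullet> (x + y)))) / 2"
        unfolding sum_distrib_left sum.distrib[symmetric] sum_divide_distrib
        by (rule sum.cong)
          (auto simp: b_def algebra_simps inner_simps cis_mult add_divide_distrib)
      finally have eq: "(\<Sum>\<zeta>\<in>S - {\<eta>}. b \<zeta> * cis (\<zeta> \<bullet> x)) = \<dots>" .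
      have "norm ((\<Sum>\<zeta>\<in>S. c \<zeta> * cis (\<zeta> \<bullet> x)) + cis (- (\<xi> \<bullet> y)) * (\<Sum>\<zeta>\<in>S. c \<zeta> * cis (\<zeta> \<bullet> (x + y)))) \<le> M + M"
        by (rule norm_triangle_mono) (use less.prems(3) in \<open>auto simp: norm_mult\<close>)
      then show "norm (\<Sum>\<zeta>\<in>S - {\<eta>}. b \<zeta> * cis (\<zeta> \<bullet> x)) \<le> M" unfolding eq by (simp add: norm_divide)
    qed (use less.prems \<eta> in auto)
    then show ?thesis by (simp add: b_def)
  qed
qed

lemma trig_sum_superset:
  assumes "finite S" "{\<xi>. c \<xi> \<noteq> 0} \<subseteq> S"
  shows "trig_sum c x = (\<Sum>\<xi>\<in>S. c \<xi> * cis (\<xi> \<bullet> x))"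
  unfolding trig_sum_def by (rule sum.mono_neutral_left) (use assms in auto)

lemma trig_polynomials_iff: "f \<in> trig_polynomials \<longleftrightarrow> (\<exists>c. finite {\<xi>. c \<xi> \<noteq> 0} \<and> f = trig_sum c)"
proof
  assume "f \<in> trig_polynomials"
  then obtain S c where S: "finite S" "f = (\<lambda>x. \<Sum>\<xi>\<in>S. c \<xi> * cis (\<xi> \<bullet> x))"
    by (auto simp: trig_polynomials_def cis_conv_exp)
  let ?c = "\<lambda>\<xi>. if \<xi> \<in> S then c \<xi> else 0"
  have "f = trig_sum ?c"
    by (rule ext, subst trig_sum_superset[OF S(1)]) (auto simp: S)
  moreover have "finite {\<xi>. ?c \<xi> \<noteq> 0}" by (rule finite_subset[OF _ S(1)]) auto
  ultimately show "\<exists>c. finite {\<xi>. c \<xi> \<noteq> 0} \<and> f = trig_sum c" by (intro exI[of _ ?c] conjI)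
next
  assume "\<exists>c. finite {\<xi>. c \<xi> \<noteq> 0} \<and> f = trig_sum c"
  then show "f \<in> trig_polynomials"
    unfolding trig_polynomials_def trig_sum_def cis_conv_exp by blast
qed

lemma finite_coef: "f \<in> trig_polynomials \<Longrightarrow> finite {\<xi>. coef f \<xi> \<noteq> 0}"
  and trig_sum_coef: "f \<in> trig_polynomials \<Longrightarrow> trig_sum (coef f) = f"
proof -
  assume "f \<in> trig_polynomials"
  then have "\<exists>c. finite {\<xi>. c \<xi> \<noteq> 0} \<and> f = trig_sum c" by (simp add: trig_polynomials_iff)
  from someI_ex[OF this] show "finite {\<xi>. coef f \<xi> \<noteq> 0}" "trig_sum (coef f) = f"
    unfolding coef_def by auto
qed

lemma trig_sum_polynomial: "finite {\<xi>. c \<xi> \<noteq> 0} \<Longrightarrow> trig_sum c \<in> trig_polynomials"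
  by (auto simp: trig_polynomials_iff)

lemma norm_coef_le:
  assumes "f \<in> trig_polynomials" "\<And>x. norm (f x) \<le> M"
  shows "norm (coef f \<xi>) \<le> M"
proof (cases "coef f \<xi> = 0")
  case True
  then show ?thesis using norm_ge_zero order_trans assms(2) by (metis norm_zero)
next
  case False
  show ?thesis
    by (rule coef_le_sup[OF finite_coef[OF assms(1)]])
      (use False assms trig_sum_coef[OF assms(1)] in \<open>auto simp: trig_sum_def fun_eq_iff\<close>)
qed

text \<open>This is \<open>coef_le_sup\<close> with bound 0, applied to the difference of the two
  representations.\<close>

lemma coef_eqI:
  assumes "finite {\<xi>. c \<xi> \<noteq> 0}" "\<And>x. f x = trig_sum c x"
  shows "coef f = c"
proof
  fix \<xi>
  have f: "f = trig_sum c" using assms(2) by auto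
  then have tp: "f \<in> trig_polynomials" using assms by (simp add: trig_sum_polynomial)
  define S where "S = insert \<xi> ({\<xi>. c \<xi> \<noteq> 0} \<union> {\<xi>. coef f \<xi> \<noteq> 0})"
  have S: "finite S" using assms finite_coef[OF tp] by (simp add: S_def)
  have "norm ((\<lambda>\<xi>. c \<xi> - coef f \<xi>) \<xi>) \<le> 0"
  proof (rule coef_le_sup[OF S])
    fix x
    have "(\<Sum>\<eta>\<in>S. (c \<eta> - coef f \<eta>) * cis (\<eta> \<bullet> x)) = trig_sum c x - trig_sum (coef f) x"
      using S by (subst (1 2) trig_sum_superset[of S]) (auto simp: S_def sum_subtractf algebra_simps)
    then show "norm (\<Sum>\<eta>\<in>S. (c \<eta> - coef f \<eta>) * cis (\<eta> \<bullet> x)) \<le> 0"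
      using f trig_sum_coef[OF tp] by simp
  qed (simp add: S_def)
  then show "coef f \<xi> = c \<xi>" by simp
qed

lemma coef_trig_sum: "finite {\<xi>. c \<xi> \<noteq> 0} \<Longrightarrow> coef (trig_sum c) = c"
  by (rule coef_eqI) auto

lemma trig_poly_eq_0_iff: "f \<in> trig_polynomials \<Longrightarrow> (\<forall>x. f x = 0) \<longleftrightarrow> (\<forall>\<xi>. coef f \<xi> = 0)"
  using trig_sum_coef[of f] coef_eqI[of "\<lambda>_. 0" f] by (force simp: trig_sum_def fun_eq_iff)

lemma trig_sum_cis:
  assumes "\<And>\<xi>. c \<xi> = (if \<xi> = \<eta> then k else 0)"
  shows "trig_sum c x = k * cis (\<eta> \<bullet> x)"
  by (subst trig_sum_superset[of "{\<eta>}"]) (use assms in auto)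

lemma tp_cis: "(\<lambda>x. k * cis (\<eta> \<bullet> x)) \<in> trig_polynomials"
  and coef_cis: "coef (\<lambda>x. k * cis (\<eta> \<bullet> x)) = (\<lambda>\<xi>. if \<xi> = \<eta> then k else 0)"
proof -
  let ?c = "\<lambda>\<xi>. if \<xi> = \<eta> then k else 0"
  have f: "finite {\<xi>. ?c \<xi> \<noteq> 0}" by (rule finite_subset[of _ "{\<eta>}"]) auto
  have eq: "trig_sum ?c = (\<lambda>x. k * cis (\<eta> \<bullet> x))" by (rule ext, rule trig_sum_cis) auto
  show "(\<lambda>x. k * cis (\<eta> \<bullet> x)) \<in> trig_polynomials" using trig_sum_polynomial[OF f] eq by simp
  show "coef (\<lambda>x. k * cis (\<eta> \<bullet> x)) = ?c" using coef_trig_sum[OF f] eq by simp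
qed

lemma tp_const: "(\<lambda>x. k) \<in> trig_polynomials"
  and coef_const: "coef (\<lambda>x. k) = (\<lambda>\<xi>. if \<xi> = 0 then k else 0)"
  using tp_cis[of k 0] coef_cis[of k 0] by simp_all

lemma tp_lincomb:
  assumes "f \<in> trig_polynomials" "g \<in> trig_polynomials"
  shows "(\<lambda>x. a * f x + b * g x) \<in> trig_polynomials"
    and coef_lincomb: "coef (\<lambda>x. a * f x + b * g x) = (\<lambda>\<xi>. a * coef f \<xi> + b * coef g \<xi>)"
proof -
  define S where "S = {\<xi>. coef f \<xi> \<noteq> 0} \<union> {\<xi>. coef g \<xi> \<noteq> 0}"
  have S: "finite S" using assms finite_coef by (auto simp: S_def)
  let ?c = "\<lambda>\<xi>. a * coef f \<xi> + b * coef g \<xi>"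
  have f: "finite {\<xi>. ?c \<xi> \<noteq> 0}" by (rule finite_subset[OF _ S]) (auto simp: S_def)
  have eq: "a * f x + b * g x = trig_sum ?c x" for x
  proof -
    have "f x = (\<Sum>\<xi>\<in>S. coef f \<xi> * cis (\<xi> \<bullet> x))" "g x = (\<Sum>\<xi>\<in>S. coef g \<xi> * cis (\<xi> \<bullet> x))"
      by (subst trig_sum_coef[OF assms(1), symmetric] trig_sum_coef[OF assms(2), symmetric],
          rule trig_sum_superset[OF S], force simp: S_def)+
    moreover have "trig_sum ?c x = (\<Sum>\<xi>\<in>S. ?c \<xi> * cis (\<xi> \<bullet> x))"
      by (rule trig_sum_superset[OF S]) (auto simp: S_def)
    ultimately show ?thesis by (simp add: sum_distrib_left sum.distrib algebra_simps)
  qed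
  show "(\<lambda>x. a * f x + b * g x) \<in> trig_polynomials"
    using trig_sum_polynomial[OF f] eq by presburger
  show "coef (\<lambda>x. a * f x + b * g x) = ?c" by (rule coef_eqI[OF f eq])
qed

lemma tp_add: "f \<in> trig_polynomials \<Longrightarrow> g \<in> trig_polynomials \<Longrightarrow> (\<lambda>x. f x + g x) \<in> trig_polynomials"
  using tp_lincomb[of f g 1 1] by simp

lemma tp_diff: "f \<in> trig_polynomials \<Longrightarrow> g \<in> trig_polynomials \<Longrightarrow> (\<lambda>x. f x - g x) \<in> trig_polynomials"
  using tp_lincomb[of f g 1 "-1"] by simp

lemma coef_diff:
  "f \<in> trig_polynomials \<Longrightarrow> g \<in> trig_polynomials \<Longrightarrow> coef (\<lambda>x. f x - g x) = (\<lambda>\<xi>. coef f \<xi> - coef g \<xi>)"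
  using coef_lincomb[of f g 1 "-1"] by simp

lemma tp_cmult: "f \<in> trig_polynomials \<Longrightarrow> (\<lambda>x. k * f x) \<in> trig_polynomials"
  using tp_lincomb[of f f k 0] by simp

lemma coef_cmult: "f \<in> trig_polynomials \<Longrightarrow> coef (\<lambda>x. k * f x) = (\<lambda>\<xi>. k * coef f \<xi>)"
  using coef_lincomb[of f f k 0] by simp

lemma tp_sum: "(\<And>i. i \<in> I \<Longrightarrow> f i \<in> trig_polynomials) \<Longrightarrow> (\<lambda>x. \<Sum>i\<in>I. f i x) \<in> trig_polynomials"
  by (induction I rule: infinite_finite_induct) (auto intro: tp_add tp_const)

lemma tp_sum_cis: "(\<lambda>x. \<Sum>i\<in>I. c i * cis (h i \<bullet> x)) \<in> trig_polynomials"
  by (rule tp_sum) (rule tp_cis)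

lemma tp_cis_mult:
  assumes "f \<in> trig_polynomials"
  shows "(\<lambda>x. cis (\<eta> \<bullet> x) * f x) \<in> trig_polynomials"
    and coef_cis_mult: "coef (\<lambda>x. cis (\<eta> \<bullet> x) * f x) = (\<lambda>\<xi>. coef f (\<xi> - \<eta>))"
proof -
  let ?S = "{\<xi>. coef f \<xi> \<noteq> 0}" and ?c = "\<lambda>\<xi>. coef f (\<xi> - \<eta>)"
  have S: "{\<xi>. ?c \<xi> \<noteq> 0} = (\<lambda>\<xi>. \<xi> + \<eta>) ` ?S"
    by (force simp: image_iff)
  then have f: "finite {\<xi>. ?c \<xi> \<noteq> 0}" using finite_coef[OF assms] by simp
  have eq: "cis (\<eta> \<bullet> x) * f x = trig_sum ?c x" for x
  proof -
    have "f x = (\<Sum>\<xi>\<in>?S. coef f \<xi> * cis (\<xi> \<bullet> x))"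
      by (subst trig_sum_coef[OF assms, symmetric]) (simp add: trig_sum_def)
    then show ?thesis
      unfolding trig_sum_def S
      by (subst sum.reindex) (auto simp: sum_distrib_left inner_simps cis_mult algebra_simps simp flip: cis_mult)
  qed
  show "(\<lambda>x. cis (\<eta> \<bullet> x) * f x) \<in> trig_polynomials"
    using trig_sum_polynomial[OF f] eq by presburger
  show "coef (\<lambda>x. cis (\<eta> \<bullet> x) * f x) = ?c" by (rule coef_eqI[OF f eq])
qed

lemma tp_mult:
  assumes "f \<in> trig_polynomials" "g \<in> trig_polynomials"
  shows "(\<lambda>x. f x * g x) \<in> trig_polynomials"
proof -
  have "f x * g x = (\<Sum>\<xi> | coef f \<xi> \<noteq> 0. coef f \<xi> * (cis (\<xi> \<bullet> x) * g x))" for x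
    by (subst trig_sum_coef[OF assms(1), symmetric]) (simp add: trig_sum_def sum_distrib_right mult.assoc)
  moreover have "(\<lambda>x. \<Sum>\<xi> | coef f \<xi> \<noteq> 0. coef f \<xi> * (cis (\<xi> \<bullet> x) * g x)) \<in> trig_polynomials"
    by (intro tp_sum tp_cmult tp_cis_mult assms)
  ultimately show ?thesis by simp
qed

lemma tp_prod: "(\<And>i. i \<in> I \<Longrightarrow> f i \<in> trig_polynomials) \<Longrightarrow> (\<lambda>x. \<Prod>i\<in>I. f i x) \<in> trig_polynomials"
  by (induction I rule: infinite_finite_induct) (auto intro: tp_mult tp_const)

lemma tp_cnj:
  assumes "f \<in> trig_polynomials"
  shows "(\<lambda>x. cnj (f x)) \<in> trig_polynomials"
proof -
  have "cnj (f x) = (\<Sum>\<xi> | coef f \<xi> \<noteq> 0. cnj (coef f \<xi>) * cis ((- \<xi>) \<bullet> x))" for x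
    by (subst trig_sum_coef[OF assms(1), symmetric]) (simp add: trig_sum_def cis_cnj)
  then show ?thesis using tp_sum_cis[of "\<lambda>\<xi>. cnj (coef f \<xi>)" uminus "{\<xi>. coef f \<xi> \<noteq> 0}"] by simp
qed

lemma sin_conv_cis: "complex_of_real (sin t) = (cis t - cis (- t)) / (2 * \<i>)"
  by (auto simp: complex_eq_iff)

lemma tp_sin: "(\<lambda>x. complex_of_real (sin (pi * (x \<bullet> \<alpha>)))) \<in> trig_polynomials"
proof -
  have "complex_of_real (sin (pi * (x \<bullet> \<alpha>))) = (1 / (2 * \<i>)) * (1 * cis ((pi *\<^sub>R \<alpha>) \<bullet> x) - 1 * cis ((- (pi *\<^sub>R \<alpha>)) \<bullet> x))" for x
    by (simp add: sin_conv_cis inner_commute)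
  moreover have "(\<lambda>x. (1 / (2 * \<i>)) * (1 * cis ((pi *\<^sub>R \<alpha>) \<bullet> x) - 1 * cis ((- (pi *\<^sub>R \<alpha>)) \<bullet> x))) \<in> trig_polynomials"
    by (intro tp_cmult tp_diff tp_cis)
  ultimately show ?thesis by simp
qed

lemma coef_sin_mult:
  assumes "f \<in> trig_polynomials"
  shows "coef (\<lambda>x. complex_of_real (sin (pi * (x \<bullet> \<alpha>))) * f x)
    = (\<lambda>\<xi>. (coef f (\<xi> - pi *\<^sub>R \<alpha>) - coef f (\<xi> + pi *\<^sub>R \<alpha>)) / (2 * \<i>))"
proof -
  have eq: "complex_of_real (sin (pi * (x \<bullet> \<alpha>))) * f x = (1 / (2 * \<i>)) * (cis ((pi *\<^sub>R \<alpha>) \<bullet> x) * f x - cis ((- (pi *\<^sub>R \<alpha>)) \<bullet> x) * f x)" for x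
    by (simp add: sin_conv_cis inner_commute left_diff_distrib)
  have "coef (\<lambda>x. complex_of_real (sin (pi * (x \<bullet> \<alpha>))) * f x) =
    (\<lambda>\<xi>. (1 / (2 * \<i>)) * (coef f (\<xi> - pi *\<^sub>R \<alpha>) - coef f (\<xi> - - (pi *\<^sub>R \<alpha>))))"
    unfolding eq
    by (subst coef_cmult coef_diff coef_cis_mult, (intro tp_cis_mult tp_diff assms)+)+ (rule refl)
  then show ?thesis by (simp add: field_simps)
qed

lemma continuous_on_tp: "f \<in> trig_polynomials \<Longrightarrow> continuous_on S f"
  unfolding trig_polynomials_def by (auto intro!: continuous_intros)

lemma cis_eq_1_iff: "cis t = 1 \<longleftrightarrow> t / (2 * pi) \<in> \<int>"
proof -
  have "cis t = 1 \<longleftrightarrow> (\<exists>n::int. t = 2 * pi * n)"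
    by (auto simp: complex_eq_iff cos_one_2pi_int)
  also have "\<dots> \<longleftrightarrow> t / (2 * pi) \<in> \<int>"
    by (auto simp: Ints_def field_simps)
  finally show ?thesis .
qed

text \<open>Exponentials whose frequencies differ by an integer multiple of \<open>2 * pi\<close>
  times \<open>\<beta>\<close> differ by a multiple of the sine, by telescoping. On the hyperplanes,
  exponentials of different classes are different characters, so the coefficients in each class add
  up to 0 and \<open>f\<close> is a combination of such differences.\<close>

lemma tp_dvd_sin:
  fixes f :: "'a::euclidean_space \<Rightarrow> complex"
  assumes f: "f \<in> trig_polynomials" and \<beta>: "\<beta> \<noteq> 0"
    and zero: "\<And>x. x \<bullet> \<beta> \<in> \<int> \<Longrightarrow> f x = 0"
  obtains g where "g \<in> trig_polynomials" "\<And>x. f x = complex_of_real (sin (pi * (x \<bullet> \<beta>))) * g x"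
proof -
  define D where "D = {f. \<exists>g\<in>trig_polynomials. f = (\<lambda>x. complex_of_real (sin (pi * (x \<bullet> \<beta>))) * g x)}"
  have D_lincomb: "(\<lambda>x. a * u x + b * v x) \<in> D" if uv: "u \<in> D" "v \<in> D" for u v a b
  proof -
    obtain u' v' where "u' \<in> trig_polynomials" "u = (\<lambda>x. complex_of_real (sin (pi * (x \<bullet> \<beta>))) * u' x)"
      "v' \<in> trig_polynomials" "v = (\<lambda>x. complex_of_real (sin (pi * (x \<bullet> \<beta>))) * v' x)"
      using uv unfolding D_def by blast
    then show ?thesis unfolding D_def
      by (intro CollectI bexI[of _ "\<lambda>x. a * u' x + b * v' x"]) (auto simp: algebra_simps tp_lincomb)
  qed
  have D0: "(\<lambda>x. 0) \<in> D" unfolding D_def by (auto intro!: bexI[of _ "\<lambda>x. 0"] tp_const)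
  define e where "e n \<xi> x = cis ((\<xi> + (2 * pi * of_int n) *\<^sub>R \<beta>) \<bullet> x)" for n :: int and \<xi> x :: 'a
  have step: "(\<lambda>x. e (n + 1) \<xi> x - e n \<xi> x) \<in> D" for n \<xi>
  proof -
    let ?\<eta> = "\<xi> + (pi * (2 * of_int n + 1)) *\<^sub>R \<beta>"
    have "e (n + 1) \<xi> x - e n \<xi> x = complex_of_real (sin (pi * (x \<bullet> \<beta>))) * (2 * \<i> * cis (?\<eta> \<bullet> x))" for x
      by (simp add: sin_conv_cis e_def left_diff_distrib cis_mult)
        (simp add: cis_mult algebra_simps inner_simps inner_commute[of \<beta>])
    then show ?thesis unfolding D_def by (auto intro!: bexI[OF _ tp_cis])
  qed
  have tele: "(\<lambda>x. e n \<xi> x - e 0 \<xi> x) \<in> D" for n \<xi>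
  proof (induction n rule: int_induct[where k = 0])
    case base
    then show ?case using D0 by simp
  next
    case (step1 n)
    then show ?case using D_lincomb[OF step1(2) step[of n \<xi>], of 1 1] by (simp add: algebra_simps)
  next
    case (step2 n)
    then show ?case using D_lincomb[OF step2(2) step[of "n - 1" \<xi>], of 1 "-1"] by (simp add: algebra_simps)
  qed
  define R where "R \<xi> \<eta> \<longleftrightarrow> (\<exists>n::int. \<eta> = \<xi> + (2 * pi * of_int n) *\<^sub>R \<beta>)" for \<xi> \<eta> :: 'a
  have R_refl: "R \<xi> \<xi>" for \<xi> unfolding R_def by (auto intro!: exI[of _ 0])
  have R_sym: "R \<eta> \<xi>" if \<xi>\<eta>: "R \<xi> \<eta>" for \<xi> \<eta>
  proof -
    obtain n where "\<eta> = \<xi> + (2 * pi * of_int n) *\<^sub>R \<beta>" using \<xi>\<eta> unfolding R_def by auto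
    then show ?thesis unfolding R_def by (intro exI[of _ "- n"]) simp
  qed
  have R_trans: "R \<xi> \<zeta>" if R: "R \<xi> \<eta>" "R \<eta> \<zeta>" for \<xi> \<eta> \<zeta>
  proof -
    obtain m n where "\<eta> = \<xi> + (2 * pi * of_int m) *\<^sub>R \<beta>" "\<zeta> = \<eta> + (2 * pi * of_int n) *\<^sub>R \<beta>"
      using R unfolding R_def by auto
    then show ?thesis unfolding R_def
      by (intro exI[of _ "m + n"]) (simp add: algebra_simps)
  qed
  define r where "r \<xi> = (SOME \<eta>. R \<eta> \<xi>)" for \<xi>
  have r: "R (r \<xi>) \<xi>" for \<xi> unfolding r_def by (rule someI[of _ \<xi>]) (rule R_refl)
  have r_eq: "r \<xi> = r \<eta>" if "R \<xi> \<eta>" for \<xi> \<eta>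
  proof -
    have "R \<zeta> \<xi> = R \<zeta> \<eta>" for \<zeta>
      using R_trans[OF _ that, of \<zeta>] R_trans[OF _ R_sym[OF that], of \<zeta>] by auto
    then show ?thesis unfolding r_def by simp
  qed
  define \<Gamma> where "\<Gamma> = {x. x \<bullet> \<beta> \<in> \<int>}"
  \<comment> \<open>\<open>\<Gamma>\<close> contains the whole subspace orthogonal to
    \<open>\<beta>\<close>, on which \<open>\<delta>\<close> must vanish, since a nonzero value
    could be rescaled to half a period. The point of level 1 on the line of \<open>\<beta>\<close>
    then makes the remaining factor an integer multiple of \<open>2 * pi\<close>.\<close>
  have agree: "R \<xi> \<eta>" if eq: "\<And>x. x \<in> \<Gamma> \<Longrightarrow> cis (\<xi> \<bullet> x) = cis (\<eta> \<bullet> x)" for \<xi> \<eta>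
  proof -
    define \<delta> where "\<delta> = \<eta> - \<xi>"
    have \<delta>: "\<delta> \<bullet> x / (2 * pi) \<in> \<int>" if "x \<in> \<Gamma>" for x
    proof -
      have "cis (\<delta> \<bullet> x) = cis (\<eta> \<bullet> x) / cis (\<xi> \<bullet> x)"
        by (simp only: \<delta>_def inner_diff_left cis_divide)
      then have "cis (\<delta> \<bullet> x) = 1" using eq[OF that] by simp
      then show ?thesis by (simp add: cis_eq_1_iff)
    qed
    have orth: "\<delta> \<bullet> x = 0" if "x \<bullet> \<beta> = 0" for x
    proof (rule ccontr)
      assume "\<delta> \<bullet> x \<noteq> 0"
      then have "\<delta> \<bullet> ((pi / (\<delta> \<bullet> x)) *\<^sub>R x) / (2 * pi) = 1 / 2" by simp
      moreover have "(pi / (\<delta> \<bullet> x)) *\<^sub>R x \<in> \<Gamma>" using that by (simp add: \<Gamma>_def)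
      ultimately have "(1 / 2 :: real) \<in> \<int>" using \<delta> by metis
      then obtain n :: int where "real_of_int n * 2 = 1" by (auto simp: Ints_def field_simps)
      then have "real_of_int (n * 2) = real_of_int 1" by simp
      then have "n * 2 = 1" by (simp only: of_int_eq_iff)
      then show False by presburger
    qed
    define s where "s = \<delta> \<bullet> \<beta> / (\<beta> \<bullet> \<beta>)"
    have "(\<delta> - s *\<^sub>R \<beta>) \<bullet> \<beta> = 0" using \<beta> by (simp add: s_def inner_diff_left)
    then have "\<beta> \<bullet> (\<delta> - s *\<^sub>R \<beta>) = 0" "\<delta> \<bullet> (\<delta> - s *\<^sub>R \<beta>) = 0"
      using orth[of "\<delta> - s *\<^sub>R \<beta>"] by (auto simp: inner_commute)
    then have "(\<delta> - s *\<^sub>R \<beta>) \<bullet> (\<delta> - s *\<^sub>R \<beta>) = 0"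
      by (simp only: inner_diff_left inner_scaleR_left)
    then have \<delta>s: "\<delta> = s *\<^sub>R \<beta>" by simp
    have "((1 / (\<beta> \<bullet> \<beta>)) *\<^sub>R \<beta>) \<in> \<Gamma>" using \<beta> by (simp add: \<Gamma>_def)
    from \<delta>[OF this] have "s / (2 * pi) \<in> \<int>" using \<beta> by (simp add: \<delta>s)
    then obtain n :: int where "s = 2 * pi * of_int n" by (auto simp: Ints_def field_simps)
    then show ?thesis unfolding R_def using \<delta>s by (auto simp: \<delta>_def algebra_simps intro!: exI[of _ n])
  qed
  define S where "S = {\<xi>. coef f \<xi> \<noteq> 0}"
  have S: "finite S" unfolding S_def by (rule finite_coef[OF f])
  have fS: "f x = (\<Sum>\<xi>\<in>S. coef f \<xi> * cis (\<xi> \<bullet> x))" for x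
    by (subst trig_sum_coef[OF f, symmetric]) (simp add: trig_sum_def S_def)
  have class0: "(\<Sum>\<xi> | \<xi> \<in> S \<and> r \<xi> = \<zeta>. coef f \<xi>) = 0" if \<zeta>: "\<zeta> \<in> r ` S" for \<zeta>
  proof -
    obtain \<eta> where \<eta>: "\<eta> \<in> S" "\<zeta> = r \<eta>" using \<zeta> by auto
    have "(\<Sum>\<xi> | \<xi> \<in> S \<and> (\<forall>x\<in>\<Gamma>. cis (\<xi> \<bullet> x) = cis (\<eta> \<bullet> x)). coef f \<xi>) = 0"
      by (rule char_indep[OF S, of \<Gamma> _ 0])
        (use zero in \<open>auto simp: \<Gamma>_def inner_simps cis_mult fS[symmetric]\<close>)
    moreover have "(\<forall>x\<in>\<Gamma>. cis (\<xi> \<bullet> x) = cis (\<eta> \<bullet> x)) \<longleftrightarrow> r \<xi> = \<zeta>" for \<xi>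
    proof
      assume "\<forall>x\<in>\<Gamma>. cis (\<xi> \<bullet> x) = cis (\<eta> \<bullet> x)"
      then show "r \<xi> = \<zeta>" using agree[of \<xi> \<eta>] r_eq \<eta> by auto
    next
      assume "r \<xi> = \<zeta>"
      then have "R \<eta> \<xi>" using R_trans[OF R_sym[OF r[of \<eta>]], of \<xi>] r[of \<xi>] \<eta> by simp
      then obtain n :: int where n: "\<xi> = \<eta> + (2 * pi * of_int n) *\<^sub>R \<beta>" unfolding R_def by auto
      show "\<forall>x\<in>\<Gamma>. cis (\<xi> \<bullet> x) = cis (\<eta> \<bullet> x)"
      proof
        fix x assume "x \<in> \<Gamma>"
        then obtain m :: int where "x \<bullet> \<beta> = of_int m" by (auto simp: \<Gamma>_def Ints_def)
        then have "cis (\<xi> \<bullet> x) = cis (\<eta> \<bullet> x) * cis (2 * pi * of_int (n * m))"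
          by (simp add: n inner_simps inner_commute[of \<beta>] cis_mult algebra_simps)
        then show "cis (\<xi> \<bullet> x) = cis (\<eta> \<bullet> x)"
          by (simp add: cis_eq_1_iff[THEN iffD2])
      qed
    qed
    ultimately show ?thesis by simp
  qed
  \<comment> \<open>Subtracting the class representatives changes nothing, since the coefficients of
    each class add up to 0.\<close>
  have "f = (\<lambda>x. \<Sum>\<xi>\<in>S. coef f \<xi> * (cis (\<xi> \<bullet> x) - cis (r \<xi> \<bullet> x)))"
  proof
    fix x
    have "(\<Sum>\<xi>\<in>S. coef f \<xi> * cis (r \<xi> \<bullet> x))
        = (\<Sum>\<zeta>\<in>r ` S. \<Sum>\<xi> | \<xi> \<in> S \<and> r \<xi> = \<zeta>. coef f \<xi> * cis (r \<xi> \<bullet> x))"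
      by (rule sum.image_gen[OF S])
    also have "\<dots> = (\<Sum>\<zeta>\<in>r ` S. (\<Sum>\<xi> | \<xi> \<in> S \<and> r \<xi> = \<zeta>. coef f \<xi>) * cis (\<zeta> \<bullet> x))"
      by (auto simp: sum_distrib_right intro!: sum.cong)
    also have "\<dots> = 0" using class0 by simp
    finally show "f x = (\<Sum>\<xi>\<in>S. coef f \<xi> * (cis (\<xi> \<bullet> x) - cis (r \<xi> \<bullet> x)))"
      by (simp add: fS right_diff_distrib sum_subtractf)
  qed
  moreover have "(\<lambda>x. \<Sum>\<xi>\<in>S. coef f \<xi> * (cis (\<xi> \<bullet> x) - cis (r \<xi> \<bullet> x))) \<in> D"
    using S
  proof (induction S rule: finite_induct)
    case empty
    then show ?case using D0 by simp
  next
    case (insert \<xi> S)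
    obtain n where n: "\<xi> = r \<xi> + (2 * pi * of_int n) *\<^sub>R \<beta>" using r[of \<xi>] unfolding R_def by auto
    have "(\<lambda>x. cis (\<xi> \<bullet> x) - cis (r \<xi> \<bullet> x)) \<in> D"
      using tele[of n "r \<xi>"] unfolding e_def n[symmetric] by simp
    from D_lincomb[OF this insert.IH, of "coef f \<xi>" 1] show ?case using insert by simp
  qed
  ultimately have "f \<in> D" by (simp only:)
  then obtain g where "g \<in> trig_polynomials" "f = (\<lambda>x. complex_of_real (sin (pi * (x \<bullet> \<beta>))) * g x)"
    unfolding D_def by blast
  then show ?thesis by (intro that[of g]) simp_all
qed

section \<open>Laplacian and heat flow\<close>

lemma has_derivative_tp:
  assumes "f \<in> trig_polynomials"
  shows "(f has_derivative (\<lambda>h. \<Sum>\<xi> | coef f \<xi> \<noteq> 0. coef f \<xi> * (\<i> * of_real (\<xi> \<bullet> h)) * cis (\<xi> \<bullet> x))) (at x)"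
proof -
  have "f = (\<lambda>x. \<Sum>\<xi> | coef f \<xi> \<noteq> 0. coef f \<xi> * exp (\<i> * of_real (\<xi> \<bullet> x)))"
    using trig_sum_coef[OF assms] by (simp add: trig_sum_def cis_conv_exp fun_eq_iff)
  moreover have "((\<lambda>x. \<Sum>\<xi> | coef f \<xi> \<noteq> 0. coef f \<xi> * exp (\<i> * of_real (\<xi> \<bullet> x))) has_derivative
      (\<lambda>h. \<Sum>\<xi> | coef f \<xi> \<noteq> 0. coef f \<xi> * (\<i> * of_real (\<xi> \<bullet> h)) * cis (\<xi> \<bullet> x))) (at x)"
  proof (rule has_derivative_sum)
    fix \<xi>
    have "((\<lambda>x. \<i> * complex_of_real (\<xi> \<bullet> x)) has_derivative (\<lambda>h. \<i> * of_real (\<xi> \<bullet> h))) (at x)"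
      by (auto intro!: derivative_eq_intros)
    from has_derivative_compose[OF this DERIV_exp[THEN has_field_derivative_imp_has_derivative]]
    have "((\<lambda>x. exp (\<i> * complex_of_real (\<xi> \<bullet> x))) has_derivative
        (\<lambda>h. exp (\<i> * complex_of_real (\<xi> \<bullet> x)) * (\<i> * of_real (\<xi> \<bullet> h)))) (at x)" .
    from has_derivative_mult_right[OF this, of "coef f \<xi>"]
    show "((\<lambda>x. coef f \<xi> * exp (\<i> * of_real (\<xi> \<bullet> x))) has_derivative
      (\<lambda>h. coef f \<xi> * (\<i> * of_real (\<xi> \<bullet> h)) * cis (\<xi> \<bullet> x))) (at x)"
      by (simp add: cis_conv_exp mult_ac)
  qed
  ultimately show ?thesis by simp
qed

lemma finite_coef_mult: "f \<in> trig_polynomials \<Longrightarrow> finite {\<xi>. m \<xi> * coef f \<xi> \<noteq> 0}"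
  by (rule finite_subset[OF _ finite_coef[of f]]) auto

text \<open>Partial derivatives, the Laplacian and the heat flow are all Fourier multipliers of this
  form.\<close>

lemma tp_multiplier:
  assumes "f \<in> trig_polynomials"
  shows "trig_sum (\<lambda>\<xi>. m \<xi> * coef f \<xi>) \<in> trig_polynomials"
    and coef_multiplier: "coef (trig_sum (\<lambda>\<xi>. m \<xi> * coef f \<xi>)) = (\<lambda>\<xi>. m \<xi> * coef f \<xi>)"
  using finite_coef_mult[OF assms, of m] by (auto intro: trig_sum_polynomial coef_trig_sum)

lemma trig_sum_multiplier:
  assumes "f \<in> trig_polynomials"
  shows "trig_sum (\<lambda>\<xi>. m \<xi> * coef f \<xi>) x = (\<Sum>\<xi> | coef f \<xi> \<noteq> 0. m \<xi> * coef f \<xi> * cis (\<xi> \<bullet> x))"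
  by (rule trig_sum_superset[OF finite_coef[OF assms]]) auto

lemma partial_deriv_tp:
  assumes "f \<in> trig_polynomials"
  shows "partial_deriv b f = trig_sum (\<lambda>\<xi>. (\<i> * of_real (\<xi> \<bullet> b)) * coef f \<xi>)"
proof
  fix x
  show "partial_deriv b f x = trig_sum (\<lambda>\<xi>. (\<i> * of_real (\<xi> \<bullet> b)) * coef f \<xi>) x"
    unfolding partial_deriv_def frechet_derivative_at[OF has_derivative_tp[OF assms], symmetric]
    unfolding trig_sum_multiplier[OF assms] by (simp add: mult_ac)
qed

lemma tp_partial_deriv: "f \<in> trig_polynomials \<Longrightarrow> partial_deriv b f \<in> trig_polynomials"
  by (simp only: partial_deriv_tp tp_multiplier)

lemma laplacian_tp:
  assumes "f \<in> trig_polynomials"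
  shows "laplacian f = trig_sum (\<lambda>\<xi>. - of_real (\<xi> \<bullet> \<xi>) * coef f \<xi>)"
proof
  fix x
  have m: "- complex_of_real (\<xi> \<bullet> \<xi>) = (\<Sum>b\<in>Basis. \<i> * of_real (\<xi> \<bullet> b) * (\<i> * of_real (\<xi> \<bullet> b)))" for \<xi> :: 'a
    by (subst euclidean_inner) (simp add: algebra_simps sum_negf flip: of_real_mult)
  have "laplacian f x = (\<Sum>b\<in>Basis. trig_sum (\<lambda>\<xi>. (\<i> * of_real (\<xi> \<bullet> b)) * ((\<i> * of_real (\<xi> \<bullet> b)) * coef f \<xi>)) x)"
    unfolding laplacian_def
    by (simp add: partial_deriv_tp assms tp_multiplier coef_multiplier)
  also have "\<dots> = (\<Sum>b\<in>Basis. trig_sum (\<lambda>\<xi>. (\<i> * of_real (\<xi> \<bullet> b) * (\<i> * of_real (\<xi> \<bullet> b))) * coef f \<xi>) x)"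
    by (simp only: mult.assoc)
  also have "\<dots> = trig_sum (\<lambda>\<xi>. - of_real (\<xi> \<bullet> \<xi>) * coef f \<xi>) x"
    unfolding trig_sum_multiplier[OF assms] m
    by (subst sum.swap) (simp only: sum_distrib_right)
  finally show "laplacian f x = trig_sum (\<lambda>\<xi>. - of_real (\<xi> \<bullet> \<xi>) * coef f \<xi>) x" .
qed

lemma tp_laplacian: "f \<in> trig_polynomials \<Longrightarrow> laplacian f \<in> trig_polynomials"
  and coef_laplacian: "f \<in> trig_polynomials \<Longrightarrow> coef (laplacian f) = (\<lambda>\<xi>. - of_real (\<xi> \<bullet> \<xi>) * coef f \<xi>)"
  by (simp_all only: laplacian_tp tp_multiplier coef_multiplier)

lemma tp_differentiable_on: "f \<in> trig_polynomials \<Longrightarrow> f differentiable_on S"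
  by (meson differentiable_at_imp_differentiable_on differentiableI has_derivative_tp)

lemma C2_on_tp: "f \<in> trig_polynomials \<Longrightarrow> C2_on S f"
  unfolding C2_on_def
  by (simp add: tp_partial_deriv tp_differentiable_on continuous_on_tp)

lemma has_vector_derivative_line:
  assumes "f differentiable (at (x + s *\<^sub>R b))"
  shows "((\<lambda>s. f (x + s *\<^sub>R b)) has_vector_derivative partial_deriv b f (x + s *\<^sub>R b)) (at s)"
proof -
  let ?y = "x + s *\<^sub>R b"
  have D: "(f has_derivative frechet_derivative f (at ?y)) (at ?y)"
    using assms by (simp add: frechet_derivative_works)
  have "((\<lambda>s. x + s *\<^sub>R b) has_derivative (\<lambda>h. h *\<^sub>R b)) (at s)"
    by (auto intro!: derivative_eq_intros)
  from diff_chain_at[OF this D]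
  have "((\<lambda>s. f (x + s *\<^sub>R b)) has_derivative (\<lambda>h. frechet_derivative f (at ?y) (h *\<^sub>R b))) (at s)"
    by (simp add: o_def)
  then show ?thesis
    unfolding has_vector_derivative_def partial_deriv_def
    using linear_frechet_derivative[OF assms] by (simp add: linear_cmul)
qed

text \<open>With \<open>m > 0\<close> the derivative, which is 0 at the maximum, would be positive
  just to the right, and the mean value theorem would give larger values there.\<close>

lemma second_derivative_nonpos_at_max:
  fixes \<phi> \<phi>' :: "real \<Rightarrow> real"
  assumes "r > 0" and \<phi>: "\<And>s. \<bar>s\<bar> < r \<Longrightarrow> (\<phi> has_real_derivative \<phi>' s) (at s)"
    and \<phi>': "(\<phi>' has_real_derivative m) (at 0)"
    and max: "\<And>s. \<bar>s\<bar> < r \<Longrightarrow> \<phi> s \<le> \<phi> 0"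
  shows "m \<le> 0"
proof (rule ccontr)
  assume "\<not> m \<le> 0"
  then obtain d where d: "d > 0" "\<And>h. 0 < h \<Longrightarrow> h < d \<Longrightarrow> \<phi>' 0 < \<phi>' h"
    using DERIV_pos_inc_right[OF \<phi>'] by auto
  have 0: "\<phi>' 0 = 0"
    by (rule DERIV_local_max[OF \<phi>[of 0] \<open>r > 0\<close>]) (use \<open>r > 0\<close> max in auto)
  define s where "s = min d r / 2"
  have s: "0 < s" "s < d" "s < r" using d \<open>r > 0\<close> by (auto simp: s_def)
  obtain z where z: "0 < z" "z < s" "\<phi> s - \<phi> 0 = (s - 0) * \<phi>' z"
    using MVT2[of 0 s \<phi> \<phi>'] s \<phi> by auto
  then have "\<phi> s - \<phi> 0 > 0" using d(2)[of z] s 0 by simp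
  then show False using max[of s] s by simp
qed

text \<open>The solution of the heat equation with initial value \<open>f\<close>. The finite sum
  makes sense for negative times too, so time derivatives are two-sided.\<close>

definition heat :: "real \<Rightarrow> ('a::euclidean_space \<Rightarrow> complex) \<Rightarrow> 'a \<Rightarrow> complex" where
  "heat t f = trig_sum (\<lambda>\<xi>. of_real (exp (- (t * (\<xi> \<bullet> \<xi>)))) * coef f \<xi>)"

lemma tp_heat: "f \<in> trig_polynomials \<Longrightarrow> heat t f \<in> trig_polynomials"
  and coef_heat: "f \<in> trig_polynomials \<Longrightarrow> coef (heat t f) = (\<lambda>\<xi>. of_real (exp (- (t * (\<xi> \<bullet> \<xi>)))) * coef f \<xi>)"
  unfolding heat_def by (auto simp: tp_multiplier coef_multiplier)

lemma heat_0: "f \<in> trig_polynomials \<Longrightarrow> heat 0 f = f"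
  by (simp add: heat_def trig_sum_coef)

lemma heat_eq_sum:
  assumes "f \<in> trig_polynomials"
  shows "heat t f x = (\<Sum>\<xi> | coef f \<xi> \<noteq> 0. of_real (exp (- (t * (\<xi> \<bullet> \<xi>)))) * coef f \<xi> * cis (\<xi> \<bullet> x))"
  unfolding heat_def by (rule trig_sum_multiplier[OF assms])

lemma heat_has_derivative:
  assumes "f \<in> trig_polynomials"
  shows "((\<lambda>t. heat t f x) has_vector_derivative laplacian (heat t f) x) (at t)"
proof -
  have "((\<lambda>t. \<Sum>\<xi> | coef f \<xi> \<noteq> 0. of_real (exp (- (t * (\<xi> \<bullet> \<xi>)))) * coef f \<xi> * cis (\<xi> \<bullet> x)) has_vector_derivative
     (\<Sum>\<xi> | coef f \<xi> \<noteq> 0. of_real (exp (- (t * (\<xi> \<bullet> \<xi>))) * - (\<xi> \<bullet> \<xi>)) * coef f \<xi> * cis (\<xi> \<bullet> x))) (at t)"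
    by (rule has_vector_derivative_sum, intro has_vector_derivative_mult_left has_vector_derivative_of_real)
      (auto intro!: derivative_eq_intros)
  moreover have "laplacian (heat t f) x =
     (\<Sum>\<xi> | coef f \<xi> \<noteq> 0. of_real (exp (- (t * (\<xi> \<bullet> \<xi>))) * - (\<xi> \<bullet> \<xi>)) * coef f \<xi> * cis (\<xi> \<bullet> x))"
  proof -
    have "laplacian (heat t f) x = trig_sum (\<lambda>\<xi>. (- of_real (\<xi> \<bullet> \<xi>) * of_real (exp (- (t * (\<xi> \<bullet> \<xi>))))) * coef f \<xi>) x"
      unfolding laplacian_tp[OF tp_heat[OF assms]] coef_heat[OF assms] by (simp only: mult.assoc)
    then show ?thesis unfolding trig_sum_multiplier[OF assms] by (simp add: mult_ac)
  qed
  ultimately show ?thesis by (simp add: heat_eq_sum[OF assms])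
qed

lemma exp_has_derivative:
  "((\<lambda>t. exp (- \<mu> * complex_of_real t)) has_vector_derivative (- \<mu> * exp (- \<mu> * of_real t))) (at t)"
proof -
  have "((\<lambda>z. exp (- \<mu> * z)) has_field_derivative (- \<mu> * exp (- \<mu> * of_real t))) (at (of_real t))"
    by (auto intro!: derivative_eq_intros)
  from has_vector_derivative_real_field[OF this] show ?thesis .
qed

text \<open>At an interior maximum of the difference minus \<open>\<delta> t\<close>, the heat equation contradicts the
  second derivative test.\<close>

lemma heat_maximum_principle:
  fixes A :: "'a::euclidean_space set"
  assumes A: "open A" "bounded A" and v: "dirichlet_eigenpair A \<mu> v" and p: "p \<in> trig_polynomials"
    and bd: "\<And>t x. x \<in> frontier A \<Longrightarrow> heat t p x = 0"
    and init: "\<And>x. x \<in> closure A \<Longrightarrow> norm (p x - v x) \<le> \<epsilon>"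
    and x: "x \<in> closure A" "t \<ge> 0"
  shows "norm (heat t p x - exp (- \<mu> * of_real t) * v x) \<le> \<epsilon>"
proof -
  define G where "G t x = heat t p x - exp (- \<mu> * of_real t) * v x" for t x
  have \<epsilon>: "\<epsilon> \<ge> 0" using init[OF x(1)] norm_ge_zero order_trans by blast
  \<comment> \<open>A maximum principle needs real values; the unit factor \<open>\<theta>\<close>
    is later chosen to turn the complex difference into its modulus.\<close>
  have main: "Re (\<theta> * G t x) \<le> \<epsilon>" if \<theta>: "norm \<theta> = 1" for \<theta>
  proof (rule ccontr)
    assume neg: "\<not> ?thesis"
    \<comment> \<open>Small enough that subtracting \<open>\<delta> * t\<close> costs less than the
      excess over \<open>\<epsilon>\<close>; the summand 1 covers \<open>t = 0\<close>.\<close>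
    define \<delta> where "\<delta> = (Re (\<theta> * G t x) - \<epsilon>) / (2 * (t + 1))"
    have \<delta>: "\<delta> > 0" using neg x(2) by (simp add: \<delta>_def)
    have "\<delta> * t \<le> \<delta> * (t + 1)" using \<delta> by simp
    also have "\<dots> = (Re (\<theta> * G t x) - \<epsilon>) / 2"
      unfolding \<delta>_def using x(2) by (simp add: divide_simps del: times_complex.sel)
    also have "\<dots> < Re (\<theta> * G t x) - \<epsilon>" using neg by simp
    finally have big: "Re (\<theta> * G t x) - \<delta> * t > \<epsilon>" by simp
    define K where "K = closure A \<times> {0..t}"
    have "compact K" unfolding K_def using A by (intro compact_Times) auto
    moreover have "K \<noteq> {}" using x by (auto simp: K_def)
    moreover have "continuous_on K (\<lambda>z. Re (\<theta> * G (snd z) (fst z)) - \<delta> * snd z)"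
    proof -
      have "continuous_on (closure A) v" using v by (simp add: dirichlet_eigenpair_def)
      then have "continuous_on K (\<lambda>z. v (fst z))"
        by (rule continuous_on_compose2[OF _ continuous_on_fst[OF continuous_on_id]]) (auto simp: K_def)
      then show ?thesis
        unfolding G_def heat_eq_sum[OF p] cis_conv_exp by (intro continuous_intros)
    qed
    ultimately obtain z where z: "z \<in> K"
      and zmax: "\<And>y. y \<in> K \<Longrightarrow> Re (\<theta> * G (snd y) (fst y)) - \<delta> * snd y \<le> Re (\<theta> * G (snd z) (fst z)) - \<delta> * snd z"
      using continuous_attains_sup by meson
    define y s where "y = fst z" and "s = snd z"
    have ys: "y \<in> closure A" "0 \<le> s" "s \<le> t" using z by (auto simp: K_def y_def s_def)
    have max: "Re (\<theta> * G s' y') - \<delta> * s' \<le> Re (\<theta> * G s y) - \<delta> * s"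
      if "y' \<in> closure A" "0 \<le> s'" "s' \<le> t" for y' s'
      using zmax[of "(y', s')"] that by (auto simp: K_def y_def s_def)
    have gt: "Re (\<theta> * G s y) - \<delta> * s > \<epsilon>" using max[of x t] big x by simp
    have "s \<noteq> 0"
    proof
      assume "s = 0"
      then have "Re (\<theta> * (p y - v y)) > \<epsilon>" using gt by (simp add: G_def heat_0 p)
      moreover have "Re (\<theta> * (p y - v y)) \<le> norm (\<theta> * (p y - v y))" by (rule complex_Re_le_cmod)
      ultimately show False using init[OF ys(1)] \<theta> by (simp add: norm_mult)
    qed
    then have s: "s > 0" using ys by simp
    have "y \<notin> frontier A"
    proof
      assume "y \<in> frontier A"
      then have "G s y = 0" using bd v by (simp add: G_def dirichlet_eigenpair_def)
      then have "\<delta> * s < 0" using gt \<epsilon> by simp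
      then show False using \<delta> s by (simp add: mult_less_0_iff)
    qed
    then have y: "y \<in> A" using ys A by (auto simp: frontier_def interior_open)
    obtain r where r: "r > 0" "ball y r \<subseteq> A" using A y openE by blast
    define k where "k = exp (- \<mu> * of_real s)"
    let ?q = "heat s p"
    have q: "?q \<in> trig_polynomials" by (rule tp_heat[OF p])
    have C2: "C2_on A v" using v by (simp add: dirichlet_eigenpair_def)
    have d1: "f differentiable (at y')" if "f differentiable_on A" "y' \<in> A" for f :: "'a \<Rightarrow> complex" and y'
      using that by (simp add: differentiable_on_eq_differentiable_at[OF A(1)])
    \<comment> \<open>Each coordinate line through the interior maximum \<open>y\<close> gives a
      nonpositive second derivative; they are added up to the Laplacian below.\<close>
    have second: "Re (\<theta> * (partial_deriv b (partial_deriv b ?q) y - k * partial_deriv b (partial_deriv b v) y)) \<le> 0"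
      if b: "b \<in> Basis" for b
    proof (rule second_derivative_nonpos_at_max[OF r(1)])
      have inA: "y + s' *\<^sub>R b \<in> A" if "\<bar>s'\<bar> < r" for s'
        using r(2) that b by (auto simp: dist_norm subset_iff)
      let ?\<phi> = "\<lambda>s'. Re (\<theta> * G s (y + s' *\<^sub>R b))"
      let ?\<phi>' = "\<lambda>s'. Re (\<theta> * (partial_deriv b ?q (y + s' *\<^sub>R b) - k * partial_deriv b v (y + s' *\<^sub>R b)))"
      show "(?\<phi> has_real_derivative ?\<phi>' s') (at s')" if "\<bar>s'\<bar> < r" for s'
        unfolding G_def k_def[symmetric] has_real_derivative_iff_has_vector_derivative
        by (intro bounded_linear.has_vector_derivative[OF bounded_linear_Re] has_vector_derivative_mult_right
             has_vector_derivative_diff has_vector_derivative_line d1[OF _ inA[OF that]] tp_differentiable_on[OF q])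
          (use C2 in \<open>auto simp: C2_on_def\<close>)
      have "y + 0 *\<^sub>R b \<in> A" using y by simp
      then have "(?\<phi>' has_real_derivative Re (\<theta> * (partial_deriv b (partial_deriv b ?q) (y + 0 *\<^sub>R b)
          - k * partial_deriv b (partial_deriv b v) (y + 0 *\<^sub>R b)))) (at 0)"
        unfolding has_real_derivative_iff_has_vector_derivative
        by (intro bounded_linear.has_vector_derivative[OF bounded_linear_Re] has_vector_derivative_mult_right
             has_vector_derivative_diff has_vector_derivative_line d1)
          (use C2 b q in \<open>auto simp: C2_on_def intro!: tp_differentiable_on tp_partial_deriv\<close>)
      then show "(?\<phi>' has_real_derivative Re (\<theta> * (partial_deriv b (partial_deriv b ?q) y - k * partial_deriv b (partial_deriv b v) y))) (at 0)"
        by simp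
      show "?\<phi> s' \<le> ?\<phi> 0" if "\<bar>s'\<bar> < r" for s'
        using max[of "y + s' *\<^sub>R b" s] inA[OF that] closure_subset[of A] ys by auto
    qed
    have "(\<Sum>b\<in>Basis. Re (\<theta> * (partial_deriv b (partial_deriv b ?q) y - k * partial_deriv b (partial_deriv b v) y))) \<le> 0"
      by (rule sum_nonpos) (rule second)
    also have "(\<Sum>b\<in>Basis. Re (\<theta> * (partial_deriv b (partial_deriv b ?q) y - k * partial_deriv b (partial_deriv b v) y)))
      = Re (\<theta> * (laplacian ?q y - k * laplacian v y))"
      unfolding laplacian_def Re_sum[symmetric] sum_distrib_left sum_subtractf[symmetric] by simp
    also have "- laplacian v y = \<mu> * v y" using v y by (simp add: dirichlet_eigenpair_def)
    then have lv: "laplacian v y = - (\<mu> * v y)" by (metis minus_minus)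
    finally have lap: "Re (\<theta> * (laplacian ?q y + k * \<mu> * v y)) \<le> 0" by (simp add: lv algebra_simps)
    \<comment> \<open>The time derivative at the maximum: the heat equation turns it into the
      nonpositive Laplacian term minus \<open>\<delta>\<close>, hence it is negative.\<close>
    define l where "l = Re (\<theta> * (laplacian ?q y - - \<mu> * exp (- \<mu> * of_real s) * v y)) - \<delta>"
    have "((\<lambda>s. Re (\<theta> * G s y) - \<delta> * s) has_real_derivative l) (at s)"
    proof -
      have "((\<lambda>s. Re (\<theta> * G s y)) has_real_derivative
          Re (\<theta> * (laplacian ?q y - - \<mu> * exp (- \<mu> * of_real s) * v y))) (at s)"
        unfolding has_real_derivative_iff_has_vector_derivative G_def
        by (intro bounded_linear.has_vector_derivative[OF bounded_linear_Re] has_vector_derivative_mult_right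
            has_vector_derivative_mult_left has_vector_derivative_diff heat_has_derivative[OF p] exp_has_derivative)
      from DERIV_diff[OF this DERIV_cmult[OF DERIV_ident, of \<delta>]]
      show ?thesis by (simp only: l_def mult_1_right)
    qed
    moreover have "l < 0" using lap \<delta> by (simp add: l_def k_def mult_ac)
    \<comment> \<open>The contradiction is sought at an earlier time, because \<open>s\<close> may
      be the final time \<open>t\<close>.\<close>
    ultimately obtain d where d: "d > 0"
      "\<And>h. 0 < h \<Longrightarrow> h < d \<Longrightarrow> Re (\<theta> * G s y) - \<delta> * s < Re (\<theta> * G (s - h) y) - \<delta> * (s - h)"
      using DERIV_neg_dec_left by meson
    define h where "h = min d s / 2"
    have "0 < h" "h < d" "h < s" using d s by (auto simp: h_def)
    then show False using d(2)[of h] max[of y "s - h"] ys by simp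
  qed
  show ?thesis
  proof (cases "G t x = 0")
    case True
    then show ?thesis using \<epsilon> by (simp add: G_def)
  next
    case False
    have "Re (cnj (sgn (G t x)) * G t x) \<le> \<epsilon>" using False by (intro main) (simp add: norm_sgn)
    also have "cnj (sgn (G t x)) * G t x = of_real (norm (G t x))"
    proof -
      have "cnj (sgn (G t x)) * G t x = (G t x * cnj (G t x)) / of_real (norm (G t x))"
        by (simp add: sgn_eq)
      then show ?thesis using False by (simp add: complex_norm_square[symmetric] power2_eq_square)
    qed
    finally show ?thesis by (simp add: G_def)
  qed
qed

section \<open>Affine reflections and galleries\<close>

definition coroot :: "'a::euclidean_space \<Rightarrow> 'a" where
  "coroot \<alpha> = (2 / (\<alpha> \<bullet> \<alpha>)) *\<^sub>R \<alpha>"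

definition aff_refl :: "'a::euclidean_space \<Rightarrow> int \<Rightarrow> 'a \<Rightarrow> 'a" where
  "aff_refl \<alpha> k x = x - (x \<bullet> \<alpha> - of_int k) *\<^sub>R coroot \<alpha>"

text \<open>Points on the hyperplane count as lying on its lower side, so replacing
  \<open>(\<alpha>, k)\<close> by \<open>(- \<alpha>, - k)\<close> is harmless only for points off
  the hyperplane.\<close>

definition sep :: "'a::euclidean_space \<Rightarrow> int \<Rightarrow> 'a \<Rightarrow> 'a \<Rightarrow> bool" where
  "sep \<alpha> k x y \<longleftrightarrow> (of_int k < x \<bullet> \<alpha>) \<noteq> (of_int k < y \<bullet> \<alpha>)"

text \<open>In a reduced root system each hyperplane has exactly the two labels
  \<open>(\<alpha>, k)\<close> and \<open>(- \<alpha>, - k)\<close>.\<close>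

definition same_hyp :: "'a::euclidean_space \<Rightarrow> int \<Rightarrow> 'a \<Rightarrow> int \<Rightarrow> bool" where
  "same_hyp \<alpha> k \<beta> m \<longleftrightarrow> \<alpha> = \<beta> \<and> k = m \<or> \<alpha> = - \<beta> \<and> k = - m"

text \<open>The level of the hyperplane to which reflection in \<open>(\<beta>, m)\<close> carries
  \<open>(\<alpha>, k)\<close>, its root being \<open>aff_refl \<beta> 0 \<alpha>\<close>. For roots
  the argument of the floor is an integer; the floor only provides the type.\<close>

definition refl_level :: "'a::euclidean_space \<Rightarrow> int \<Rightarrow> 'a \<Rightarrow> int \<Rightarrow> int" where
  "refl_level \<beta> m \<alpha> k = k - m * \<lfloor>coroot \<beta> \<bullet> \<alpha>\<rfloor>"

lemma coroot_uminus [simp]: "coroot (- \<alpha>) = - coroot \<alpha>"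
  by (simp add: coroot_def)

lemma coroot_inner_self: "\<alpha> \<noteq> 0 \<Longrightarrow> coroot \<alpha> \<bullet> \<alpha> = 2"
  by (simp add: coroot_def)

lemma aff_refl_uminus: "aff_refl (- \<alpha>) (- k) = aff_refl \<alpha> k"
  by (rule ext) (simp add: aff_refl_def algebra_simps)

lemma aff_refl_same: "same_hyp \<alpha> k \<beta> m \<Longrightarrow> aff_refl \<alpha> k = aff_refl \<beta> m"
  by (auto simp: same_hyp_def aff_refl_uminus)

lemma aff_refl_inner:
  "aff_refl \<alpha> k x \<bullet> \<beta> = x \<bullet> aff_refl \<alpha> 0 \<beta> + of_int k * (coroot \<alpha> \<bullet> \<beta>)"
  by (simp add: aff_refl_def coroot_def inner_diff_left inner_diff_right inner_commute algebra_simps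
      diff_divide_distrib)

lemma aff_refl_inner_self: "\<alpha> \<noteq> 0 \<Longrightarrow> aff_refl \<alpha> k x \<bullet> \<alpha> = 2 * of_int k - x \<bullet> \<alpha>"
  by (simp add: aff_refl_def inner_diff_left coroot_inner_self)

lemma aff_refl_fixed: "x \<bullet> \<alpha> = of_int k \<Longrightarrow> aff_refl \<alpha> k x = x"
  by (simp add: aff_refl_def)

lemma aff_refl_invol [simp]:
  assumes "\<alpha> \<noteq> 0" shows "aff_refl \<alpha> k (aff_refl \<alpha> k x) = x"
proof -
  have "aff_refl \<alpha> k (aff_refl \<alpha> k x) = aff_refl \<alpha> k x - (aff_refl \<alpha> k x \<bullet> \<alpha> - of_int k) *\<^sub>R coroot \<alpha>"
    by (simp add: aff_refl_def[of \<alpha> k "aff_refl \<alpha> k x"])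
  also have "\<dots> = aff_refl \<alpha> k x + (x \<bullet> \<alpha> - of_int k) *\<^sub>R coroot \<alpha>"
  proof -
    have "aff_refl \<alpha> k x \<bullet> \<alpha> - of_int k = - (x \<bullet> \<alpha> - of_int k)"
      using aff_refl_inner_self[OF assms, of k x] by simp
    then show ?thesis by (simp only: scaleR_minus_left diff_minus_eq_add)
  qed
  finally show ?thesis by (simp add: aff_refl_def)
qed

lemma linear_refl: "linear (aff_refl \<alpha> 0)"
  by (rule linearI) (simp_all add: aff_refl_def inner_add_left algebra_simps)

lemma aff_refl_eq: "aff_refl \<alpha> k x = aff_refl \<alpha> 0 x + of_int k *\<^sub>R coroot \<alpha>"
  by (simp add: aff_refl_def algebra_simps)

lemma refl_adjoint: "aff_refl \<alpha> 0 x \<bullet> y = x \<bullet> aff_refl \<alpha> 0 y"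
  using aff_refl_inner[of \<alpha> 0 x y] by simp

lemma refl_inner: "\<alpha> \<noteq> 0 \<Longrightarrow> aff_refl \<alpha> 0 x \<bullet> aff_refl \<alpha> 0 y = x \<bullet> y"
  by (simp add: refl_adjoint)

lemma norm_refl: "\<alpha> \<noteq> 0 \<Longrightarrow> norm (aff_refl \<alpha> 0 x) = norm x"
  by (simp add: norm_eq_sqrt_inner refl_inner)

lemma aff_refl_diff: "aff_refl \<alpha> k x - aff_refl \<alpha> k y = aff_refl \<alpha> 0 (x - y)"
  by (simp add: aff_refl_eq[of \<alpha> k] linear_diff[OF linear_refl])

lemma dist_aff_refl: "\<alpha> \<noteq> 0 \<Longrightarrow> dist (aff_refl \<alpha> k x) (aff_refl \<alpha> k y) = dist x y"
  by (simp add: dist_norm aff_refl_diff norm_refl)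

lemma refl_coroot: "\<beta> \<noteq> 0 \<Longrightarrow> aff_refl \<beta> 0 (coroot \<alpha>) = coroot (aff_refl \<beta> 0 \<alpha>)"
  by (simp add: coroot_def[of \<alpha>] coroot_def[of "aff_refl \<beta> 0 \<alpha>"] refl_inner linear_cmul[OF linear_refl])

text \<open>Conjugating a reflection by an isometry gives the reflection in the image hyperplane;
  the second assumption says that \<open>m'\<close> is the level of that image.\<close>

lemma aff_refl_conj:
  assumes "\<gamma> \<noteq> 0" and "\<And>x. aff_refl \<gamma> l x \<bullet> aff_refl \<gamma> 0 \<beta> - of_int m' = x \<bullet> \<beta> - of_int m"
  shows "aff_refl \<gamma> l (aff_refl \<beta> m x) = aff_refl (aff_refl \<gamma> 0 \<beta>) m' (aff_refl \<gamma> l x)"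
proof -
  have "aff_refl \<gamma> l (aff_refl \<beta> m x) = aff_refl \<gamma> l x - aff_refl \<gamma> 0 ((x \<bullet> \<beta> - of_int m) *\<^sub>R coroot \<beta>)"
    using aff_refl_diff[of \<gamma> l x "aff_refl \<beta> m x"] by (simp add: aff_refl_def[of \<beta>] algebra_simps)
  then show ?thesis
    by (simp add: aff_refl_def[of "aff_refl \<gamma> 0 \<beta>"] assms linear_cmul[OF linear_refl] refl_coroot)
qed

text \<open>The squared distance changes by \<open>4 / (\<alpha> \<bullet> \<alpha>)\<close> times
  the product of the signed offsets of \<open>a\<close> and \<open>y\<close> from the hyperplane,
  which is negative when it separates them.\<close>

lemma dist_aff_refl_less:
  assumes "\<alpha> \<noteq> 0" "sep \<alpha> k a y" "a \<bullet> \<alpha> \<noteq> of_int k" "y \<bullet> \<alpha> \<noteq> of_int k"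
  shows "dist a (aff_refl \<alpha> k y) < dist a y"
proof -
  define f where "f = y \<bullet> \<alpha> - of_int k"
  have neg: "f * (a \<bullet> \<alpha> - of_int k) < 0"
    using assms by (auto simp: sep_def f_def mult_less_0_iff)
  have pos: "\<alpha> \<bullet> \<alpha> > 0" using assms by simp
  have "(norm (a - aff_refl \<alpha> k y))\<^sup>2 = (norm ((a - y) + (2 * f / (\<alpha> \<bullet> \<alpha>)) *\<^sub>R \<alpha>))\<^sup>2"
    by (simp add: aff_refl_def coroot_def f_def algebra_simps)
  also have "\<dots> = (norm (a - y))\<^sup>2 + 2 * (2 * f / (\<alpha> \<bullet> \<alpha>)) * ((a - y) \<bullet> \<alpha>) + (2 * f / (\<alpha> \<bullet> \<alpha>))\<^sup>2 * (\<alpha> \<bullet> \<alpha>)"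
    unfolding power2_norm_eq_inner
    by (simp add: inner_add_left inner_add_right inner_commute power2_eq_square)
  also have "\<dots> = (norm (a - y))\<^sup>2 + 4 / (\<alpha> \<bullet> \<alpha>) * (f * ((a - y) \<bullet> \<alpha>) + f * f)"
    using pos by (simp add: field_simps power2_eq_square)
  also have "f * ((a - y) \<bullet> \<alpha>) + f * f = f * (a \<bullet> \<alpha> - of_int k)"
    by (simp add: f_def inner_diff_left algebra_simps)
  also have "4 / (\<alpha> \<bullet> \<alpha>) * (f * (a \<bullet> \<alpha> - of_int k)) < 0" using neg pos by (simp add: mult_pos_neg divide_neg_pos)
  finally have "(norm (a - aff_refl \<alpha> k y))\<^sup>2 < (norm (a - y))\<^sup>2" by simp
  then show ?thesis unfolding dist_norm by (rule power2_less_imp_less) simp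
qed

text \<open>Countably many hyperplanes form a null set, and a nonempty open set is not null.\<close>

lemma generic_point:
  fixes U :: "'a::euclidean_space set"
  assumes "open U" "U \<noteq> {}" "countable I" and nz: "\<forall>i\<in>I. n i \<noteq> 0"
  shows "\<exists>x\<in>U. \<forall>i\<in>I. n i \<bullet> x \<noteq> (c i :: real)"
proof -
  have "negligible (\<Union>i\<in>I. {x. n i \<bullet> x = c i})"
  proof (rule negligible_countable_Union)
    show "countable ((\<lambda>i. {x. n i \<bullet> x = c i}) ` I)" using assms by simp
    fix N assume "N \<in> (\<lambda>i. {x. n i \<bullet> x = c i}) ` I"
    then obtain i where "i \<in> I" "N = {x. n i \<bullet> x = c i}" by auto
    then show "negligible N" using nz negligible_hyperplane by blast
  qed
  then have "\<not> U \<subseteq> (\<Union>i\<in>I. {x. n i \<bullet> x = c i})"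
    using assms open_not_negligible negligible_subset by blast
  then show ?thesis by blast
qed

lemma orthogonal_to_spanning:
  fixes s :: "'a::euclidean_space"
  assumes "span D = UNIV" "\<And>d. d \<in> D \<Longrightarrow> s \<bullet> d = 0"
  shows "s = 0"
proof -
  have "s \<bullet> s = 0"
    using span_induct[of s D "\<lambda>z. s \<bullet> z = 0"] assms by (auto simp: subspace_def inner_add_right)
  then show ?thesis by simp
qed

lemma finite_bounded_inner_values:
  fixes Y :: "'a::euclidean_space set"
  assumes "finite D" "span D = UNIV" "\<And>d. d \<in> D \<Longrightarrow> finite ((\<lambda>y. y \<bullet> d) ` Y)"
  shows "finite Y"
proof (rule inj_on_finite)
  let ?h = "\<lambda>y. restrict (\<lambda>d. y \<bullet> d) D"
  show "inj_on ?h Y"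
  proof (rule inj_onI)
    fix y y' assume "?h y = ?h y'"
    then have "\<And>d. d \<in> D \<Longrightarrow> (y - y') \<bullet> d = 0"
      by (metis inner_diff_left restrict_apply' right_minus_eq)
    then have "y - y' = 0" by (rule orthogonal_to_spanning[OF assms(2)])
    then show "y = y'" by simp
  qed
  show "?h ` Y \<subseteq> PiE D (\<lambda>d. (\<lambda>y. y \<bullet> d) ` Y)" by auto
  show "finite (PiE D (\<lambda>d. (\<lambda>y. y \<bullet> d) ` Y))" using assms by (intro finite_PiE) auto
qed

lemma finite_bounded_Ints: "finite {r \<in> \<int>. \<bar>r::real\<bar> \<le> K}"
proof (rule finite_subset)
  show "{r \<in> \<int>. \<bar>r::real\<bar> \<le> K} \<subseteq> of_int ` {-\<lceil>K\<rceil>..\<lceil>K\<rceil>}"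
  proof
    fix r :: real assume "r \<in> {r \<in> \<int>. \<bar>r\<bar> \<le> K}"
    then obtain n where "r = of_int n" "\<bar>r\<bar> \<le> K" by (auto simp: Ints_def)
    then show "r \<in> of_int ` {-\<lceil>K\<rceil>..\<lceil>K\<rceil>}" by (auto intro!: imageI) linarith+
  qed
qed simp

section \<open>Hyperplanes of a root system under reflections\<close>

locale positive_roots =
  fixes \<Phi> P :: "'a::euclidean_space set"
  assumes root_system: "root_system \<Phi>" and crystallographic: "crystallographic \<Phi>"
    and nonempty: "\<Phi> \<noteq> {}" and span_roots: "span \<Phi> = UNIV" and positive: "positive_system \<Phi> P"
begin

lemma finite_roots: "finite \<Phi>" and root_nz: "\<alpha> \<in> \<Phi> \<Longrightarrow> \<alpha> \<noteq> 0"
  using root_system by (auto simp: root_system_def)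

lemma root_parallel: "\<alpha> \<in> \<Phi> \<Longrightarrow> c *\<^sub>R \<alpha> \<in> \<Phi> \<Longrightarrow> c *\<^sub>R \<alpha> = \<alpha> \<or> c *\<^sub>R \<alpha> = - \<alpha>"
  using root_system unfolding root_system_def by blast

lemma root_uminus: "\<alpha> \<in> \<Phi> \<Longrightarrow> - \<alpha> \<in> \<Phi>"
  using root_system unfolding root_system_def by blast

lemma root_refl: "\<alpha> \<in> \<Phi> \<Longrightarrow> \<beta> \<in> \<Phi> \<Longrightarrow> aff_refl \<alpha> 0 \<beta> \<in> \<Phi>"
proof -
  have "aff_refl \<alpha> 0 = root_reflection \<alpha>"
    by (rule ext) (simp add: aff_refl_def root_reflection_def coroot_def)
  then show "\<alpha> \<in> \<Phi> \<Longrightarrow> \<beta> \<in> \<Phi> \<Longrightarrow> aff_refl \<alpha> 0 \<beta> \<in> \<Phi>"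
    using root_system unfolding root_system_def by force
qed

lemma coroot_inner_Ints: "\<alpha> \<in> \<Phi> \<Longrightarrow> \<beta> \<in> \<Phi> \<Longrightarrow> coroot \<alpha> \<bullet> \<beta> \<in> \<int>"
  using crystallographic unfolding crystallographic_def coroot_def by simp

lemma of_int_coroot_inner: "\<alpha> \<in> \<Phi> \<Longrightarrow> \<beta> \<in> \<Phi> \<Longrightarrow> of_int \<lfloor>coroot \<alpha> \<bullet> \<beta>\<rfloor> = coroot \<alpha> \<bullet> \<beta>"
  using coroot_inner_Ints by simp

lemma positive_root: "\<alpha> \<in> P \<Longrightarrow> \<alpha> \<in> \<Phi>"
  and positive_cases: "\<alpha> \<in> \<Phi> \<Longrightarrow> \<alpha> \<in> P \<or> - \<alpha> \<in> P"
  and positive_not_uminus: "\<alpha> \<in> P \<Longrightarrow> - \<alpha> \<notin> P"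
  and finite_positive: "finite P"
  using positive finite_roots root_uminus unfolding positive_system_def
  by (auto simp: linorder_neq_iff)

definition regular :: "'a \<Rightarrow> bool" where "regular x \<longleftrightarrow> (\<forall>\<alpha>\<in>\<Phi>. x \<bullet> \<alpha> \<notin> \<int>)"

lemma regular_neq: "regular x \<Longrightarrow> \<alpha> \<in> \<Phi> \<Longrightarrow> x \<bullet> \<alpha> \<noteq> of_int k"
  by (auto simp: regular_def)

lemma aff_refl_level:
  assumes "\<beta> \<in> \<Phi>" "\<alpha> \<in> \<Phi>"
  shows "aff_refl \<beta> m x \<bullet> \<alpha> - of_int k = x \<bullet> aff_refl \<beta> 0 \<alpha> - of_int (refl_level \<beta> m \<alpha> k)"
  using assms by (simp add: aff_refl_inner refl_level_def of_int_coroot_inner)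

lemma refl_level_invol:
  assumes "\<beta> \<in> \<Phi>" "\<alpha> \<in> \<Phi>"
  shows "refl_level \<beta> m (aff_refl \<beta> 0 \<alpha>) (refl_level \<beta> m \<alpha> k) = k"
proof -
  have "coroot \<beta> \<bullet> aff_refl \<beta> 0 \<alpha> = - (coroot \<beta> \<bullet> \<alpha>)"
    using assms root_nz[of \<beta>] by (simp add: refl_adjoint[symmetric]) (simp add: aff_refl_def coroot_inner_self inner_diff_left)
  moreover have "\<lfloor>- (coroot \<beta> \<bullet> \<alpha>)\<rfloor> = - \<lfloor>coroot \<beta> \<bullet> \<alpha>\<rfloor>"
    using coroot_inner_Ints[OF assms] by (auto simp: Ints_def simp flip: of_int_minus)
  ultimately show ?thesis by (simp add: refl_level_def)
qed

lemma refl_level_uminus: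
  assumes "\<beta> \<in> \<Phi>" "\<alpha> \<in> \<Phi>"
  shows "refl_level \<beta> m (- \<alpha>) (- k) = - refl_level \<beta> m \<alpha> k"
proof -
  have "\<lfloor>- (coroot \<beta> \<bullet> \<alpha>)\<rfloor> = - \<lfloor>coroot \<beta> \<bullet> \<alpha>\<rfloor>"
    using coroot_inner_Ints[OF assms] by (auto simp: Ints_def simp flip: of_int_minus)
  then show ?thesis by (simp add: refl_level_def)
qed

lemma regular_aff_refl: "\<beta> \<in> \<Phi> \<Longrightarrow> regular x \<Longrightarrow> regular (aff_refl \<beta> m x)"
  unfolding regular_def
proof (intro ballI notI)
  fix \<alpha> assume *: "\<beta> \<in> \<Phi>" "\<forall>\<alpha>\<in>\<Phi>. x \<bullet> \<alpha> \<notin> \<int>" "\<alpha> \<in> \<Phi>" "aff_refl \<beta> m x \<bullet> \<alpha> \<in> \<int>"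
  have "x \<bullet> aff_refl \<beta> 0 \<alpha> = aff_refl \<beta> m x \<bullet> \<alpha> - of_int m * (coroot \<beta> \<bullet> \<alpha>)"
    by (simp add: aff_refl_inner)
  then have "x \<bullet> aff_refl \<beta> 0 \<alpha> \<in> \<int>" using * coroot_inner_Ints[of \<beta> \<alpha>] by simp
  then show False using * root_refl by blast
qed

lemma sep_aff_refl:
  assumes "\<beta> \<in> \<Phi>" "\<alpha> \<in> \<Phi>"
  shows "sep \<alpha> k (aff_refl \<beta> m x) (aff_refl \<beta> m y) \<longleftrightarrow> sep (aff_refl \<beta> 0 \<alpha>) (refl_level \<beta> m \<alpha> k) x y"
  using aff_refl_level[OF assms, of m x k] aff_refl_level[OF assms, of m y k]
  unfolding sep_def by (smt (verit))

lemma sep_uminus: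
  assumes "regular x" "regular y" "\<alpha> \<in> \<Phi>"
  shows "sep (- \<alpha>) (- k) x y \<longleftrightarrow> sep \<alpha> k x y"
  using regular_neq[OF assms(1,3), of k] regular_neq[OF assms(2,3), of k] by (auto simp: sep_def)

text \<open>The action of a reflection on labelled hyperplanes is an involution, so one implication,
  used in both directions, is enough.\<close>

lemma same_hyp_transport:
  assumes "\<gamma> \<in> \<Phi>" "\<alpha> \<in> \<Phi>" "\<beta> \<in> \<Phi>"
  shows "same_hyp (aff_refl \<gamma> 0 \<alpha>) (refl_level \<gamma> l \<alpha> k) \<beta> m
     \<longleftrightarrow> same_hyp \<alpha> k (aff_refl \<gamma> 0 \<beta>) (refl_level \<gamma> l \<beta> m)"
proof -
  have *: "same_hyp \<alpha> k (aff_refl \<gamma> 0 \<beta>) (refl_level \<gamma> l \<beta> m)"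
    if \<alpha>\<beta>: "\<alpha> \<in> \<Phi>" "\<beta> \<in> \<Phi>" "same_hyp (aff_refl \<gamma> 0 \<alpha>) (refl_level \<gamma> l \<alpha> k) \<beta> m" for \<alpha> \<beta> k m
  proof -
    consider "\<beta> = aff_refl \<gamma> 0 \<alpha>" "m = refl_level \<gamma> l \<alpha> k"
      | "\<beta> = - aff_refl \<gamma> 0 \<alpha>" "m = - refl_level \<gamma> l \<alpha> k"
      using \<alpha>\<beta>(3) unfolding same_hyp_def by force
    then show ?thesis
    proof cases
      case 1
      then show ?thesis using \<alpha>\<beta> assms root_nz by (simp add: same_hyp_def refl_level_invol)
    next
      case 2
      then show ?thesis using \<alpha>\<beta> assms root_nz root_refl
        by (simp add: same_hyp_def refl_level_invol refl_level_uminus linear_neg[OF linear_refl])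
    qed
  qed
  have sym: "same_hyp \<alpha> k \<beta> m \<longleftrightarrow> same_hyp \<beta> m \<alpha> k" for \<alpha> \<beta> :: 'a and k m
    by (auto simp: same_hyp_def)
  show ?thesis
    using *[OF assms(2,3), of k m] *[OF assms(3,2), of m k] sym by blast
qed

text \<open>Regular points stand for the alcoves containing them: \<open>adj\<close> is adjacency across a wall,
  \<open>gal n\<close> connection by a gallery of length \<open>n\<close>, and \<open>sim\<close> means lying in the same alcove.\<close>

definition adj :: "'a \<Rightarrow> 'a \<Rightarrow> bool" where
  "adj x y \<longleftrightarrow> (\<exists>\<beta>\<in>\<Phi>. \<exists>m. y = aff_refl \<beta> m x \<and>
     (\<forall>\<alpha>\<in>\<Phi>. \<forall>k. sep \<alpha> k x y \<longleftrightarrow> same_hyp \<alpha> k \<beta> m))"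

inductive gal :: "nat \<Rightarrow> 'a \<Rightarrow> 'a \<Rightarrow> bool" where
  gal_0: "gal 0 x x"
| gal_Suc: "adj x y \<Longrightarrow> gal n y z \<Longrightarrow> gal (Suc n) x z"

definition sim :: "'a \<Rightarrow> 'a \<Rightarrow> bool" where
  "sim x y \<longleftrightarrow> (\<forall>\<alpha>\<in>\<Phi>. \<forall>k. \<not> sep \<alpha> k x y)"

lemma sim_aff_refl: "\<beta> \<in> \<Phi> \<Longrightarrow> sim x y \<Longrightarrow> sim (aff_refl \<beta> m x) (aff_refl \<beta> m y)"
  by (simp add: sim_def sep_aff_refl root_refl)

text \<open>Reflections permute the hyperplanes and preserve separation, so the single hyperplane
  between two adjacent points goes to the single one between their images.\<close>

lemma adj_aff_refl:
  assumes \<gamma>: "\<gamma> \<in> \<Phi>" and "adj x y"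
  shows "adj (aff_refl \<gamma> l x) (aff_refl \<gamma> l y)"
proof -
  obtain \<beta> m where \<beta>: "\<beta> \<in> \<Phi>" "y = aff_refl \<beta> m x"
    and iff: "\<And>\<alpha> k. \<alpha> \<in> \<Phi> \<Longrightarrow> sep \<alpha> k x y \<longleftrightarrow> same_hyp \<alpha> k \<beta> m"
    using assms(2) unfolding adj_def by blast
  let ?\<beta> = "aff_refl \<gamma> 0 \<beta>" and ?m = "refl_level \<gamma> l \<beta> m"
  have eq: "aff_refl \<gamma> l y = aff_refl ?\<beta> ?m (aff_refl \<gamma> l x)"
    unfolding \<beta>(2)
  proof (rule aff_refl_conj)
    show "aff_refl \<gamma> l x \<bullet> ?\<beta> - of_int ?m = x \<bullet> \<beta> - of_int m" for x
      using aff_refl_level[OF \<gamma> root_refl[OF \<gamma> \<beta>(1)], of l x ?m] refl_level_invol[OF \<gamma> \<beta>(1), of l m]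
        root_nz[OF \<gamma>] by simp
  qed (use \<gamma> root_nz in auto)
  show ?thesis unfolding adj_def
  proof (intro bexI[of _ ?\<beta>] exI[of _ ?m] conjI ballI allI)
    show "aff_refl \<gamma> l y = aff_refl ?\<beta> ?m (aff_refl \<gamma> l x)" by (rule eq)
    fix \<alpha> k assume \<alpha>: "\<alpha> \<in> \<Phi>"
    show "sep \<alpha> k (aff_refl \<gamma> l x) (aff_refl \<gamma> l y) \<longleftrightarrow> same_hyp \<alpha> k ?\<beta> ?m"
      using sep_aff_refl[OF \<gamma> \<alpha>] iff[OF root_refl[OF \<gamma> \<alpha>]] same_hyp_transport[OF \<gamma> \<alpha> \<beta>(1)] by simp
  qed (rule root_refl[OF \<gamma> \<beta>(1)])
qed

lemma adj_sym: "adj x y \<Longrightarrow> adj y x"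
  unfolding adj_def sep_def by (metis aff_refl_invol root_nz)

lemma gal_aff_refl: "gal n x y \<Longrightarrow> \<gamma> \<in> \<Phi> \<Longrightarrow> gal n (aff_refl \<gamma> l x) (aff_refl \<gamma> l y)"
  by (induction rule: gal.induct) (auto intro: gal.intros adj_aff_refl)

lemma gal_trans: "gal m x y \<Longrightarrow> gal n y z \<Longrightarrow> gal (m + n) x z"
  by (induction rule: gal.induct) (auto intro: gal.intros)

lemma gal_sym: "gal m x y \<Longrightarrow> gal m y x"
proof (induction rule: gal.induct)
  case (gal_Suc x y n z)
  have "gal 1 y x" using gal_Suc(1) gal.intros adj_sym by (metis One_nat_def)
  from gal_trans[OF gal_Suc(3) this] show ?case by simp
qed (rule gal_0)

text \<open>Reflecting the part of the gallery after its first crossing of the hyperplane.\<close>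

lemma gal_fold:
  "gal n x y \<Longrightarrow> sep \<alpha> k x y \<Longrightarrow> \<alpha> \<in> \<Phi> \<Longrightarrow> \<exists>m<n. gal m x (aff_refl \<alpha> k y)"
proof (induction rule: gal.induct)
  case (gal_0 x)
  then show ?case by (simp add: sep_def)
next
  case (gal_Suc x y n z)
  obtain \<beta> l where \<beta>: "\<beta> \<in> \<Phi>" "y = aff_refl \<beta> l x"
    and iff: "\<And>\<alpha> k. \<alpha> \<in> \<Phi> \<Longrightarrow> sep \<alpha> k x y \<longleftrightarrow> same_hyp \<alpha> k \<beta> l"
    using gal_Suc.hyps(1) unfolding adj_def by blast
  show ?case
  proof (cases "sep \<alpha> k x y")
    case True
    then have "same_hyp \<alpha> k \<beta> l" using iff gal_Suc.prems by blast
    then have "aff_refl \<alpha> k = aff_refl \<beta> l" by (rule aff_refl_same)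
    then have "aff_refl \<alpha> k y = x" using \<beta> root_nz by simp
    then show ?thesis using gal_aff_refl[OF gal_Suc.hyps(2), of \<alpha> k] gal_Suc.prems by auto
  next
    case False
    then have "sep \<alpha> k y z" using gal_Suc.prems by (auto simp: sep_def)
    then obtain m where "m < n" "gal m y (aff_refl \<alpha> k z)" using gal_Suc by blast
    then show ?thesis using gal.gal_Suc[OF gal_Suc.hyps(1)] by (intro exI[of _ "Suc m"]) auto
  qed
qed

text \<open>A gallery that ends in the alcove where it starts has to cross its first wall again.
  Folding at that wall and reflecting the result back gives a strictly shorter gallery with the same
  ends, down to length 0. Since galleries consist of points and not only of alcoves, the end point
  is \<open>x\<close> itself.\<close>

lemma gal_closed: "gal n x y \<Longrightarrow> sim x y \<Longrightarrow> x = y"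
proof (induction n arbitrary: x y rule: less_induct)
  case (less n)
  from less.prems(1) show ?case
  proof cases
    case (gal_Suc z n')
    obtain \<beta> l where \<beta>: "\<beta> \<in> \<Phi>" "z = aff_refl \<beta> l x"
      and iff: "\<And>\<alpha> k. \<alpha> \<in> \<Phi> \<Longrightarrow> sep \<alpha> k x z \<longleftrightarrow> same_hyp \<alpha> k \<beta> l"
      using gal_Suc unfolding adj_def by blast
    have "sep \<beta> l x z" using iff[OF \<beta>(1)] by (simp add: same_hyp_def)
    moreover have "\<not> sep \<beta> l x y" using less.prems(2) \<beta>(1) by (simp add: sim_def)
    ultimately have "sep \<beta> l z y" by (auto simp: sep_def)
    then obtain m where m: "m < n'" "gal m z (aff_refl \<beta> l y)" using gal_fold gal_Suc \<beta>(1) by blast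
    have "gal m x y" using gal_aff_refl[OF m(2) \<beta>(1), of l] \<beta> root_nz by simp
    then show ?thesis using less.IH[of m] m(1) gal_Suc less.prems(2) by simp
  qed auto
qed

end

lemma finite_argmin:
  fixes f :: "'b \<Rightarrow> real"
  assumes "finite S" "S \<noteq> {}"
  shows "\<exists>s\<in>S. \<forall>y\<in>S. f s \<le> f y"
proof -
  have "Min (f ` S) \<in> f ` S" using assms by (intro Min_in) auto
  then obtain s where "s \<in> S" "f s = Min (f ` S)" by auto
  then show ?thesis using assms by (intro bexI[of _ s]) auto
qed

lemma bounded_inner_values:
  fixes Y :: "'a::euclidean_space set"
  assumes "span D = UNIV" "\<And>d y. d \<in> D \<Longrightarrow> y \<in> Y \<Longrightarrow> \<bar>y \<bullet> d\<bar> \<le> 1"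
  shows "bounded Y"
proof -
  have "\<exists>K. \<forall>y\<in>Y. \<bar>y \<bullet> z\<bar> \<le> K" for z
  proof (rule span_induct[of z D])
    show "z \<in> span D" using assms by simp
    show "subspace {z. \<exists>K. \<forall>y\<in>Y. \<bar>y \<bullet> z\<bar> \<le> K}"
      unfolding subspace_def
    proof (intro conjI ballI allI)
      show "0 \<in> {z. \<exists>K. \<forall>y\<in>Y. \<bar>y \<bullet> z\<bar> \<le> K}" by auto
      fix z w assume "z \<in> {z. \<exists>K. \<forall>y\<in>Y. \<bar>y \<bullet> z\<bar> \<le> K}" "w \<in> {z. \<exists>K. \<forall>y\<in>Y. \<bar>y \<bullet> z\<bar> \<le> K}"
      then obtain K L where "\<forall>y\<in>Y. \<bar>y \<bullet> z\<bar> \<le> K" "\<forall>y\<in>Y. \<bar>y \<bullet> w\<bar> \<le> L" by auto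
      then have "\<forall>y\<in>Y. \<bar>y \<bullet> (z + w)\<bar> \<le> K + L" by (fastforce simp: inner_add_right)
      then show "z + w \<in> {z. \<exists>K. \<forall>y\<in>Y. \<bar>y \<bullet> z\<bar> \<le> K}" by auto
    next
      fix c z assume "z \<in> {z. \<exists>K. \<forall>y\<in>Y. \<bar>y \<bullet> z\<bar> \<le> K}"
      then obtain K where "\<forall>y\<in>Y. \<bar>y \<bullet> z\<bar> \<le> K" by auto
      then have "\<forall>y\<in>Y. \<bar>y \<bullet> (c *\<^sub>R z)\<bar> \<le> \<bar>c\<bar> * K" by (auto simp: abs_mult mult_left_mono)
      then show "c *\<^sub>R z \<in> {z. \<exists>K. \<forall>y\<in>Y. \<bar>y \<bullet> z\<bar> \<le> K}" by auto
    qed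
    show "\<exists>K. \<forall>y\<in>Y. \<bar>y \<bullet> d\<bar> \<le> K" if "d \<in> D" for d using assms that by blast
  qed
  then obtain K where K: "\<And>z y. y \<in> Y \<Longrightarrow> \<bar>y \<bullet> z\<bar> \<le> K z" by metis
  show ?thesis
    unfolding bounded_iff
  proof (intro exI ballI)
    fix y assume "y \<in> Y"
    have "norm y \<le> (\<Sum>b\<in>Basis. \<bar>y \<bullet> b\<bar>)" by (rule norm_le_l1)
    also have "\<dots> \<le> sum K Basis" by (rule sum_mono) (rule K[OF \<open>y \<in> Y\<close>])
    finally show "norm y \<le> sum K Basis" .
  qed
qed

text \<open>The affine function from \<open>p\<close> at time 0 to \<open>q\<close> at time 1
  vanishes in between only if the signs differ, and then at time \<open>p / (p - q)\<close>; before
  that its sign is that of \<open>p\<close>.\<close>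

lemma segment_side:
  fixes p q t :: real
  assumes "p \<noteq> 0" "q \<noteq> 0" "0 < t" "t < 1" and "(p > 0) \<noteq> (q > 0) \<Longrightarrow> t < p / (p - q)"
  shows "p + t * (q - p) \<noteq> 0 \<and> (0 < p \<longleftrightarrow> 0 < p + t * (q - p))"
proof -
  have eq: "p + t * (q - p) = (1 - t) * p + t * q" by (simp add: algebra_simps)
  consider "p > 0" "q > 0" | "p < 0" "q < 0" | "p > 0" "q < 0" | "p < 0" "q > 0"
    using assms by linarith
  then show ?thesis
  proof cases
    case 1
    then have "(1 - t) * p + t * q > 0" using assms by (intro add_pos_pos) auto
    then show ?thesis using 1 eq by simp
  next
    case 2
    then have "(1 - t) * p + t * q < 0" using assms by (intro add_neg_neg) (auto simp: mult_less_0_iff)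
    then show ?thesis using 2 eq by simp
  next
    case 3
    then have "t < p / (p - q)" using assms by simp
    then have "t * (p - q) < p" using 3 by (simp add: pos_less_divide_eq)
    then show ?thesis using 3 by (simp add: algebra_simps)
  next
    case 4
    then have "t < p / (p - q)" using assms by simp
    then have "t * (p - q) > p" using 4 by (simp add: neg_less_divide_eq)
    then show ?thesis using 4 by (simp add: algebra_simps)
  qed
qed

section \<open>Existence of galleries between alcoves\<close>

context positive_roots
begin

lemma int_less_iff_floor: "x \<bullet> \<alpha> \<noteq> of_int k \<Longrightarrow> (of_int k < x \<bullet> \<alpha>) \<longleftrightarrow> k \<le> \<lfloor>x \<bullet> \<alpha>\<rfloor>"
  by (simp add: le_floor_iff) linarith

text \<open>Since the reflection fixes \<open>z\<close> and permutes the other hyperplanes,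
  \<open>z\<close> lies on the same side of each of them as the reflected point too; so nothing but
  the wall separates \<open>a\<close> from its image.\<close>

lemma wall_adj:
  assumes a: "regular a" and \<beta>: "\<beta> \<in> \<Phi>" and z: "z \<bullet> \<beta> = of_int m"
    and side: "\<And>\<alpha> k. \<alpha> \<in> \<Phi> \<Longrightarrow> \<not> same_hyp \<alpha> k \<beta> m \<Longrightarrow> of_int k < a \<bullet> \<alpha> \<longleftrightarrow> of_int k < z \<bullet> \<alpha>"
  shows "adj a (aff_refl \<beta> m a)"
  unfolding adj_def
proof (intro bexI[OF _ \<beta>] exI[of _ m] conjI ballI allI)
  fix \<alpha> k assume \<alpha>: "\<alpha> \<in> \<Phi>"
  let ?r = "aff_refl \<beta> m"
  have sep\<beta>: "sep \<beta> m a (?r a)"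
    using regular_neq[OF a \<beta>, of m] root_nz[OF \<beta>] by (auto simp: sep_def aff_refl_inner_self)
  show "sep \<alpha> k a (?r a) \<longleftrightarrow> same_hyp \<alpha> k \<beta> m"
  proof
    assume "same_hyp \<alpha> k \<beta> m"
    then show "sep \<alpha> k a (?r a)"
      using sep\<beta> sep_uminus[OF a regular_aff_refl[OF \<beta> a] \<beta>] unfolding same_hyp_def by auto
  next
    let ?\<alpha> = "aff_refl \<beta> 0 \<alpha>" and ?k = "refl_level \<beta> m \<alpha> k"
    assume sep: "sep \<alpha> k a (?r a)"
    show "same_hyp \<alpha> k \<beta> m"
    proof (rule ccontr)
      assume ns: "\<not> same_hyp \<alpha> k \<beta> m"
      have "aff_refl \<beta> 0 \<beta> = - \<beta>" using root_nz[OF \<beta>] by (simp add: aff_refl_def coroot_def scaleR_2)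
      moreover have "refl_level \<beta> m \<beta> m = - m" using root_nz[OF \<beta>]
        by (simp add: refl_level_def coroot_inner_self)
      ultimately have ns': "\<not> same_hyp ?\<alpha> ?k \<beta> m"
        using ns same_hyp_transport[OF \<beta> \<alpha> \<beta>, of m k m] by (auto simp: same_hyp_def)
      have "of_int k < ?r a \<bullet> \<alpha> \<longleftrightarrow> of_int ?k < a \<bullet> ?\<alpha>"
        using aff_refl_level[OF \<beta> \<alpha>, of m a k] by linarith
      also have "\<dots> \<longleftrightarrow> of_int ?k < z \<bullet> ?\<alpha>" using side[OF root_refl[OF \<beta> \<alpha>] ns'] .
      also have "\<dots> \<longleftrightarrow> of_int k < z \<bullet> \<alpha>"
        using aff_refl_level[OF \<beta> \<alpha>, of m z k] aff_refl_fixed[OF z] by (smt (verit))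
      also have "\<dots> \<longleftrightarrow> of_int k < a \<bullet> \<alpha>" using side[OF \<alpha> ns] by simp
      finally show False using sep by (simp add: sep_def)
    qed
  qed
qed simp

lemma finite_sep: "finite {(\<alpha>, k). \<alpha> \<in> \<Phi> \<and> sep \<alpha> k x y}"
proof (rule finite_subset)
  show "{(\<alpha>, k). \<alpha> \<in> \<Phi> \<and> sep \<alpha> k x y} \<subseteq>
     (SIGMA \<alpha>:\<Phi>. {min \<lfloor>x \<bullet> \<alpha>\<rfloor> \<lfloor>y \<bullet> \<alpha>\<rfloor> .. max \<lfloor>x \<bullet> \<alpha>\<rfloor> \<lfloor>y \<bullet> \<alpha>\<rfloor>})"
    by (auto simp: sep_def le_floor_iff floor_le_iff min_le_iff_disj le_max_iff_disj)
qed (use finite_roots in auto)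

text \<open>Whether a reflection leads to an adjacent point depends only on the alcove. This allows
  a point to be replaced by a generic one of its alcove and back.\<close>

lemma sim_adj:
  assumes ra: "regular a" and sim: "sim x a" and \<beta>: "\<beta> \<in> \<Phi>" and adj: "adj a (aff_refl \<beta> m a)"
  shows "adj x (aff_refl \<beta> m x)"
proof -
  have r: "sim (aff_refl \<beta> m x) (aff_refl \<beta> m a)" by (rule sim_aff_refl[OF \<beta> sim])
  obtain \<beta>' m' where \<beta>': "\<beta>' \<in> \<Phi>" "aff_refl \<beta> m a = aff_refl \<beta>' m' a"
    and iff: "\<And>\<alpha> k. \<alpha> \<in> \<Phi> \<Longrightarrow> sep \<alpha> k a (aff_refl \<beta> m a) \<longleftrightarrow> same_hyp \<alpha> k \<beta>' m'"
    using adj unfolding adj_def by blast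
  have "sep \<beta> m a (aff_refl \<beta> m a)"
    using regular_neq[OF ra \<beta>, of m] root_nz[OF \<beta>] by (auto simp: sep_def aff_refl_inner_self)
  then have same: "same_hyp \<beta> m \<beta>' m'" using iff \<beta> by blast
  then have "aff_refl \<beta>' m' = aff_refl \<beta> m" by (metis aff_refl_same)
  moreover have "sep \<alpha> k x (aff_refl \<beta> m x) \<longleftrightarrow> sep \<alpha> k a (aff_refl \<beta> m a)" if "\<alpha> \<in> \<Phi>" for \<alpha> k
    using r sim that unfolding sim_def sep_def by blast
  ultimately show ?thesis unfolding adj_def using \<beta>' iff by metis
qed

text \<open>From a generic point \<open>a\<close> of the alcove of \<open>x\<close>, the segment to
  \<open>y\<close> meets the separating hyperplanes one at a time; the first one met is a wall of
  the alcove.\<close>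

lemma separated_adj:
  assumes x: "regular x" and y: "regular y" and "\<not> sim x y"
  obtains \<beta> m where "\<beta> \<in> \<Phi>" "sep \<beta> m x y" "adj x (aff_refl \<beta> m x)"
proof -
  define K where "K = {(\<alpha>, k). \<alpha> \<in> \<Phi> \<and> sep \<alpha> k x y}"
  have K: "finite K" "K \<noteq> {}" using finite_sep assms(3) by (auto simp: K_def sim_def)
  define U where "U = (\<Inter>\<alpha>\<in>\<Phi>. {a. of_int \<lfloor>x \<bullet> \<alpha>\<rfloor> < a \<bullet> \<alpha>} \<inter> {a. a \<bullet> \<alpha> < of_int (\<lfloor>x \<bullet> \<alpha>\<rfloor> + 1)})"
  have "open U" unfolding U_def
    by (intro open_INT finite_roots ballI open_Int open_Collect_less continuous_intros)
  have xU: "x \<in> U"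
  proof -
    have "of_int \<lfloor>x \<bullet> \<alpha>\<rfloor> < x \<bullet> \<alpha>" if "\<alpha> \<in> \<Phi>" for \<alpha>
      using regular_neq[OF x that, of "\<lfloor>x \<bullet> \<alpha>\<rfloor>"] of_int_floor_le[of "x \<bullet> \<alpha>"] by linarith
    then show ?thesis unfolding U_def by simp
  qed
  define I where "I = {((\<alpha>, k), (\<beta>, m)) | \<alpha> k \<beta> m. (\<alpha>, k) \<in> K \<and> (\<beta>, m) \<in> K \<and> \<alpha> \<noteq> \<beta> \<and> \<alpha> \<noteq> - \<beta>}"
  have "finite I" by (rule finite_subset[of _ "K \<times> K"]) (use K in \<open>auto simp: I_def\<close>)
  then have I: "countable I" by (rule countable_finite)
  \<comment> \<open>\<open>n i \<bullet> a = c i\<close> is the cross-multiplied condition that the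
    segment from \<open>a\<close> to \<open>y\<close> meets both hyperplanes at the same parameter.
    Its normal vector is nonzero because the two roots are not parallel and \<open>y\<close> lies on
    no hyperplane.\<close>
  define n :: "('a \<times> int) \<times> ('a \<times> int) \<Rightarrow> 'a" where
    "n = (\<lambda>((\<alpha>, k), (\<beta>, m)). (y \<bullet> \<beta> - of_int m) *\<^sub>R \<alpha> - (y \<bullet> \<alpha> - of_int k) *\<^sub>R \<beta>)"
  define c :: "('a \<times> int) \<times> ('a \<times> int) \<Rightarrow> real" where
    "c = (\<lambda>((\<alpha>, k), (\<beta>, m)). of_int k * (y \<bullet> \<beta> - of_int m) - of_int m * (y \<bullet> \<alpha> - of_int k))"
  have nz: "n i \<noteq> 0" if iI: "i \<in> I" for i
  proof
    assume "n i = 0"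
    obtain \<alpha> k \<beta> m where i: "i = ((\<alpha>, k), (\<beta>, m))" "(\<alpha>, k) \<in> K" "(\<beta>, m) \<in> K" "\<alpha> \<noteq> \<beta>" "\<alpha> \<noteq> - \<beta>"
      using iI by (auto simp: I_def)
    have \<Phi>: "\<alpha> \<in> \<Phi>" "\<beta> \<in> \<Phi>" using i by (auto simp: K_def)
    have nz: "y \<bullet> \<beta> - of_int m \<noteq> 0" using regular_neq[OF y \<Phi>(2), of m] by simp
    have "(y \<bullet> \<beta> - of_int m) *\<^sub>R \<alpha> = (y \<bullet> \<alpha> - of_int k) *\<^sub>R \<beta>" using \<open>n i = 0\<close> by (simp add: n_def i)
    then have "(1 / (y \<bullet> \<beta> - of_int m)) *\<^sub>R ((y \<bullet> \<beta> - of_int m) *\<^sub>R \<alpha>) = (1 / (y \<bullet> \<beta> - of_int m)) *\<^sub>R ((y \<bullet> \<alpha> - of_int k) *\<^sub>R \<beta>)" by simp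
    then have "\<alpha> = ((y \<bullet> \<alpha> - of_int k) / (y \<bullet> \<beta> - of_int m)) *\<^sub>R \<beta>" using nz by simp
    then show False using root_parallel[OF \<Phi>(2)] \<Phi> i by metis
  qed
  from xU have "U \<noteq> {}" by auto
  then obtain a where a: "a \<in> U" and gen: "\<And>i. i \<in> I \<Longrightarrow> n i \<bullet> a \<noteq> c i"
    using generic_point[OF \<open>open U\<close> _ I, of n c] nz by blast
  have a_fl: "\<lfloor>a \<bullet> \<alpha>\<rfloor> = \<lfloor>x \<bullet> \<alpha>\<rfloor>" "of_int \<lfloor>x \<bullet> \<alpha>\<rfloor> < a \<bullet> \<alpha>" if "\<alpha> \<in> \<Phi>" for \<alpha>
    using a that by (auto simp: U_def floor_eq_iff less_imp_le)
  have ra: "regular a" unfolding regular_def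
  proof (intro ballI notI)
    fix \<alpha> assume "\<alpha> \<in> \<Phi>" "a \<bullet> \<alpha> \<in> \<int>"
    then show False using a_fl[of \<alpha>] by (auto simp: Ints_def)
  qed
  have sim: "sim x a"
    unfolding sim_def sep_def
    using int_less_iff_floor[OF regular_neq[OF x]] int_less_iff_floor[OF regular_neq[OF ra]] a_fl by simp
  have sepa: "sep \<alpha> k a w \<longleftrightarrow> sep \<alpha> k x w" if "\<alpha> \<in> \<Phi>" for \<alpha> k w
    using sim that unfolding sim_def sep_def by blast
  \<comment> \<open>The parameter at which the segment from \<open>a\<close> to \<open>y\<close>
    crosses the hyperplane.\<close>
  define \<tau> where "\<tau> = (\<lambda>(\<alpha>, k). (a \<bullet> \<alpha> - of_int k) / ((a \<bullet> \<alpha> - of_int k) - (y \<bullet> \<alpha> - of_int k)))"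
  have \<tau>01: "0 < \<tau> (\<alpha>, k) \<and> \<tau> (\<alpha>, k) < 1" if h: "(\<alpha>, k) \<in> K" for \<alpha> k
  proof -
    have "\<alpha> \<in> \<Phi>" "sep \<alpha> k a y" using h sepa by (auto simp: K_def)
    then show ?thesis
      using regular_neq[OF ra, of \<alpha> k] regular_neq[OF y, of \<alpha> k]
      by (auto simp: sep_def \<tau>_def zero_less_divide_iff divide_less_eq_1)
  qed
  obtain h where "h \<in> K" and min: "\<And>h'. h' \<in> K \<Longrightarrow> \<tau> h \<le> \<tau> h'"
    using finite_argmin[OF K, of \<tau>] by blast
  then obtain \<beta> m where h: "h = (\<beta>, m)" "(\<beta>, m) \<in> K" by (cases h) auto
  have \<beta>: "\<beta> \<in> \<Phi>" "sep \<beta> m x y" using h by (auto simp: K_def)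
  define t where "t = \<tau> (\<beta>, m)"
  have t: "0 < t" "t < 1" using \<tau>01[OF h(2)] by (auto simp: t_def)
  define z where "z = a + t *\<^sub>R (y - a)"
  have z_in: "z \<bullet> \<alpha> - of_int k = (a \<bullet> \<alpha> - of_int k) + t * ((y \<bullet> \<alpha> - of_int k) - (a \<bullet> \<alpha> - of_int k))" for \<alpha> k
    by (simp add: z_def inner_add_left inner_diff_left)
  have den: "(a \<bullet> \<alpha> - of_int k) - (y \<bullet> \<alpha> - of_int k) \<noteq> 0" if "(\<alpha>, k) \<in> K" for \<alpha> k
    using \<tau>01[OF that] by (auto simp: \<tau>_def)
  have z\<beta>: "z \<bullet> \<beta> = of_int m"
  proof -
    let ?p = "a \<bullet> \<beta> - of_int m" and ?q = "y \<bullet> \<beta> - of_int m"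
    have "t * (?p - ?q) = ?p" using den[OF h(2)] by (simp add: t_def \<tau>_def)
    moreover have "t * (?q - ?p) = - (t * (?p - ?q))" by (simp only: mult_minus_right[symmetric] minus_diff_eq)
    ultimately have "t * (?q - ?p) = - ?p" by simp
    then show ?thesis using z_in[of \<beta> m] by simp
  qed
  have side: "of_int k < a \<bullet> \<alpha> \<longleftrightarrow> of_int k < z \<bullet> \<alpha>" if \<alpha>: "\<alpha> \<in> \<Phi>" and ns: "\<not> same_hyp \<alpha> k \<beta> m" for \<alpha> k
  proof -
    let ?p = "a \<bullet> \<alpha> - of_int k" and ?q = "y \<bullet> \<alpha> - of_int k"
    let ?p' = "a \<bullet> \<beta> - of_int m" and ?q' = "y \<bullet> \<beta> - of_int m"
    have "?p + t * (?q - ?p) \<noteq> 0 \<and> (0 < ?p \<longleftrightarrow> 0 < ?p + t * (?q - ?p))"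
    proof (rule segment_side)
      show "?p \<noteq> 0" "?q \<noteq> 0" using regular_neq[OF ra \<alpha>, of k] regular_neq[OF y \<alpha>, of k] by auto
      assume "(?p > 0) \<noteq> (?q > 0)"
      then have "sep \<alpha> k a y" by (simp add: sep_def)
      then have hK: "(\<alpha>, k) \<in> K" using \<alpha> sepa by (simp add: K_def)
      have "t \<noteq> \<tau> (\<alpha>, k)"
      proof
        assume eq: "t = \<tau> (\<alpha>, k)"
        then have "?p' / (?p' - ?q') = ?p / (?p - ?q)" by (simp only: t_def \<tau>_def case_prod_conv)
        from frac_eq_eq[THEN iffD1, OF den[OF h(2)] den[OF hK] this]
        have cross: "?p' * (?p - ?q) = ?p * (?p' - ?q')" .
        \<comment> \<open>A common crossing parameter would make parallel hyperplanes equal, and is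
          excluded for non-parallel ones by the choice of \<open>a\<close>.\<close>
        consider "\<alpha> = \<beta>" | "\<alpha> = - \<beta>" | "\<alpha> \<noteq> \<beta>" "\<alpha> \<noteq> - \<beta>" by blast
        then show False
        proof cases
          case 1
          then have "(?p' - ?p) * (?p' - ?q') = 0" using cross by (simp add: algebra_simps)
          then have "?p' = ?p" using den[OF h(2)] by simp
          then show False using 1 ns by (simp add: same_hyp_def)
        next
          case 2
          then have "?p - ?q = - (?p' - ?q')" by simp
          have "(p' + p) * D' = 0" if "D = - D'" "p' * D = p * D'" for p p' D D' :: real
            using that by (simp add: algebra_simps)
          from this[OF \<open>?p - ?q = - (?p' - ?q')\<close> cross]
          have "(?p' + ?p) * (?p' - ?q') = 0" .
          then have "?p' + ?p = 0" using den[OF h(2)] by simp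
          then have "of_int k = (of_int (- m) :: real)" using 2 by simp
          then show False using 2 ns by (simp only: same_hyp_def of_int_eq_iff) simp
        next
          case 3
          then have "((\<alpha>, k), (\<beta>, m)) \<in> I" using hK h by (auto simp: I_def)
          from gen[OF this] show False
            using cross by (simp add: n_def c_def inner_diff_left inner_commute algebra_simps)
        qed
      qed
      then show "t < ?p / (?p - ?q)" using min[OF hK] h by (simp add: t_def \<tau>_def)
    qed (use t in auto)
    then have "0 < ?p \<longleftrightarrow> 0 < z \<bullet> \<alpha> - of_int k" by (simp only: z_in)
    then show ?thesis by (simp only: diff_gt_0_iff_gt)
  qed
  have adj: "adj a (aff_refl \<beta> m a)" by (rule wall_adj[OF ra \<beta>(1) z\<beta> side])
  have "adj x (aff_refl \<beta> m x)" by (rule sim_adj[OF ra sim \<beta>(1) adj])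
  then show ?thesis using that \<beta> by blast
qed

text \<open>Crossing a wall that separates \<open>x\<close> from \<open>y\<close> removes that
  hyperplane from the finite set of separating ones and adds none.\<close>

lemma reach_alcove:
  assumes "regular x" "regular y"
  shows "\<exists>n y'. gal n x y' \<and> sim y' y"
  using assms(1)
proof (induction "card {(\<alpha>, k). \<alpha> \<in> \<Phi> \<and> sep \<alpha> k x y}" arbitrary: x rule: less_induct)
  case less
  let ?K = "\<lambda>x. {(\<alpha>, k). \<alpha> \<in> \<Phi> \<and> sep \<alpha> k x y}"
  show ?case
  proof (cases "sim x y")
    case True
    then show ?thesis using gal_0 by blast
  next
    case False
    then obtain \<beta> m where \<beta>: "\<beta> \<in> \<Phi>" "sep \<beta> m x y" "adj x (aff_refl \<beta> m x)"
      using separated_adj[OF less.prems assms(2)] by metis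
    let ?x = "aff_refl \<beta> m x"
    have rx: "regular ?x" by (rule regular_aff_refl[OF \<beta>(1) less.prems])
    obtain \<beta>' m' where \<beta>': "\<beta>' \<in> \<Phi>"
      and iff: "\<And>\<alpha> k. \<alpha> \<in> \<Phi> \<Longrightarrow> sep \<alpha> k x ?x \<longleftrightarrow> same_hyp \<alpha> k \<beta>' m'"
      using \<beta>(3) unfolding adj_def by blast
    have sx: "sep \<beta> m x ?x"
      using regular_neq[OF less.prems \<beta>(1), of m] root_nz[OF \<beta>(1)] by (auto simp: sep_def aff_refl_inner_self)
    then have "same_hyp \<beta> m \<beta>' m'" using iff \<beta> by blast
    then have iff: "sep \<alpha> k x ?x \<longleftrightarrow> same_hyp \<alpha> k \<beta> m" if "\<alpha> \<in> \<Phi>" for \<alpha> k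
      using iff[OF that] by (auto simp: same_hyp_def)
    have nsep: "\<not> sep \<beta> m ?x y" using sx \<beta>(2) by (auto simp: sep_def)
    have "?K ?x \<subset> ?K x"
    proof
      show "?K ?x \<subseteq> ?K x"
      proof clarify
        fix \<alpha> k assume *: "\<alpha> \<in> \<Phi>" "sep \<alpha> k ?x y"
        have "\<not> same_hyp \<alpha> k \<beta> m"
          using * nsep sep_uminus[OF rx assms(2) \<beta>(1)] by (auto simp: same_hyp_def)
        then have "\<not> sep \<alpha> k x ?x" using iff * by blast
        then show "sep \<alpha> k x y" using * by (auto simp: sep_def)
      qed
      show "?K ?x \<noteq> ?K x" using nsep \<beta> by auto
    qed
    then have "card (?K ?x) < card (?K x)" by (rule psubset_card_mono[OF finite_sep])
    from less.hyps[OF this rx] obtain n y' where "gal n ?x y'" "sim y' y" by blast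
    then show ?thesis using gal_Suc[OF \<beta>(3)] by blast
  qed
qed

text \<open>A hyperplane has a point lying on no non-parallel one; slightly off it there is an
  alcove of which the hyperplane is a wall.\<close>

lemma next_to_hyperplane:
  assumes \<beta>: "\<beta> \<in> \<Phi>"
  obtains y where "regular y" "adj y (aff_refl \<beta> m y)"
proof -
  define I where "I = {\<alpha>\<in>\<Phi>. \<alpha> \<noteq> \<beta> \<and> \<alpha> \<noteq> - \<beta>} \<times> (UNIV :: int set)"
  have "countable I" unfolding I_def
    by (intro countable_SIGMA countable_finite[OF finite_subset[OF _ finite_roots]]) auto
  \<comment> \<open>\<open>n (\<alpha>, k) \<bullet> u = c (\<alpha>, k)\<close> says that the
    orthogonal projection of \<open>u\<close> to the hyperplane \<open>(\<beta>, m)\<close>, called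
    \<open>z\<close> below, lies on \<open>(\<alpha>, k)\<close>.\<close>
  define n where "n = (\<lambda>(\<alpha>, k::int). \<alpha> - ((coroot \<beta> \<bullet> \<alpha>) / 2) *\<^sub>R \<beta>)"
  define c where "c = (\<lambda>(\<alpha>, k). of_int k - of_int m / 2 * (coroot \<beta> \<bullet> \<alpha>))"
  have nz: "n i \<noteq> 0" if iI: "i \<in> I" for i
  proof
    assume "n i = 0"
    obtain \<alpha> k where i: "i = (\<alpha>, k)" "\<alpha> \<in> \<Phi>" "\<alpha> \<noteq> \<beta>" "\<alpha> \<noteq> - \<beta>" using iI by (auto simp: I_def)
    then have "\<alpha> = ((coroot \<beta> \<bullet> \<alpha>) / 2) *\<^sub>R \<beta>" using \<open>n i = 0\<close> by (simp add: n_def)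
    then show False using root_parallel[OF \<beta>] i by metis
  qed
  obtain u where u: "\<And>i. i \<in> I \<Longrightarrow> n i \<bullet> u \<noteq> c i"
    using generic_point[OF open_UNIV UNIV_not_empty \<open>countable I\<close>, of n c] nz by blast
  define z where "z = u - ((u \<bullet> \<beta> - of_int m) / 2) *\<^sub>R coroot \<beta>"
  have z\<beta>: "z \<bullet> \<beta> = of_int m"
    using root_nz[OF \<beta>] by (simp add: z_def inner_diff_left coroot_inner_self field_simps)
  have z\<alpha>: "z \<bullet> \<alpha> \<noteq> of_int k" if "\<alpha> \<in> \<Phi>" "\<alpha> \<noteq> \<beta>" "\<alpha> \<noteq> - \<beta>" for \<alpha> k
  proof
    assume "z \<bullet> \<alpha> = of_int k"
    then have "n (\<alpha>, k) \<bullet> u = c (\<alpha>, k)"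
      by (simp add: z_def n_def c_def inner_diff_left algebra_simps inner_commute diff_divide_distrib)
    moreover have "(\<alpha>, k) \<in> I" using that by (simp add: I_def)
    ultimately show False using u by blast
  qed
  have "\<forall>\<^sub>F e in at_right 0. \<forall>\<alpha>\<in>\<Phi>. \<alpha> \<noteq> \<beta> \<and> \<alpha> \<noteq> - \<beta> \<longrightarrow>
      of_int \<lfloor>z \<bullet> \<alpha>\<rfloor> < z \<bullet> \<alpha> + e * (\<beta> \<bullet> \<alpha>) \<and> z \<bullet> \<alpha> + e * (\<beta> \<bullet> \<alpha>) < of_int \<lfloor>z \<bullet> \<alpha>\<rfloor> + 1"
  proof (intro eventually_ball_finite finite_roots ballI)
    fix \<alpha> assume \<alpha>: "\<alpha> \<in> \<Phi>"
    have t: "((\<lambda>e. z \<bullet> \<alpha> + e * (\<beta> \<bullet> \<alpha>)) \<longlongrightarrow> z \<bullet> \<alpha> + 0 * (\<beta> \<bullet> \<alpha>)) (at_right 0)"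
      by (intro tendsto_intros)
    show "\<forall>\<^sub>F e in at_right 0. \<alpha> \<noteq> \<beta> \<and> \<alpha> \<noteq> - \<beta> \<longrightarrow>
      of_int \<lfloor>z \<bullet> \<alpha>\<rfloor> < z \<bullet> \<alpha> + e * (\<beta> \<bullet> \<alpha>) \<and> z \<bullet> \<alpha> + e * (\<beta> \<bullet> \<alpha>) < of_int \<lfloor>z \<bullet> \<alpha>\<rfloor> + 1"
    proof (cases "\<alpha> \<noteq> \<beta> \<and> \<alpha> \<noteq> - \<beta>")
      case True
      then have "of_int \<lfloor>z \<bullet> \<alpha>\<rfloor> < z \<bullet> \<alpha> + 0 * (\<beta> \<bullet> \<alpha>)" "z \<bullet> \<alpha> + 0 * (\<beta> \<bullet> \<alpha>) < of_int \<lfloor>z \<bullet> \<alpha>\<rfloor> + 1"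
        using z\<alpha>[OF \<alpha>, of "\<lfloor>z \<bullet> \<alpha>\<rfloor>"] of_int_floor_le[of "z \<bullet> \<alpha>"] by linarith+
      from order_tendstoD(1)[OF t this(1)] order_tendstoD(2)[OF t this(2)]
      show ?thesis by eventually_elim simp
    qed auto
  qed
  moreover have "\<forall>\<^sub>F e in at_right 0. e * (\<beta> \<bullet> \<beta>) < 1"
  proof -
    have "((\<lambda>e. e * (\<beta> \<bullet> \<beta>)) \<longlongrightarrow> 0 * (\<beta> \<bullet> \<beta>)) (at_right 0)" by (intro tendsto_intros)
    from order_tendstoD(2)[OF this, of 1] show ?thesis by simp
  qed
  moreover have "\<forall>\<^sub>F e in at_right 0. 0 < (e::real)" by (rule eventually_at_right_less)
  ultimately have "\<forall>\<^sub>F e in at_right 0. (\<forall>\<alpha>\<in>\<Phi>. \<alpha> \<noteq> \<beta> \<and> \<alpha> \<noteq> - \<beta> \<longrightarrow>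
      of_int \<lfloor>z \<bullet> \<alpha>\<rfloor> < z \<bullet> \<alpha> + e * (\<beta> \<bullet> \<alpha>) \<and> z \<bullet> \<alpha> + e * (\<beta> \<bullet> \<alpha>) < of_int \<lfloor>z \<bullet> \<alpha>\<rfloor> + 1)
      \<and> e * (\<beta> \<bullet> \<beta>) < 1 \<and> 0 < e"
    by eventually_elim blast
  then obtain e where e: "\<And>\<alpha>. \<alpha> \<in> \<Phi> \<Longrightarrow> \<alpha> \<noteq> \<beta> \<Longrightarrow> \<alpha> \<noteq> - \<beta> \<Longrightarrow>
      of_int \<lfloor>z \<bullet> \<alpha>\<rfloor> < z \<bullet> \<alpha> + e * (\<beta> \<bullet> \<alpha>) \<and> z \<bullet> \<alpha> + e * (\<beta> \<bullet> \<alpha>) < of_int \<lfloor>z \<bullet> \<alpha>\<rfloor> + 1"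
      "e * (\<beta> \<bullet> \<beta>) < 1" "0 < e"
    by (auto dest!: eventually_happens simp: trivial_limit_at_right_real)
  \<comment> \<open>The shift is so small that no floor for a non-parallel root changes, and the
    next parallel hyperplane, at level \<open>m + 1\<close>, is not reached.\<close>
  define y where "y = z + e *\<^sub>R \<beta>"
  have y_in: "y \<bullet> \<alpha> = z \<bullet> \<alpha> + e * (\<beta> \<bullet> \<alpha>)" for \<alpha> by (simp add: y_def inner_add_left)
  have pos: "0 < e * (\<beta> \<bullet> \<beta>)" using e(3) root_nz[OF \<beta>] by simp
  have y\<beta>: "of_int m < y \<bullet> \<beta>" "y \<bullet> \<beta> < of_int m + 1" using y_in[of \<beta>] z\<beta> e(2) pos by auto
  have bounds: "of_int \<lfloor>z \<bullet> \<alpha>\<rfloor> < y \<bullet> \<alpha>" "y \<bullet> \<alpha> < of_int \<lfloor>z \<bullet> \<alpha>\<rfloor> + 1" if "\<alpha> \<in> \<Phi>" "\<alpha> \<noteq> \<beta>" "\<alpha> \<noteq> - \<beta>" for \<alpha>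
    using e(1)[OF that] y_in by auto
  have nint: "r \<noteq> of_int k" if "of_int j < r" "r < of_int j + 1" for r :: real and j k :: int
    using that by auto
  have reg: "regular y"
    unfolding regular_def
  proof (intro ballI notI)
    fix \<alpha> assume \<alpha>: "\<alpha> \<in> \<Phi>" "y \<bullet> \<alpha> \<in> \<int>"
    then obtain k where k: "y \<bullet> \<alpha> = of_int k" by (auto simp: Ints_def)
    consider "\<alpha> = \<beta>" | "\<alpha> = - \<beta>" | "\<alpha> \<noteq> \<beta>" "\<alpha> \<noteq> - \<beta>" by blast
    then show False
    proof cases
      case 1
      then show False using nint[OF y\<beta>, of k] k by simp
    next
      case 2
      then show False using nint[OF y\<beta>, of "- k"] k by simp
    next
      case 3
      then show False using nint[OF bounds, of \<alpha> k] k \<alpha> by simp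
    qed
  qed
  moreover have "adj y (aff_refl \<beta> m y)"
  proof (rule wall_adj[OF reg \<beta> z\<beta>])
    fix \<alpha> k assume \<alpha>: "\<alpha> \<in> \<Phi>" and ns: "\<not> same_hyp \<alpha> k \<beta> m"
    consider "\<alpha> = \<beta>" "k \<noteq> m" | "\<alpha> = - \<beta>" "k \<noteq> - m" | "\<alpha> \<noteq> \<beta>" "\<alpha> \<noteq> - \<beta>"
      using ns by (auto simp: same_hyp_def)
    then show "of_int k < y \<bullet> \<alpha> \<longleftrightarrow> of_int k < z \<bullet> \<alpha>"
    proof cases
      case 1
      then show ?thesis using y\<beta> z\<beta> by auto
    next
      case 2
      then have "real_of_int k \<le> - of_int m - 1 \<or> real_of_int k \<ge> - of_int m + 1"
        by (cases "k < - m") linarith+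
      then show ?thesis using y\<beta> z\<beta> 2(1) by auto
    next
      case 3
      have "\<lfloor>y \<bullet> \<alpha>\<rfloor> = \<lfloor>z \<bullet> \<alpha>\<rfloor>" using bounds[OF \<alpha> 3] by (simp add: floor_eq_iff less_imp_le)
      then show ?thesis
        using int_less_iff_floor[OF z\<alpha>[OF \<alpha> 3]] int_less_iff_floor[OF regular_neq[OF reg \<alpha>]] by simp
    qed
  qed
  ultimately show ?thesis by (rule that)
qed

text \<open>Walk to an alcove next to the hyperplane, cross it, and return along the reflected
  gallery.\<close>

lemma reach_aff_refl:
  assumes x: "regular x" and \<beta>: "\<beta> \<in> \<Phi>"
  shows "\<exists>n. gal n x (aff_refl \<beta> m x)"
proof -
  obtain y where y: "regular y" "adj y (aff_refl \<beta> m y)" by (rule next_to_hyperplane[OF \<beta>])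
  obtain n y' where g: "gal n x y'" "sim y' y" using reach_alcove[OF x y(1)] by blast
  have "adj y' (aff_refl \<beta> m y')" by (rule sim_adj[OF y(1) g(2) \<beta> y(2)])
  moreover have "gal n (aff_refl \<beta> m y') (aff_refl \<beta> m x)"
    using gal_sym[OF g(1)] gal_aff_refl \<beta> by blast
  ultimately show ?thesis using gal_trans[OF g(1)] gal_Suc by blast
qed

section \<open>The affine Weyl group\<close>

inductive_set affine_group :: "('a \<Rightarrow> 'a) set" where
  id: "(\<lambda>x. x) \<in> affine_group"
| refl: "\<beta> \<in> \<Phi> \<Longrightarrow> g \<in> affine_group \<Longrightarrow> (\<lambda>x. aff_refl \<beta> m (g x)) \<in> affine_group"

lemma affine_group_comp: "g \<in> affine_group \<Longrightarrow> h \<in> affine_group \<Longrightarrow> (\<lambda>x. g (h x)) \<in> affine_group"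
  by (induction rule: affine_group.induct) (auto intro: affine_group.intros)

lemma affine_group_dist: "g \<in> affine_group \<Longrightarrow> dist (g x) (g y) = dist x y"
  by (induction rule: affine_group.induct) (auto simp: dist_aff_refl root_nz)

lemma affine_group_gal:
  assumes "g \<in> affine_group" "regular x"
  shows "regular (g x) \<and> (\<exists>n. gal n x (g x))"
  using assms(1)
proof (induction rule: affine_group.induct)
  case id
  then show ?case using assms gal_0 by blast
next
  case (refl \<beta> g m)
  then show ?case using regular_aff_refl reach_aff_refl[of "g x" \<beta> m] gal_trans by blast
qed

text \<open>The group acts freely on alcoves: \<open>x\<close> and \<open>g x\<close> are joined by
  a gallery, and \<open>gal_closed\<close> applies.\<close>

lemma affine_group_sim: "g \<in> affine_group \<Longrightarrow> regular x \<Longrightarrow> sim x (g x) \<Longrightarrow> g x = x"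
  using affine_group_gal gal_closed by metis

text \<open>Used to pull hyperplanes back along \<open>g\<close> and to see that orbits are
  discrete.\<close>

lemma affine_group_inner:
  "g \<in> affine_group \<Longrightarrow> \<alpha> \<in> \<Phi> \<Longrightarrow> \<exists>\<gamma>\<in>\<Phi>. \<exists>j::int. \<forall>x. g x \<bullet> \<alpha> = x \<bullet> \<gamma> + of_int j"
proof (induction arbitrary: \<alpha> rule: affine_group.induct)
  case id
  then show ?case by (intro bexI[of _ \<alpha>] exI[of _ 0]) auto
next
  case (refl \<beta> g m)
  then obtain \<gamma> j where "\<gamma> \<in> \<Phi>" "\<And>x. g x \<bullet> aff_refl \<beta> 0 \<alpha> = x \<bullet> \<gamma> + of_int j" using root_refl by metis
  moreover obtain i :: int where "coroot \<beta> \<bullet> \<alpha> = of_int i"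
    using of_int_coroot_inner[OF refl.hyps(1) refl.prems] by metis
  ultimately show ?case
    by (intro bexI[of _ \<gamma>] exI[of _ "j + m * i"]) (auto simp: aff_refl_inner)
qed

end

section \<open>The alcove as a fundamental domain\<close>

context positive_roots
begin

definition calcove :: "'a set" where
  "calcove = {x. \<forall>\<alpha>\<in>P. 0 \<le> x \<bullet> \<alpha> \<and> x \<bullet> \<alpha> \<le> 1}"

lemma alcove_nonempty: "alcove P \<noteq> {}"
proof -
  obtain v where v: "P = {\<alpha>\<in>\<Phi>. \<alpha> \<bullet> v > 0}" using positive by (auto simp: positive_system_def)
  \<comment> \<open>Dividing \<open>v\<close> by \<open>1 + s\<close>, with \<open>s\<close> at
    least every value on a positive root, brings all values into the open unit interval.\<close>
  define s where "s = (\<Sum>\<alpha>\<in>P. \<alpha> \<bullet> v)"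
  have le: "\<alpha> \<bullet> v \<le> s" if "\<alpha> \<in> P" for \<alpha>
    unfolding s_def by (rule member_le_sum[OF that _ finite_positive]) (auto simp: v less_imp_le)
  have "s \<ge> 0" unfolding s_def by (rule sum_nonneg) (auto simp: v less_imp_le)
  have "(1 / (1 + s)) *\<^sub>R v \<in> alcove P"
    unfolding alcove_def
  proof (intro CollectI ballI conjI)
    fix \<alpha> assume "\<alpha> \<in> P"
    then have "\<alpha> \<bullet> v > 0" "\<alpha> \<bullet> v \<le> s" using le by (auto simp: v)
    then show "0 < (1 / (1 + s)) *\<^sub>R v \<bullet> \<alpha>" "(1 / (1 + s)) *\<^sub>R v \<bullet> \<alpha> < 1"
      using \<open>s \<ge> 0\<close> by (auto simp: inner_commute divide_simps)
  qed
  then show ?thesis by blast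
qed

lemma open_alcove: "open (alcove P)"
proof -
  have "alcove P = (\<Inter>\<alpha>\<in>P. {x. 0 < x \<bullet> \<alpha>} \<inter> {x. x \<bullet> \<alpha> < 1})" by (auto simp: alcove_def)
  then show ?thesis
    by (simp only:) (intro open_INT finite_positive ballI open_Int open_Collect_less continuous_intros)
qed

lemma closed_calcove: "closed calcove"
proof -
  have "calcove = (\<Inter>\<alpha>\<in>P. {x. 0 \<le> x \<bullet> \<alpha>} \<inter> {x. x \<bullet> \<alpha> \<le> 1})" by (auto simp: calcove_def)
  then show ?thesis
    by (simp only:) (intro closed_INT ballI closed_Int closed_Collect_le continuous_intros)
qed

lemma closure_alcove: "closure (alcove P) = calcove"
proof
  show "closure (alcove P) \<subseteq> calcove"
    by (rule closure_minimal[OF _ closed_calcove]) (auto simp: alcove_def calcove_def less_imp_le)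
  show "calcove \<subseteq> closure (alcove P)"
  proof
    fix x assume x: "x \<in> calcove"
    obtain a where a: "a \<in> alcove P" using alcove_nonempty by blast
    have "x + (1 / real (Suc n)) *\<^sub>R (a - x) \<in> alcove P" for n
    proof -
      define e where "e = 1 / real (Suc n)"
      have e: "0 < e" "e \<le> 1" by (auto simp: e_def)
      have "0 < (x + e *\<^sub>R (a - x)) \<bullet> \<alpha> \<and> (x + e *\<^sub>R (a - x)) \<bullet> \<alpha> < 1" if "\<alpha> \<in> P" for \<alpha>
      proof -
        have eq: "(x + e *\<^sub>R (a - x)) \<bullet> \<alpha> = (1 - e) * (x \<bullet> \<alpha>) + e * (a \<bullet> \<alpha>)"
          by (simp add: inner_add_left inner_diff_left algebra_simps)
        have xa: "0 \<le> x \<bullet> \<alpha>" "x \<bullet> \<alpha> \<le> 1" "0 < a \<bullet> \<alpha>" "a \<bullet> \<alpha> < 1"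
          using x a that by (auto simp: calcove_def alcove_def)
        have "0 < (1 - e) * (x \<bullet> \<alpha>) + e * (a \<bullet> \<alpha>)"
          using e xa by (intro add_nonneg_pos mult_nonneg_nonneg mult_pos_pos) auto
        moreover have "(1 - e) * (x \<bullet> \<alpha>) \<le> 1 - e" using e xa by (simp add: mult_left_le)
        moreover have "e * (a \<bullet> \<alpha>) < e" using e xa by simp
        ultimately show ?thesis unfolding eq by linarith
      qed
      then show ?thesis by (simp add: alcove_def e_def)
    qed
    moreover have "(\<lambda>n. x + (1 / real (Suc n)) *\<^sub>R (a - x)) \<longlonglongrightarrow> x + 0 *\<^sub>R (a - x)"
      by (intro tendsto_intros LIMSEQ_Suc[OF lim_1_over_n])
    ultimately show "x \<in> closure (alcove P)"
      unfolding closure_sequential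
      by (intro exI[of _ "\<lambda>n. x + (1 / real (Suc n)) *\<^sub>R (a - x)"] conjI allI) simp_all
  qed
qed

lemma span_positive: "span P = UNIV"
proof -
  have "\<Phi> \<subseteq> span P" using positive_cases span_base span_neg by fastforce
  then have "span \<Phi> \<subseteq> span P" by (rule span_minimal) simp
  then show ?thesis using span_roots by auto
qed

lemma bounded_calcove: "bounded calcove"
  by (rule bounded_inner_values[OF span_positive]) (auto simp: calcove_def)

lemma compact_calcove: "compact calcove"
  using bounded_calcove closed_calcove by (simp add: compact_eq_bounded_closed)

lemma frontier_alcove: "frontier (alcove P) = calcove - alcove P"
  using open_alcove by (simp add: frontier_def closure_alcove interior_open)

lemma alcove_subset: "alcove P \<subseteq> calcove"
  by (auto simp: alcove_def calcove_def)

lemma frontier_alcoveD: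
  assumes "x \<in> frontier (alcove P)"
  obtains \<alpha> where "\<alpha> \<in> P" "x \<bullet> \<alpha> \<in> \<int>"
proof -
  obtain \<alpha> where "\<alpha> \<in> P" "x \<bullet> \<alpha> = 0 \<or> x \<bullet> \<alpha> = 1"
    using assms unfolding frontier_alcove by (force simp: alcove_def calcove_def)
  then show ?thesis using that by auto
qed

text \<open>On the alcove a positive root takes values between 0 and 1, and no integer lies strictly
  between; negative roots reduce to these.\<close>

lemma alcove_sides:
  assumes "\<alpha> \<in> \<Phi>"
  shows "(\<forall>x\<in>alcove P. of_int k < x \<bullet> \<alpha>) \<and> (\<forall>x\<in>calcove. of_int k \<le> x \<bullet> \<alpha>) \<or>
    (\<forall>x\<in>alcove P. x \<bullet> \<alpha> < of_int k) \<and> (\<forall>x\<in>calcove. x \<bullet> \<alpha> \<le> of_int k)"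
proof -
  have pos: "(\<forall>x\<in>alcove P. of_int k < x \<bullet> \<alpha>) \<and> (\<forall>x\<in>calcove. of_int k \<le> x \<bullet> \<alpha>) \<or>
    (\<forall>x\<in>alcove P. x \<bullet> \<alpha> < of_int k) \<and> (\<forall>x\<in>calcove. x \<bullet> \<alpha> \<le> of_int k)" if "\<alpha> \<in> P" for \<alpha> k
  proof -
    have x: "0 < x \<bullet> \<alpha>" "x \<bullet> \<alpha> < 1" if "x \<in> alcove P" for x using that \<open>\<alpha> \<in> P\<close> by (auto simp: alcove_def)
    have y: "0 \<le> x \<bullet> \<alpha>" "x \<bullet> \<alpha> \<le> 1" if "x \<in> calcove" for x using that \<open>\<alpha> \<in> P\<close> by (auto simp: calcove_def)
    consider "k \<le> 0" | "k \<ge> 1" by linarith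
    then show ?thesis
    proof cases
      case 1
      then have "real_of_int k \<le> 0" by simp
      then show ?thesis using x y by (meson le_less_trans order_trans)
    next
      case 2
      then have "real_of_int k \<ge> 1" by simp
      then show ?thesis using x y by (meson less_le_trans order_trans)
    qed
  qed
  consider "\<alpha> \<in> P" | "- \<alpha> \<in> P" using positive_cases[OF assms] by blast
  then show ?thesis
  proof cases
    case 1
    then show ?thesis by (rule pos)
  next
    case 2
    from pos[OF this, of "- k"] show ?thesis by auto
  qed
qed

lemma regular_alcove:
  assumes "x \<in> alcove P"
  shows "regular x"
  unfolding regular_def
proof (intro ballI notI)
  fix \<alpha> assume \<alpha>: "\<alpha> \<in> \<Phi>" "x \<bullet> \<alpha> \<in> \<int>"
  then obtain k where "x \<bullet> \<alpha> = of_int k" by (auto simp: Ints_def)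
  then show False using alcove_sides[OF \<alpha>(1), of k] assms by force
qed

text \<open>Inner products of orbit points with a root lie in finitely many cosets of the integers,
  so each ball contains finitely many orbit points. A subset \<open>G\<close> is allowed, so that
  the minimum can be taken over the maps with a prescribed value at one point.\<close>

lemma orbit_argmin:
  assumes "G \<subseteq> affine_group" "G \<noteq> {}"
  obtains g where "g \<in> G" "\<And>h. h \<in> G \<Longrightarrow> dist a (g x) \<le> dist a (h x)"
proof -
  obtain g0 where g0: "g0 \<in> G" using assms by blast
  define S where "S = {g x | g. g \<in> G \<and> dist a (g x) \<le> dist a (g0 x)}"
  have "finite S"
  proof (rule finite_bounded_inner_values[OF finite_roots span_roots])
    fix \<alpha> assume \<alpha>: "\<alpha> \<in> \<Phi>"
    define K where "K = (norm a + dist a (g0 x)) * norm \<alpha>"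
    have "(\<lambda>y. y \<bullet> \<alpha>) ` S \<subseteq> (\<Union>\<gamma>\<in>\<Phi>. (\<lambda>r. x \<bullet> \<gamma> + r) ` {r \<in> \<int>. \<bar>r\<bar> \<le> K + \<bar>x \<bullet> \<gamma>\<bar>})"
    proof (intro image_subsetI)
      fix y assume "y \<in> S"
      then obtain g where g: "g \<in> G" "y = g x" "dist a (g x) \<le> dist a (g0 x)" by (auto simp: S_def)
      obtain \<gamma> j where \<gamma>: "\<gamma> \<in> \<Phi>" "g x \<bullet> \<alpha> = x \<bullet> \<gamma> + of_int j"
        using affine_group_inner[of g \<alpha>] g assms \<alpha> by blast
      have "norm y \<le> norm a + dist a y" using norm_triangle_ineq[of a "y - a"] by (simp add: dist_norm norm_minus_commute)
      then have "norm y \<le> norm a + dist a (g0 x)" using g by simp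
      then have "norm y * norm \<alpha> \<le> K" unfolding K_def by (rule mult_right_mono) simp
      then have "\<bar>y \<bullet> \<alpha>\<bar> \<le> K" using Cauchy_Schwarz_ineq2[of y \<alpha>] by linarith
      then have "\<bar>real_of_int j\<bar> \<le> K + \<bar>x \<bullet> \<gamma>\<bar>" using \<gamma>(2) unfolding g(2) by linarith
      then show "y \<bullet> \<alpha> \<in> (\<Union>\<gamma>\<in>\<Phi>. (\<lambda>r. x \<bullet> \<gamma> + r) ` {r \<in> \<int>. \<bar>r\<bar> \<le> K + \<bar>x \<bullet> \<gamma>\<bar>})"
        using \<gamma> g(2) by (auto intro!: bexI[of _ \<gamma>] image_eqI[of _ _ "of_int j"])
    qed
    then show "finite ((\<lambda>y. y \<bullet> \<alpha>) ` S)"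
      by (rule finite_subset) (intro finite_UN_I finite_roots finite_imageI finite_bounded_Ints)
  qed
  moreover have "S \<noteq> {}" using g0 by (auto simp: S_def)
  ultimately obtain s where s: "s \<in> S" "\<And>y. y \<in> S \<Longrightarrow> dist a s \<le> dist a y"
    using finite_argmin[of S "dist a"] by blast
  obtain g where g: "g \<in> G" "s = g x" "dist a (g x) \<le> dist a (g0 x)" using s(1) by (auto simp: S_def)
  have "dist a (g x) \<le> dist a (h x)" if "h \<in> G" for h
  proof (cases "dist a (h x) \<le> dist a (g0 x)")
    case True
    then have "h x \<in> S" using that by (auto simp: S_def)
    then show ?thesis using s(2) g by blast
  qed (use g in linarith)
  then show ?thesis using that g by blast
qed

text \<open>The orbit point closest to an interior point \<open>a\<close> satisfies all
  inequalities; otherwise reflection in a violated one, of level 0 or 1, would bring it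
  closer.\<close>

lemma to_calcove: "\<exists>g\<in>affine_group. g x \<in> calcove"
proof -
  obtain a where a: "a \<in> alcove P" using alcove_nonempty by blast
  obtain g where g: "g \<in> affine_group" and min: "\<And>h. h \<in> affine_group \<Longrightarrow> dist a (g x) \<le> dist a (h x)"
    using orbit_argmin[OF order_refl, of a x] affine_group.id by (metis empty_iff)
  have "g x \<in> calcove"
  proof (rule ccontr)
    assume "g x \<notin> calcove"
    then obtain \<alpha> where \<alpha>: "\<alpha> \<in> P" "g x \<bullet> \<alpha> < 0 \<or> g x \<bullet> \<alpha> > 1" by (force simp: calcove_def)
    define k :: int where "k = (if g x \<bullet> \<alpha> < 0 then 0 else 1)"
    have "dist a (aff_refl \<alpha> k (g x)) < dist a (g x)"
    proof (rule dist_aff_refl_less)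
      show "\<alpha> \<noteq> 0" using \<alpha> positive_root root_nz by blast
      show "sep \<alpha> k a (g x)" "a \<bullet> \<alpha> \<noteq> of_int k" "g x \<bullet> \<alpha> \<noteq> of_int k"
        using \<alpha> a by (auto simp: sep_def k_def alcove_def split: if_splits)
    qed
    then show False using min[OF affine_group.refl[OF positive_root[OF \<alpha>(1)] g, of k]] by linarith
  qed
  then show ?thesis using g by blast
qed

text \<open>Among the elements taking \<open>x\<close> to \<open>y\<close>, one moving \<open>a\<close> as little as possible
  fixes \<open>a\<close>; hence \<open>x\<close> and \<open>y\<close> have the same distance to every point of the alcove.\<close>

lemma calcove_orbit_unique:
  assumes x: "x \<in> calcove" and y: "y \<in> calcove" and f: "f \<in> affine_group" "y = f x"
  shows "x = y"
proof -
  have eq: "dist y a = dist x a" if a: "a \<in> alcove P" for a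
  proof -
    define G where "G = {g \<in> affine_group. g x = y}"
    have "G \<subseteq> affine_group" "G \<noteq> {}" using f by (auto simp: G_def)
    then obtain g where g: "g \<in> G" and min: "\<And>h. h \<in> G \<Longrightarrow> dist a (g a) \<le> dist a (h a)"
      using orbit_argmin[of G a a] by metis
    have gG: "g \<in> affine_group" "g x = y" using g by (auto simp: G_def)
    have rega: "regular a" by (rule regular_alcove[OF a])
    have regg: "regular (g a)" using affine_group_gal[OF gG(1) rega] by blast
    have "sim a (g a)"
      unfolding sim_def
    proof (intro ballI allI notI)
      fix \<alpha> k assume \<alpha>: "\<alpha> \<in> \<Phi>" and sep: "sep \<alpha> k a (g a)"
      obtain \<gamma> j where \<gamma>: "\<gamma> \<in> \<Phi>" "\<And>x. g x \<bullet> \<alpha> = x \<bullet> \<gamma> + of_int j"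
        using affine_group_inner[OF gG(1) \<alpha>] by blast
      have g\<gamma>: "of_int k < g w \<bullet> \<alpha> \<longleftrightarrow> of_int (k - j) < w \<bullet> \<gamma>"
         "g w \<bullet> \<alpha> < of_int k \<longleftrightarrow> w \<bullet> \<gamma> < of_int (k - j)"
         "of_int k \<le> g w \<bullet> \<alpha> \<longleftrightarrow> of_int (k - j) \<le> w \<bullet> \<gamma>"
         "g w \<bullet> \<alpha> \<le> of_int k \<longleftrightarrow> w \<bullet> \<gamma> \<le> of_int (k - j)" for w
        using \<gamma>(2)[of w] by auto
      \<comment> \<open>The closed alcove and its image under \<open>g\<close> lie on opposite
        closed sides of a hyperplane separating \<open>a\<close> from \<open>g a\<close>, and
        \<open>y = g x\<close> belongs to both.\<close>
      have "y \<bullet> \<alpha> = of_int k"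
        using alcove_sides[OF \<alpha>, of k] alcove_sides[OF \<gamma>(1), of "k - j"] sep a x y gG(2) g\<gamma>[of a] g\<gamma>[of x]
          regular_neq[OF rega \<alpha>, of k] regular_neq[OF regg \<alpha>, of k]
        unfolding sep_def by (smt (verit))
      then have "aff_refl \<alpha> k y = y" by (rule aff_refl_fixed)
      then have "(\<lambda>x. aff_refl \<alpha> k (g x)) \<in> G"
        using affine_group.refl[OF \<alpha> gG(1)] gG(2) by (simp add: G_def)
      from min[OF this] have "dist a (g a) \<le> dist a (aff_refl \<alpha> k (g a))" .
      moreover have "dist a (aff_refl \<alpha> k (g a)) < dist a (g a)"
        by (rule dist_aff_refl_less[OF root_nz[OF \<alpha>] sep regular_neq[OF rega \<alpha>] regular_neq[OF regg \<alpha>]])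
      ultimately show False by linarith
    qed
    then have "g a = a" by (rule affine_group_sim[OF gG(1) rega])
    then show ?thesis using affine_group_dist[OF gG(1), of x a] gG(2) by simp
  qed
  obtain a where a: "a \<in> alcove P" using alcove_nonempty by blast
  obtain e where e: "e > 0" "ball a e \<subseteq> alcove P" using open_alcove a openE by blast
  \<comment> \<open>Equality of the distances to \<open>b\<close> is a linear condition on
    \<open>b\<close>; holding on an open set, it forces \<open>x = y\<close>.\<close>
  have lin: "2 * (b \<bullet> (x - y)) = x \<bullet> x - y \<bullet> y" if "b \<in> alcove P" for b
  proof -
    have "(dist y b)\<^sup>2 = (dist x b)\<^sup>2" using eq[OF that] by simp
    then show ?thesis
      by (simp add: dist_norm power2_norm_eq_inner inner_diff_left inner_diff_right inner_commute)
  qed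
  show ?thesis
  proof (rule ccontr)
    assume ne: "x \<noteq> y"
    define b where "b = a + (e / (2 * norm (x - y))) *\<^sub>R (x - y)"
    have "b \<in> ball a e" using ne e by (simp add: b_def dist_norm)
    then have "b \<bullet> (x - y) = a \<bullet> (x - y)" using lin[of b] lin[OF a] e by auto
    then have "(e / (2 * norm (x - y))) * ((x - y) \<bullet> (x - y)) = 0"
      by (simp only: b_def inner_add_left inner_scaleR_left)
    then show False using ne e by simp
  qed
qed

end

section \<open>Antisymmetric trigonometric polynomials\<close>

lemma sin_pi_eq_0_iff: "sin (pi * r) = 0 \<longleftrightarrow> r \<in> \<int>"
  by (auto simp: sin_zero_iff_int2 Ints_def mult.commute)

text \<open>The zeros of a sine factor are nowhere dense along any transversal direction.\<close>

lemma sin_cancel: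
  fixes f :: "'a::euclidean_space \<Rightarrow> complex"
  assumes f: "continuous_on UNIV f" and z: "z \<bullet> \<beta> \<noteq> 0"
    and X: "\<And>x t. x \<in> X \<Longrightarrow> x + t *\<^sub>R z \<in> X"
    and 0: "\<And>x. x \<in> X \<Longrightarrow> complex_of_real (sin (pi * (x \<bullet> \<beta>))) * f x = 0"
    and x: "x \<in> X"
  shows "f x = 0"
proof (rule ccontr)
  assume nz: "f x \<noteq> 0"
  have "((\<lambda>t. f (x + t *\<^sub>R z)) \<longlongrightarrow> f (x + 0 *\<^sub>R z)) (at_right 0)"
  proof (rule isCont_tendsto_compose[of _ f])
    show "isCont f (x + 0 *\<^sub>R z)" using f by (simp add: continuous_on_eq_continuous_at)
    show "((\<lambda>t. x + t *\<^sub>R z) \<longlongrightarrow> x + 0 *\<^sub>R z) (at_right 0)" by (intro tendsto_intros)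
  qed
  then have "\<forall>\<^sub>F t in at_right 0. f (x + t *\<^sub>R z) \<noteq> 0"
    by (rule tendsto_imp_eventually_ne) (use nz in simp)
  then obtain d where d: "d > 0" "\<And>t. 0 < t \<Longrightarrow> t < d \<Longrightarrow> f (x + t *\<^sub>R z) \<noteq> 0"
    unfolding eventually_at_right_field by auto
  have int: "x \<bullet> \<beta> + t * (z \<bullet> \<beta>) \<in> \<int>" if "0 < t" "t < d" for t
  proof -
    have "sin (pi * ((x + t *\<^sub>R z) \<bullet> \<beta>)) = 0" using 0[OF X[OF x], of t] d(2)[OF that] by auto
    then show ?thesis unfolding sin_pi_eq_0_iff by (simp add: inner_add_left)
  qed
  \<comment> \<open>Both \<open>t\<close> and \<open>2 * t\<close> lie in the interval, so
    \<open>t * (z \<bullet> \<beta>)\<close> is a difference of two integers, and it is at most 1/2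
    in absolute value.\<close>
  define t where "t = min (d / 3) (1 / (2 * \<bar>z \<bullet> \<beta>\<bar>))"
  have t: "0 < t" "2 * t < d" using d z by (auto simp: t_def)
  have "t * \<bar>z \<bullet> \<beta>\<bar> \<le> 1 / (2 * \<bar>z \<bullet> \<beta>\<bar>) * \<bar>z \<bullet> \<beta>\<bar>" by (rule mult_right_mono) (auto simp: t_def)
  then have "\<bar>t * (z \<bullet> \<beta>)\<bar> < 1" using t z by (simp add: abs_mult)
  moreover have "t * (z \<bullet> \<beta>) \<in> \<int>"
    using Ints_diff[OF int[of "2 * t"] int[of t]] t by (simp add: algebra_simps)
  ultimately have "t * (z \<bullet> \<beta>) = 0" using Ints_nonzero_abs_less1 by blast
  then show False using t z by simp
qed

text \<open>The linear part of the reflection moves the frequencies, its translation part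
  contributes a phase.\<close>

lemma coef_aff_refl:
  assumes f: "f \<in> trig_polynomials" and \<alpha>: "\<alpha> \<noteq> 0"
  shows "(\<lambda>x. f (aff_refl \<alpha> k x)) \<in> trig_polynomials"
    and "coef (\<lambda>x. f (aff_refl \<alpha> k x)) =
      (\<lambda>\<eta>. coef f (aff_refl \<alpha> 0 \<eta>) * cis (- (of_int k * (\<eta> \<bullet> coroot \<alpha>))))"
proof -
  let ?S = "{\<xi>. coef f \<xi> \<noteq> 0}" and ?s = "aff_refl \<alpha> 0"
  let ?c = "\<lambda>\<eta>. coef f (?s \<eta>) * cis (- (of_int k * (\<eta> \<bullet> coroot \<alpha>)))"
  have S: "{\<eta>. ?c \<eta> \<noteq> 0} = ?s ` ?S"
  proof
    show "{\<eta>. ?c \<eta> \<noteq> 0} \<subseteq> ?s ` ?S"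
    proof
      fix \<eta> assume "\<eta> \<in> {\<eta>. ?c \<eta> \<noteq> 0}"
      then have "?s \<eta> \<in> ?S" by simp
      moreover have "\<eta> = ?s (?s \<eta>)" using \<alpha> by simp
      ultimately show "\<eta> \<in> ?s ` ?S" by blast
    qed
    show "?s ` ?S \<subseteq> {\<eta>. ?c \<eta> \<noteq> 0}" using \<alpha> by auto
  qed
  have inj: "inj_on ?s ?S" by (rule inj_on_inverseI[of _ ?s]) (use \<alpha> in simp)
  have fin: "finite {\<eta>. ?c \<eta> \<noteq> 0}" unfolding S using finite_coef[OF f] by simp
  have eq: "f (aff_refl \<alpha> k x) = trig_sum ?c x" for x
  proof -
    have cr: "?s \<xi> \<bullet> coroot \<alpha> = - (\<xi> \<bullet> coroot \<alpha>)" for \<xi>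
    proof -
      have "?s (coroot \<alpha>) = - coroot \<alpha>"
        using \<alpha> by (simp add: aff_refl_def coroot_inner_self scaleR_2)
      then show ?thesis by (simp add: refl_adjoint)
    qed
    have "f (aff_refl \<alpha> k x) = (\<Sum>\<xi>\<in>?S. coef f \<xi> * cis (\<xi> \<bullet> aff_refl \<alpha> k x))"
      by (subst trig_sum_coef[OF f, symmetric]) (simp add: trig_sum_def)
    also have "\<dots> = (\<Sum>\<xi>\<in>?S. ?c (?s \<xi>) * cis (?s \<xi> \<bullet> x))"
    proof (rule sum.cong[OF refl])
      fix \<xi>
      have "\<xi> \<bullet> aff_refl \<alpha> k x = ?s \<xi> \<bullet> x + of_int k * (\<xi> \<bullet> coroot \<alpha>)"
        by (simp only: inner_commute[of \<xi> "aff_refl \<alpha> k x"] aff_refl_inner[of \<alpha> k x \<xi>]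
            inner_commute[of "?s \<xi>" x] inner_commute[of \<xi> "coroot \<alpha>"])
      then show "coef f \<xi> * cis (\<xi> \<bullet> aff_refl \<alpha> k x) = ?c (?s \<xi>) * cis (?s \<xi> \<bullet> x)"
        using \<alpha> by (simp add: cr cis_mult add.commute)
    qed
    also have "\<dots> = trig_sum ?c x" unfolding trig_sum_def S by (simp add: sum.reindex[OF inj])
    finally show ?thesis .
  qed
  show "(\<lambda>x. f (aff_refl \<alpha> k x)) \<in> trig_polynomials"
    using trig_sum_polynomial[OF fin] by (simp only: eq)
  show "coef (\<lambda>x. f (aff_refl \<alpha> k x)) = ?c" by (rule coef_eqI[OF fin eq])
qed

lemma sin_shift_int: "sin (pi * (r + of_int m)) = cos (pi * of_int m) * sin (pi * r)"
proof -
  have "sin (pi * of_int m) = 0" by (simp add: sin_pi_eq_0_iff)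
  then show ?thesis by (simp add: distrib_left sin_add)
qed

text \<open>Multiplication by the sine shifts frequencies by \<open>pi *\<^sub>R \<alpha>\<close> in
  both directions. A frequency highest in direction \<open>v\<close>, shifted further up, cannot be
  cancelled, because the only other contribution would come from a still higher frequency.\<close>

lemma top_frequency_sin:
  fixes f :: "'a::euclidean_space \<Rightarrow> complex"
  assumes f: "f \<in> trig_polynomials" and \<xi>: "coef f \<xi> \<noteq> 0" and \<alpha>: "\<alpha> \<bullet> v \<noteq> 0"
  shows "\<exists>\<eta>. coef (\<lambda>x. complex_of_real (sin (pi * (x \<bullet> \<alpha>))) * f x) \<eta> \<noteq> 0 \<and>
    \<xi> \<bullet> v + pi * \<bar>\<alpha> \<bullet> v\<bar> \<le> \<eta> \<bullet> v"
proof -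
  have ne: "{\<xi>. coef f \<xi> \<noteq> 0} \<noteq> {}" using \<xi> by auto
  obtain \<zeta> where "\<zeta> \<in> {\<xi>. coef f \<xi> \<noteq> 0}"
    and min': "\<And>\<eta>. \<eta> \<in> {\<xi>. coef f \<xi> \<noteq> 0} \<Longrightarrow> - (\<zeta> \<bullet> v) \<le> - (\<eta> \<bullet> v)"
    using finite_argmin[OF finite_coef[OF f] ne, of "\<lambda>\<zeta>. - (\<zeta> \<bullet> v)"] by blast
  then have \<zeta>: "coef f \<zeta> \<noteq> 0" and min: "\<And>\<eta>. coef f \<eta> \<noteq> 0 \<Longrightarrow> - (\<zeta> \<bullet> v) \<le> - (\<eta> \<bullet> v)"
    using min' by simp_all
  have big: "coef f \<eta> = 0" if "\<eta> \<bullet> v > \<zeta> \<bullet> v" for \<eta> using min[of \<eta>] that by auto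
  have \<zeta>\<xi>: "\<xi> \<bullet> v \<le> \<zeta> \<bullet> v" using min[OF \<xi>] by simp
  consider "\<alpha> \<bullet> v > 0" | "\<alpha> \<bullet> v < 0" using \<alpha> by linarith
  then show ?thesis
  proof cases
    case 1
    then have "coef f (\<zeta> + pi *\<^sub>R \<alpha> + pi *\<^sub>R \<alpha>) = 0" by (intro big) (simp add: inner_add_left)
    then show ?thesis using \<zeta> \<zeta>\<xi> 1
      by (intro exI[of _ "\<zeta> + pi *\<^sub>R \<alpha>"]) (simp add: coef_sin_mult[OF f] inner_add_left)
  next
    case 2
    then have "coef f (\<zeta> - pi *\<^sub>R \<alpha> - pi *\<^sub>R \<alpha>) = 0"
      by (intro big) (simp add: inner_diff_left mult_pos_neg)
    then show ?thesis using \<zeta> \<zeta>\<xi> 2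
      by (intro exI[of _ "\<zeta> - pi *\<^sub>R \<alpha>"]) (simp add: coef_sin_mult[OF f] inner_diff_left)
  qed
qed

section \<open>The sine product: symmetry, divisibility and frequencies\<close>

context positive_roots
begin

definition H :: "'a \<Rightarrow> complex" where "H x = complex_of_real (sine_product P x)"

definition sines :: "'a set \<Rightarrow> 'a \<Rightarrow> complex" where
  "sines S x = (\<Prod>\<alpha>\<in>S. complex_of_real (sin (pi * (x \<bullet> \<alpha>))))"

lemma H_eq_sines: "H = sines P"
  by (rule ext) (simp add: H_def sines_def sine_product_def)

lemma sines_insert:
  "finite S \<Longrightarrow> \<alpha> \<notin> S \<Longrightarrow> sines (insert \<alpha> S) x = complex_of_real (sin (pi * (x \<bullet> \<alpha>))) * sines S x"
  by (simp add: sines_def)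

lemma tp_sines: "sines S \<in> trig_polynomials"
  unfolding sines_def[abs_def] by (rule tp_prod) (rule tp_sin)

lemma tp_H: "H \<in> trig_polynomials"
  by (simp add: H_eq_sines tp_sines)

text \<open>The component of \<open>\<beta>\<close> orthogonal to \<open>\<alpha>\<close> serves; it
  is nonzero because distinct positive roots are not parallel.\<close>

lemma transversal:
  assumes "\<alpha> \<in> P" "\<beta> \<in> P" "\<alpha> \<noteq> \<beta>"
  obtains z where "z \<bullet> \<alpha> = 0" "z \<bullet> \<beta> \<noteq> 0"
proof -
  have \<Phi>: "\<alpha> \<in> \<Phi>" "\<beta> \<in> \<Phi>" using assms positive_root by auto
  define c where "c = \<beta> \<bullet> \<alpha> / (\<alpha> \<bullet> \<alpha>)"
  define z where "z = \<beta> - c *\<^sub>R \<alpha>"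
  have z\<alpha>: "z \<bullet> \<alpha> = 0" using root_nz[OF \<Phi>(1)] by (simp add: z_def c_def inner_diff_left)
  have "z \<bullet> \<beta> \<noteq> 0"
  proof
    assume "z \<bullet> \<beta> = 0"
    moreover have "z \<bullet> z = z \<bullet> \<beta> - c * (z \<bullet> \<alpha>)"
      by (subst (2) z_def) (simp add: inner_diff_right)
    ultimately have "z = 0" using z\<alpha> by simp
    then have "\<beta> = c *\<^sub>R \<alpha>" by (simp add: z_def)
    then have "\<beta> = \<alpha> \<or> \<beta> = - \<alpha>" using root_parallel[OF \<Phi>(1), of c] \<Phi>(2) by simp
    then show False using assms positive_not_uminus by auto
  qed
  then show ?thesis using that z\<alpha> by blast
qed

text \<open>Inside the hyperplane every other sine can be cancelled by moving in a direction that is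
  tangent to it and transversal to the zeros of that sine.\<close>

lemma sines_cancel_hyperplane:
  assumes "finite S" "S \<subseteq> P - {\<alpha>}" "\<alpha> \<in> P" and f: "f \<in> trig_polynomials"
    and "\<And>x. x \<bullet> \<alpha> = c \<Longrightarrow> sines S x * f x = 0" and "x \<bullet> \<alpha> = c"
  shows "f x = 0"
  using assms(1,2,5,6)
proof (induction S arbitrary: x)
  case empty
  then show ?case by (simp add: sines_def)
next
  case (insert \<beta> S)
  obtain z where z: "z \<bullet> \<alpha> = 0" "z \<bullet> \<beta> \<noteq> 0" using transversal[OF assms(3), of \<beta>] insert.prems(1) by auto
  show ?case
  proof (rule insert.IH[OF _ _ insert.prems(3)])
    fix y assume y: "y \<bullet> \<alpha> = c"
    show "sines S y * f y = 0"
    proof (rule sin_cancel[of "\<lambda>y. sines S y * f y" z \<beta> "{y. y \<bullet> \<alpha> = c}"])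
      show "continuous_on UNIV (\<lambda>y. sines S y * f y)" by (intro continuous_on_tp tp_mult tp_sines f)
      show "complex_of_real (sin (pi * (x \<bullet> \<beta>))) * (sines S x * f x) = 0" if "x \<in> {y. y \<bullet> \<alpha> = c}" for x
        using insert.prems(2)[of x] that insert.hyps by (simp add: sines_insert)
    qed (use z y in \<open>auto simp: inner_add_left\<close>)
  qed (use insert.prems in auto)
qed

lemma sines_cancel:
  assumes "finite S" "S \<subseteq> P" and f: "f \<in> trig_polynomials" and "\<And>x. sines S x * f x = 0"
  shows "f x = 0"
  using assms(1,2,4)
proof (induction S arbitrary: x)
  case empty
  then show ?case by (simp add: sines_def)
next
  case (insert \<beta> S)
  have \<beta>: "\<beta> \<noteq> 0" using insert.prems positive_root root_nz by blast
  show ?case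
  proof (rule insert.IH)
    fix y
    show "sines S y * f y = 0"
    proof (rule sin_cancel[of "\<lambda>y. sines S y * f y" \<beta> \<beta> UNIV])
      show "continuous_on UNIV (\<lambda>y. sines S y * f y)" by (intro continuous_on_tp tp_mult tp_sines f)
      show "complex_of_real (sin (pi * (x \<bullet> \<beta>))) * (sines S x * f x) = 0" for x
        using insert.prems(2)[of x] insert.hyps by (simp add: sines_insert)
    qed (use \<beta> in auto)
  qed (use insert.prems in auto)
qed

text \<open>One factor is divided out at a time. The quotient so far still vanishes on the
  hyperplanes of the next root, because the factors already removed can be cancelled there; then
  \<open>tp_dvd_sin\<close> applies.\<close>

lemma dvd_sines:
  assumes "finite S" "S \<subseteq> P" and T: "T \<in> trig_polynomials"
    and 0: "\<And>\<alpha> x. \<alpha> \<in> P \<Longrightarrow> x \<bullet> \<alpha> \<in> \<int> \<Longrightarrow> T x = 0"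
  shows "\<exists>g\<in>trig_polynomials. \<forall>x. T x = sines S x * g x"
  using assms(1,2)
proof (induction S)
  case empty
  then show ?case using T by (auto simp: sines_def)
next
  case (insert \<alpha> S)
  then obtain g where g: "g \<in> trig_polynomials" "\<And>x. T x = sines S x * g x" by auto
  have \<alpha>: "\<alpha> \<in> P" using insert by auto
  have "g x = 0" if "x \<bullet> \<alpha> \<in> \<int>" for x
    by (rule sines_cancel_hyperplane[OF insert.hyps(1) _ \<alpha> g(1), of "x \<bullet> \<alpha>"])
      (use insert 0[OF \<alpha>] g that in auto)
  then obtain g' where "g' \<in> trig_polynomials" "\<And>x. g x = complex_of_real (sin (pi * (x \<bullet> \<alpha>))) * g' x"
    using tp_dvd_sin[OF g(1) root_nz[OF positive_root[OF \<alpha>]]] by metis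
  then show ?case using g insert.hyps by (auto simp: sines_insert mult_ac)
qed

text \<open>The reflection permutes the positive roots up to sign, and integer shifts of the
  arguments only change signs of sines. The total sign is left open here, which spares counting
  roots made negative and parities of shifts.\<close>

lemma H_aff_refl_sign:
  assumes \<beta>: "\<beta> \<in> \<Phi>"
  obtains \<sigma> :: complex where "\<And>x. H (aff_refl \<beta> k x) = \<sigma> * H x"
proof -
  let ?s = "aff_refl \<beta> 0"
  define sg :: "'a \<Rightarrow> real" where "sg \<alpha> = (if ?s \<alpha> \<in> P then 1 else -1)" for \<alpha>
  define q where "q \<alpha> = sg \<alpha> *\<^sub>R ?s \<alpha>" for \<alpha>
  have sq: "?s \<alpha> = sg \<alpha> *\<^sub>R q \<alpha>" for \<alpha> by (simp add: q_def sg_def)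
  have qP: "q \<alpha> \<in> P" if "\<alpha> \<in> P" for \<alpha>
    using positive_cases[OF root_refl[OF \<beta> positive_root[OF that]]] by (auto simp: q_def sg_def)
  have inj: "inj_on q P"
  proof (rule inj_onI)
    fix \<alpha> \<gamma> assume *: "\<alpha> \<in> P" "\<gamma> \<in> P" "q \<alpha> = q \<gamma>"
    have "?s (q \<delta>) = sg \<delta> *\<^sub>R \<delta>" for \<delta>
      using root_nz[OF \<beta>] by (simp add: q_def linear_cmul[OF linear_refl])
    then have "sg \<alpha> *\<^sub>R \<alpha> = sg \<gamma> *\<^sub>R \<gamma>" using *(3) by metis
    then have "\<alpha> = \<gamma> \<or> \<alpha> = - \<gamma>" by (auto simp: sg_def split: if_splits)
    then show "\<alpha> = \<gamma>" using * positive_not_uminus by auto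
  qed
  have img: "q ` P = P" by (rule endo_inj_surj[OF finite_positive _ inj]) (use qP in auto)
  define n where "n \<alpha> = k * \<lfloor>coroot \<beta> \<bullet> \<alpha>\<rfloor>" for \<alpha>
  have sinq: "sin (pi * (aff_refl \<beta> k x \<bullet> \<alpha>)) = (cos (pi * of_int (n \<alpha>)) * sg \<alpha>) * sin (pi * (x \<bullet> q \<alpha>))" if "\<alpha> \<in> P" for x \<alpha>
  proof -
    have "aff_refl \<beta> k x \<bullet> \<alpha> = x \<bullet> ?s \<alpha> + of_int (n \<alpha>)"
      by (simp only: aff_refl_inner n_def of_int_mult of_int_coroot_inner[OF \<beta> positive_root[OF that]])
    moreover have "sin (pi * (x \<bullet> ?s \<alpha>)) = sg \<alpha> * sin (pi * (x \<bullet> q \<alpha>))"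
      by (subst sq) (auto simp: sg_def)
    ultimately show ?thesis by (simp add: sin_shift_int del: of_int_mult)
  qed
  have "H (aff_refl \<beta> k x) = (\<Prod>\<alpha>\<in>P. of_real (cos (pi * of_int (n \<alpha>)) * sg \<alpha>)) * (\<Prod>\<alpha>\<in>P. of_real (sin (pi * (x \<bullet> q \<alpha>))))" for x
    unfolding H_eq_sines sines_def prod.distrib[symmetric] by (rule prod.cong[OF HOL.refl]) (simp only: sinq of_real_mult)
  moreover have "(\<Prod>\<alpha>\<in>P. complex_of_real (sin (pi * (x \<bullet> q \<alpha>)))) = H x" for x
    unfolding H_eq_sines sines_def
    using prod.reindex[OF inj, of "\<lambda>\<alpha>. complex_of_real (sin (pi * (x \<bullet> \<alpha>)))"] img by simp
  ultimately have "H (aff_refl \<beta> k x) = (\<Prod>\<alpha>\<in>P. of_real (cos (pi * of_int (n \<alpha>)) * sg \<alpha>)) * H x" for x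
    by (simp only:)
  then show ?thesis by (rule that)
qed

text \<open>Writing \<open>H\<close> as the sine of \<open>\<beta>\<close> times \<open>K\<close>,
  the first factor changes sign, so \<open>K\<close> is multiplied by \<open>- \<sigma>\<close>. On
  the fixed hyperplane \<open>K\<close> is unchanged, hence for \<open>\<sigma> \<noteq> -1\<close>
  it would vanish there, and cancelling its sines one by one would give
  \<open>1 = 0\<close>.\<close>

lemma H_aff_refl_positive:
  assumes \<beta>: "\<beta> \<in> P"
  shows "H (aff_refl \<beta> k x) = - H x"
proof -
  have \<beta>\<Phi>: "\<beta> \<in> \<Phi>" "\<beta> \<noteq> 0" using \<beta> positive_root root_nz by auto
  obtain \<sigma> where \<sigma>: "\<And>x. H (aff_refl \<beta> k x) = \<sigma> * H x" using H_aff_refl_sign[OF \<beta>\<Phi>(1)] by metis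
  define K where "K = sines (P - {\<beta>})"
  have K: "K \<in> trig_polynomials" by (simp add: K_def tp_sines)
  have HK: "H x = complex_of_real (sin (pi * (x \<bullet> \<beta>))) * K x" for x
    using sines_insert[of "P - {\<beta>}" \<beta> x] \<beta> finite_positive by (simp add: H_eq_sines K_def insert_absorb)
  have sn: "sin (pi * (aff_refl \<beta> k x \<bullet> \<beta>)) = - sin (pi * (x \<bullet> \<beta>))" for x
  proof -
    have "pi * (aff_refl \<beta> k x \<bullet> \<beta>) = pi * (- (x \<bullet> \<beta>) + of_int (2 * k))"
      using \<beta>\<Phi> by (simp add: aff_refl_inner_self)
    moreover have "cos (pi * of_int (2 * k)) = 1"
      using cos_int_2pin[of k] by (simp add: mult_ac)
    ultimately show ?thesis using sin_shift_int[of "- (x \<bullet> \<beta>)" "2 * k"] by simp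
  qed
  have Kr: "(\<lambda>x. K (aff_refl \<beta> k x)) \<in> trig_polynomials" by (rule coef_aff_refl(1)[OF K \<beta>\<Phi>(2)])
  have eq: "K (aff_refl \<beta> k x) + \<sigma> * K x = 0" for x
  proof (rule sin_cancel[of "\<lambda>x. K (aff_refl \<beta> k x) + \<sigma> * K x" \<beta> \<beta> UNIV])
    show "continuous_on UNIV (\<lambda>x. K (aff_refl \<beta> k x) + \<sigma> * K x)"
      by (intro continuous_on_tp tp_add tp_cmult K Kr)
    show "complex_of_real (sin (pi * (x \<bullet> \<beta>))) * (K (aff_refl \<beta> k x) + \<sigma> * K x) = 0" for x
    proof -
      have "\<sigma> * (complex_of_real (sin (pi * (x \<bullet> \<beta>))) * K x)
          = - (complex_of_real (sin (pi * (x \<bullet> \<beta>))) * K (aff_refl \<beta> k x))"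
        using \<sigma>[of x] unfolding HK sn by simp
      then show ?thesis by (simp only: distrib_left mult.left_commute[of _ \<sigma>]) simp
    qed
  qed (use \<beta>\<Phi> in auto)
  have "\<sigma> = -1"
  proof (rule ccontr)
    assume \<sigma>1: "\<sigma> \<noteq> -1"
    define x0 where "x0 = (of_int k / (\<beta> \<bullet> \<beta>)) *\<^sub>R \<beta>"
    have x0: "x0 \<bullet> \<beta> = of_int k" using \<beta>\<Phi> by (simp add: x0_def)
    have "K x = 0" if "x \<bullet> \<beta> = of_int k" for x
    proof -
      have "(\<sigma> - (-1)) * K x = 0" using eq[of x] aff_refl_fixed[OF that] by (simp add: algebra_simps)
      then show ?thesis using \<sigma>1 by (simp only: mult_eq_0_iff right_minus_eq) blast
    qed
    then have "(1::complex) = 0"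
      using sines_cancel_hyperplane[OF _ _ \<beta> tp_const[of 1], of "P - {\<beta>}" "of_int k" x0]
        finite_positive x0 by (simp add: K_def)
    then show False by simp
  qed
  then show ?thesis using \<sigma> by simp
qed

text \<open>All levels \<open>k\<close> are included, so such functions are also periodic under the
  coroots: the product of two parallel reflections is a translation.\<close>

definition antisymmetric :: "('a \<Rightarrow> complex) \<Rightarrow> bool" where
  "antisymmetric f \<longleftrightarrow> (\<forall>\<beta>\<in>\<Phi>. \<forall>k x. f (aff_refl \<beta> k x) = - f x)"

definition invariant :: "('a \<Rightarrow> 'b) \<Rightarrow> bool" where
  "invariant f \<longleftrightarrow> (\<forall>\<beta>\<in>\<Phi>. \<forall>k x. f (aff_refl \<beta> k x) = f x)"

lemma antisymmetric_H: "antisymmetric H"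
  unfolding antisymmetric_def
proof (intro ballI allI)
  fix \<beta> k x assume "\<beta> \<in> \<Phi>"
  then consider "\<beta> \<in> P" | "- \<beta> \<in> P" using positive_cases by blast
  then show "H (aff_refl \<beta> k x) = - H x"
  proof cases
    case 1
    then show ?thesis by (rule H_aff_refl_positive)
  next
    case 2
    from H_aff_refl_positive[OF 2, of "- k" x] show ?thesis by (simp add: aff_refl_uminus)
  qed
qed

lemma antisymmetric_vanish:
  assumes "antisymmetric f" "\<alpha> \<in> P" "x \<bullet> \<alpha> \<in> \<int>"
  shows "f x = 0"
proof -
  obtain k where "x \<bullet> \<alpha> = of_int k" using assms by (auto simp: Ints_def)
  then have "aff_refl \<alpha> k x = x" by (rule aff_refl_fixed)
  then have "f x = - f x" using assms positive_root unfolding antisymmetric_def by metis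
  then show ?thesis by simp
qed

lemma antisymmetric_frontier: "antisymmetric f \<Longrightarrow> x \<in> frontier (alcove P) \<Longrightarrow> f x = 0"
  using antisymmetric_vanish frontier_alcoveD by metis

lemma antisymmetric_dvd:
  assumes T: "T \<in> trig_polynomials" "antisymmetric T"
  obtains g where "g \<in> trig_polynomials" "\<And>x. T x = H x * g x" "invariant g"
proof -
  obtain g where g: "g \<in> trig_polynomials" "\<And>x. T x = H x * g x"
  proof -
    have "\<exists>g\<in>trig_polynomials. \<forall>x. T x = sines P x * g x"
      by (rule dvd_sines[OF finite_positive order_refl T(1)]) (rule antisymmetric_vanish[OF T(2)])
    then show thesis using that H_eq_sines by auto
  qed
  have "g (aff_refl \<beta> k x) = g x" if \<beta>: "\<beta> \<in> \<Phi>" for \<beta> k x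
  proof -
    let ?d = "\<lambda>x. g (aff_refl \<beta> k x) - g x"
    have "?d \<in> trig_polynomials" by (intro tp_diff coef_aff_refl(1) g root_nz \<beta>)
    moreover have "sines P x * ?d x = 0" for x
    proof -
      have "H (aff_refl \<beta> k x) * g (aff_refl \<beta> k x) = - (H x * g x)"
        using T(2) \<beta> g(2) by (simp add: antisymmetric_def)
      moreover have "H (aff_refl \<beta> k x) = - H x" using antisymmetric_H \<beta> by (simp add: antisymmetric_def)
      ultimately show ?thesis by (simp add: H_eq_sines algebra_simps)
    qed
    ultimately have "?d x = 0" by (rule sines_cancel[OF finite_positive order_refl])
    then show ?thesis by simp
  qed
  then show ?thesis using that g by (auto simp: invariant_def)
qed

lemma coef_antisymmetric:
  assumes "f \<in> trig_polynomials" "antisymmetric f" "\<alpha> \<in> \<Phi>"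
  shows "coef f (aff_refl \<alpha> 0 \<eta>) * cis (- (of_int k * (\<eta> \<bullet> coroot \<alpha>))) = - coef f \<eta>"
proof -
  have "(\<lambda>x. f (aff_refl \<alpha> k x)) = (\<lambda>x. -1 * f x)" using assms by (auto simp: antisymmetric_def)
  then have "coef (\<lambda>x. f (aff_refl \<alpha> k x)) = coef (\<lambda>x. -1 * f x)" by simp
  from fun_cong[OF this, of \<eta>] show ?thesis
    unfolding coef_aff_refl(2)[OF assms(1) root_nz[OF assms(3)]] coef_cmult[OF assms(1)] by (simp only: mult_minus1)
qed

lemma coef_invariant:
  assumes "f \<in> trig_polynomials" "invariant f" "\<alpha> \<in> \<Phi>"
  shows "coef f (aff_refl \<alpha> 0 \<eta>) = coef f \<eta>"
proof -
  have "(\<lambda>x. f (aff_refl \<alpha> 0 x)) = f" using assms by (auto simp: invariant_def)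
  then have "coef (\<lambda>x. f (aff_refl \<alpha> 0 x)) = coef f" by (simp only:)
  from fun_cong[OF this, of \<eta>] show ?thesis
    unfolding coef_aff_refl(2)[OF assms(1) root_nz[OF assms(3)]] by simp
qed

text \<open>Comparing levels 0 and 1 gives periodicity under the coroot, so the phase of a frequency
  along it is trivial: frequencies are \<open>2 * pi\<close> times weights.\<close>

lemma antisymmetric_frequency:
  assumes "f \<in> trig_polynomials" "antisymmetric f" "\<alpha> \<in> \<Phi>" "coef f \<eta> \<noteq> 0"
  shows "\<eta> \<bullet> coroot \<alpha> / (2 * pi) \<in> \<int>"
proof -
  have "coef f (aff_refl \<alpha> 0 \<eta>) \<noteq> 0"
    "coef f (aff_refl \<alpha> 0 \<eta>) * cis (- (\<eta> \<bullet> coroot \<alpha>)) = coef f (aff_refl \<alpha> 0 \<eta>)"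
    using coef_antisymmetric[OF assms(1-3), of \<eta> 0] coef_antisymmetric[OF assms(1-3), of \<eta> 1] assms(4) by auto
  then have "cis (- (\<eta> \<bullet> coroot \<alpha>)) = 1" by simp
  then show ?thesis using cis_eq_1_iff[of "- (\<eta> \<bullet> coroot \<alpha>)"] by simp
qed

text \<open>Linear reflections preserve norms, so radial multipliers, like those of the heat flow
  and the Laplacian, commute with all reflections.\<close>

lemma antisymmetric_multiplier:
  assumes f: "f \<in> trig_polynomials" "antisymmetric f"
    and m: "\<And>\<xi> \<eta>. norm \<xi> = norm \<eta> \<Longrightarrow> m \<xi> = m \<eta>"
  shows "antisymmetric (trig_sum (\<lambda>\<xi>. m \<xi> * coef f \<xi>))"
  unfolding antisymmetric_def
proof (intro ballI allI)
  fix \<beta> k x assume \<beta>: "\<beta> \<in> \<Phi>"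
  let ?F = "trig_sum (\<lambda>\<xi>. m \<xi> * coef f \<xi>)"
  have F: "?F \<in> trig_polynomials" by (rule tp_multiplier[OF f(1)])
  have "coef (\<lambda>x. ?F (aff_refl \<beta> k x)) = coef (\<lambda>x. -1 * ?F x)"
  proof
    fix \<eta>
    have "m (aff_refl \<beta> 0 \<eta>) = m \<eta>" by (rule m) (simp add: norm_refl root_nz \<beta>)
    then show "coef (\<lambda>x. ?F (aff_refl \<beta> k x)) \<eta> = coef (\<lambda>x. -1 * ?F x) \<eta>"
      unfolding coef_aff_refl(2)[OF F root_nz[OF \<beta>]] coef_cmult[OF F] coef_multiplier[OF f(1)]
      using coef_antisymmetric[OF f \<beta>, of \<eta> k] by (simp add: mult.assoc)
  qed
  then have "(\<lambda>x. ?F (aff_refl \<beta> k x)) = (\<lambda>x. -1 * ?F x)"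
    using trig_sum_coef[OF coef_aff_refl(1)[OF F root_nz[OF \<beta>], of k]] trig_sum_coef[OF tp_cmult[OF F, of "-1"]] by simp
  from fun_cong[OF this, of x] show "?F (aff_refl \<beta> k x) = - ?F x" by simp
qed

lemma antisymmetric_heat: "f \<in> trig_polynomials \<Longrightarrow> antisymmetric f \<Longrightarrow> antisymmetric (heat t f)"
  unfolding heat_def by (rule antisymmetric_multiplier) (auto simp: norm_eq_sqrt_inner)

lemma antisymmetric_laplacian:
  assumes "f \<in> trig_polynomials" "antisymmetric f"
  shows "antisymmetric (laplacian f)"
  unfolding laplacian_tp[OF assms(1)]
  by (rule antisymmetric_multiplier[OF assms]) (auto simp: norm_eq_sqrt_inner)

text \<open>Support function of the zonotope that is the sum of the segments from
  \<open>- pi *\<^sub>R \<alpha>\<close> to \<open>pi *\<^sub>R \<alpha>\<close>; it contains all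
  frequencies of the sine product.\<close>

definition width :: "'a set \<Rightarrow> 'a \<Rightarrow> real" where "width S v = pi * (\<Sum>\<alpha>\<in>S. \<bar>\<alpha> \<bullet> v\<bar>)"

text \<open>Each sine raises the highest frequency in direction \<open>v\<close> by its full amount,
  without cancellation because no root in \<open>P\<close> is orthogonal to
  \<open>v\<close>.\<close>

lemma top_frequency:
  assumes "finite S" "S \<subseteq> P" "f \<in> trig_polynomials" "coef f \<xi> \<noteq> 0" "\<And>\<alpha>. \<alpha> \<in> P \<Longrightarrow> \<alpha> \<bullet> v \<noteq> 0"
  shows "\<exists>\<eta>. coef (\<lambda>x. sines S x * f x) \<eta> \<noteq> 0 \<and> \<xi> \<bullet> v + width S v \<le> \<eta> \<bullet> v"
  using assms(1,2)
proof (induction S)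
  case empty
  then show ?case using assms(4) by (auto simp: sines_def width_def)
next
  case (insert \<alpha> S)
  then obtain \<eta> where \<eta>: "coef (\<lambda>x. sines S x * f x) \<eta> \<noteq> 0" "\<xi> \<bullet> v + width S v \<le> \<eta> \<bullet> v" by blast
  have "\<alpha> \<bullet> v \<noteq> 0" using assms(5) insert by auto
  from top_frequency_sin[OF tp_mult[OF tp_sines assms(3)] \<eta>(1) this] obtain \<zeta> where
    "coef (\<lambda>x. complex_of_real (sin (pi * (x \<bullet> \<alpha>))) * (sines S x * f x)) \<zeta> \<noteq> 0"
    "\<eta> \<bullet> v + pi * \<bar>\<alpha> \<bullet> v\<bar> \<le> \<zeta> \<bullet> v" by blast
  then show ?case using \<eta>(2) insert.hyps
    by (intro exI[of _ \<zeta>]) (auto simp: sines_insert width_def distrib_left mult.assoc)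
qed

lemma frequency_sines_le:
  assumes "finite S" "coef (sines S) \<eta> \<noteq> 0"
  shows "\<eta> \<bullet> v \<le> width S v"
  using assms
proof (induction S arbitrary: \<eta>)
  case empty
  then show ?case by (simp add: sines_def[abs_def] coef_const width_def split: if_splits)
next
  case (insert \<alpha> S)
  have "sines (insert \<alpha> S) = (\<lambda>x. complex_of_real (sin (pi * (x \<bullet> \<alpha>))) * sines S x)"
    using insert.hyps by (auto simp: sines_insert)
  then have "coef (sines (insert \<alpha> S)) = (\<lambda>\<xi>. (coef (sines S) (\<xi> - pi *\<^sub>R \<alpha>) - coef (sines S) (\<xi> + pi *\<^sub>R \<alpha>)) / (2 * \<i>))"
    using coef_sin_mult[OF tp_sines, of \<alpha> S] by simp
  then have "coef (sines S) (\<eta> - pi *\<^sub>R \<alpha>) \<noteq> 0 \<or> coef (sines S) (\<eta> + pi *\<^sub>R \<alpha>) \<noteq> 0"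
    using insert.prems by auto
  then have "(\<eta> - pi *\<^sub>R \<alpha>) \<bullet> v \<le> width S v \<or> (\<eta> + pi *\<^sub>R \<alpha>) \<bullet> v \<le> width S v"
    using insert.IH by blast
  moreover have "width (insert \<alpha> S) v = width S v + pi * \<bar>\<alpha> \<bullet> v\<bar>"
    using insert.hyps by (simp add: width_def algebra_simps)
  moreover have "\<bar>pi * (\<alpha> \<bullet> v)\<bar> = pi * \<bar>\<alpha> \<bullet> v\<bar>" by (simp add: abs_mult)
  moreover have "(\<eta> - pi *\<^sub>R \<alpha>) \<bullet> v = \<eta> \<bullet> v - pi * (\<alpha> \<bullet> v)" "(\<eta> + pi *\<^sub>R \<alpha>) \<bullet> v = \<eta> \<bullet> v + pi * (\<alpha> \<bullet> v)"
    by (simp_all add: inner_diff_left inner_add_left)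
  ultimately show ?case by linarith
qed

lemma sine_product_positive: "x \<in> alcove P \<Longrightarrow> sine_product P x > 0"
  unfolding sine_product_def
proof (rule prod_pos)
  fix \<alpha> assume "x \<in> alcove P" "\<alpha> \<in> P"
  then have "0 < x \<bullet> \<alpha>" "x \<bullet> \<alpha> < 1" by (auto simp: alcove_def)
  then show "0 < sin (pi * (x \<bullet> \<alpha>))" by (intro sin_gt_zero) auto
qed

lemma H_frequency_exists: "\<exists>\<rho>. coef H \<rho> \<noteq> 0"
proof (rule ccontr)
  assume "\<nexists>\<rho>. coef H \<rho> \<noteq> 0"
  then have 0: "\<forall>x. H x = 0" using trig_poly_eq_0_iff[OF tp_H] by blast
  obtain a where "a \<in> alcove P" using alcove_nonempty by blast
  from sine_product_positive[OF this] show False using 0[rule_format, of a] by (simp add: H_def)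
qed

lemma generic_direction:
  assumes "open U" "U \<noteq> {}" "finite L" "0 \<notin> L"
  shows "\<exists>v\<in>U. (\<forall>\<alpha>\<in>P. \<alpha> \<bullet> v \<noteq> 0) \<and> (\<forall>\<xi>\<in>L. \<xi> \<bullet> v \<noteq> 0)"
proof -
  have "countable (P \<union> L)" using assms finite_positive by (simp add: countable_finite)
  moreover have "\<forall>\<alpha>\<in>P \<union> L. \<alpha> \<noteq> 0" using assms(4) positive_root root_nz by blast
  ultimately have "\<exists>v\<in>U. \<forall>\<alpha>\<in>P \<union> L. \<alpha> \<bullet> v \<noteq> 0" by (rule generic_point[OF assms(1,2)])
  then show ?thesis by blast
qed

text \<open>The Laplacian creates no new frequencies, so multiplying \<open>H\<close> by the
  quotient \<open>g\<close> must not lead beyond \<open>width\<close> in any generic direction.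
  Applied to \<open>v\<close> and \<open>- v\<close> this leaves only the frequency 0 for
  \<open>g\<close>.\<close>

lemma laplacian_H: "\<exists>c. \<forall>x. laplacian H x = c * H x"
proof -
  obtain g where g: "g \<in> trig_polynomials" "\<And>x. laplacian H x = H x * g x"
    using antisymmetric_dvd[OF tp_laplacian[OF tp_H] antisymmetric_laplacian[OF tp_H antisymmetric_H]] by metis
  have eq: "laplacian H = (\<lambda>x. sines P x * g x)" using g(2) by (simp add: H_eq_sines fun_eq_iff)
  have le: "\<xi> \<bullet> v \<le> 0" if \<xi>v: "coef g \<xi> \<noteq> 0" "\<And>\<alpha>. \<alpha> \<in> P \<Longrightarrow> \<alpha> \<bullet> v \<noteq> 0" for \<xi> v
  proof -
    obtain \<eta> where \<eta>: "coef (laplacian H) \<eta> \<noteq> 0" "\<xi> \<bullet> v + width P v \<le> \<eta> \<bullet> v"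
      using top_frequency[OF finite_positive order_refl g(1) \<xi>v] unfolding eq by blast
    then have "coef (sines P) \<eta> \<noteq> 0" by (simp add: coef_laplacian[OF tp_H] flip: H_eq_sines)
    from frequency_sines_le[OF finite_positive this, of v] \<eta>(2) show ?thesis by linarith
  qed
  have 0: "\<xi> = 0" if \<xi>: "coef g \<xi> \<noteq> 0" for \<xi>
  proof (rule ccontr)
    assume "\<xi> \<noteq> 0"
    then obtain v where v: "\<And>\<alpha>. \<alpha> \<in> P \<Longrightarrow> \<alpha> \<bullet> v \<noteq> 0" "\<xi> \<bullet> v \<noteq> 0"
      using generic_direction[of UNIV "{\<xi>}"] by auto
    have "\<xi> \<bullet> v \<le> 0" by (rule le[OF \<xi> v(1)])
    moreover have "\<xi> \<bullet> (- v) \<le> 0" by (rule le[OF \<xi>]) (use v in auto)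
    ultimately show False using v(2) by simp
  qed
  have "g x = coef g 0" for x
  proof -
    have "g x = (\<Sum>\<xi>\<in>{0}. coef g \<xi> * cis (\<xi> \<bullet> x))"
      by (subst trig_sum_coef[OF g(1), symmetric], rule trig_sum_superset) (use 0 in auto)
    then show ?thesis by simp
  qed
  then have "laplacian H x = coef g 0 * H x" for x using g(2)[of x] by (metis mult.commute)
  then show ?thesis by blast
qed

lemma H_frequencies:
  obtains l where "\<And>\<xi>. coef H \<xi> \<noteq> 0 \<Longrightarrow> \<xi> \<bullet> \<xi> = l" "\<And>x. laplacian H x = - of_real l * H x"
proof -
  obtain c where c: "\<And>x. laplacian H x = c * H x" using laplacian_H by blast
  obtain \<rho> where \<rho>: "coef H \<rho> \<noteq> 0" using H_frequency_exists by blast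
  have "laplacian H = (\<lambda>x. c * H x)" using c by (rule ext)
  then have "coef (laplacian H) = coef (\<lambda>x. c * H x)" by simp
  then have eq: "- of_real (\<xi> \<bullet> \<xi>) * coef H \<xi> = c * coef H \<xi>" for \<xi>
    unfolding coef_laplacian[OF tp_H] coef_cmult[OF tp_H] by (rule fun_cong)
  have c\<xi>: "c = - of_real (\<xi> \<bullet> \<xi>)" if "coef H \<xi> \<noteq> 0" for \<xi>
    using mult_right_cancel[THEN iffD1, OF that eq] by (rule sym)
  show ?thesis
  proof (rule that[of "\<rho> \<bullet> \<rho>"])
    show "\<xi> \<bullet> \<xi> = \<rho> \<bullet> \<rho>" if "coef H \<xi> \<noteq> 0" for \<xi>
    proof -
      have "complex_of_real (\<xi> \<bullet> \<xi>) = of_real (\<rho> \<bullet> \<rho>)" using c\<xi>[OF that] c\<xi>[OF \<rho>] by (metis neg_equal_iff_equal)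
      then show ?thesis by (simp only: of_real_eq_iff)
    qed
    show "laplacian H x = - of_real (\<rho> \<bullet> \<rho>) * H x" for x using c c\<xi>[OF \<rho>] by simp
  qed
qed

text \<open>The sum of all frequencies is fixed by every linear reflection, hence orthogonal to all
  roots, hence 0; so the frequencies cannot all lie strictly on one side.\<close>

lemma invariant_frequency_nonneg:
  assumes g: "g \<in> trig_polynomials" "invariant g" "coef g \<xi> \<noteq> 0"
  shows "\<exists>\<zeta>. coef g \<zeta> \<noteq> 0 \<and> \<zeta> \<bullet> v \<ge> 0"
proof (rule ccontr)
  assume neg: "\<nexists>\<zeta>. coef g \<zeta> \<noteq> 0 \<and> \<zeta> \<bullet> v \<ge> 0"
  let ?S = "{\<zeta>. coef g \<zeta> \<noteq> 0}"
  have fin: "finite ?S" by (rule finite_coef[OF g(1)])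
  define s where "s = (\<Sum>\<zeta>\<in>?S. \<zeta>)"
  have "s \<bullet> \<alpha> = 0" if \<alpha>: "\<alpha> \<in> \<Phi>" for \<alpha>
  proof -
    let ?r = "aff_refl \<alpha> 0"
    have inv: "?r (?r x) = x" for x using root_nz[OF \<alpha>] by simp
    have "?r ` ?S = ?S"
    proof
      show "?r ` ?S \<subseteq> ?S" using coef_invariant[OF g(1,2) \<alpha>] by auto
      then have "?r ` (?r ` ?S) \<subseteq> ?r ` ?S" by (rule image_mono)
      then show "?S \<subseteq> ?r ` ?S" by (simp add: image_image inv)
    qed
    moreover have "inj_on ?r ?S" by (rule inj_on_inverseI[of _ ?r]) (rule inv)
    ultimately have "(\<Sum>\<zeta>\<in>?S. \<zeta>) = (\<Sum>\<zeta>\<in>?S. ?r \<zeta>)"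
      using sum.reindex[of ?r ?S "\<lambda>\<zeta>. \<zeta>"] by (simp add: o_def)
    then have "s = (\<Sum>\<zeta>\<in>?S. ?r \<zeta>)" by (simp only: s_def)
    also have "\<dots> = ?r s" unfolding s_def by (rule linear_sum[OF linear_refl, symmetric])
    finally have "s = ?r s" .
    then have "s \<bullet> \<alpha> = ?r s \<bullet> \<alpha>" by (rule arg_cong)
    then show ?thesis using root_nz[OF \<alpha>] by (simp add: aff_refl_inner_self)
  qed
  then have "s = 0" by (rule orthogonal_to_spanning[OF span_roots])
  then have "(\<Sum>\<zeta>\<in>?S. \<zeta> \<bullet> v) = 0" by (simp add: s_def flip: inner_sum_left)
  moreover have "(\<Sum>\<zeta>\<in>?S. \<zeta> \<bullet> v) < 0"
    using sum_strict_mono[of ?S "\<lambda>\<zeta>. \<zeta> \<bullet> v" "\<lambda>_. 0"] neg fin g(3) by force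
  ultimately show False by simp
qed

text \<open>A frequency \<open>\<rho>\<close> of \<open>H\<close> lies on the sphere and in the convex hull of the frequencies
  of \<open>H * g\<close>; by strict convexity it is one of them.\<close>

lemma H_frequency_in_multiple:
  assumes g: "g \<in> trig_polynomials" "invariant g" "coef g \<xi>0 \<noteq> 0"
    and \<rho>: "coef H \<rho> \<noteq> 0" and small: "\<And>\<xi>. coef (\<lambda>x. H x * g x) \<xi> \<noteq> 0 \<Longrightarrow> \<xi> \<bullet> \<xi> \<le> \<rho> \<bullet> \<rho>"
  shows "coef (\<lambda>x. H x * g x) \<rho> \<noteq> 0"
proof
  assume \<rho>0: "coef (\<lambda>x. H x * g x) \<rho> = 0"
  let ?S = "{\<xi>. coef (\<lambda>x. H x * g x) \<xi> \<noteq> 0}"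
  have fin: "finite ?S" by (rule finite_coef[OF tp_mult[OF tp_H g(1)]])
  have lt: "\<xi> \<bullet> \<rho> < \<rho> \<bullet> \<rho>" if "\<xi> \<in> ?S" for \<xi>
  proof -
    have "(\<xi> - \<rho>) \<bullet> (\<xi> - \<rho>) > 0" using that \<rho>0 by auto
    then have "2 * (\<xi> \<bullet> \<rho>) < \<xi> \<bullet> \<xi> + \<rho> \<bullet> \<rho>" by (simp add: inner_diff_left inner_diff_right inner_commute)
    then show ?thesis using small[of \<xi>] that by simp
  qed
  \<comment> \<open>A generic \<open>v\<close> close to \<open>\<rho>\<close> still puts
    \<open>\<rho>\<close> strictly above all frequencies of the product, and is orthogonal to no
    root, as \<open>top_frequency\<close> requires.\<close>
  define U where "U = (\<Inter>\<xi>\<in>?S. {v. \<xi> \<bullet> v < \<rho> \<bullet> v})"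
  have "open U" unfolding U_def by (intro open_INT fin ballI open_Collect_less continuous_intros)
  moreover have "\<rho> \<in> U" using lt by (auto simp: U_def)
  ultimately obtain v where v: "v \<in> U" "\<And>\<alpha>. \<alpha> \<in> P \<Longrightarrow> \<alpha> \<bullet> v \<noteq> 0"
    using generic_direction[of U "{}"] by blast
  obtain \<zeta> where \<zeta>: "coef g \<zeta> \<noteq> 0" "\<zeta> \<bullet> v \<ge> 0" using invariant_frequency_nonneg[OF g] by blast
  obtain \<eta> where \<eta>: "\<eta> \<in> ?S" "\<zeta> \<bullet> v + width P v \<le> \<eta> \<bullet> v"
    using top_frequency[OF finite_positive order_refl g(1) \<zeta>(1) v(2)] by (auto simp: H_eq_sines)
  have "\<eta> \<bullet> v < \<rho> \<bullet> v" using INT_D[OF v(1)[unfolded U_def] \<eta>(1)] by simp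
  also have "\<dots> \<le> width P v" by (rule frequency_sines_le[OF finite_positive \<rho>[unfolded H_eq_sines]])
  finally show False using \<eta>(2) \<zeta>(2) by linarith
qed

end

section \<open>Density of antisymmetric trigonometric polynomials\<close>

text \<open>Makes integer spans available: \<open>int_module.span S\<close> is the additive group
  generated by \<open>S\<close>.\<close>

interpretation int_module: module "\<lambda>(n::int) (v::'a::real_vector). of_int n *\<^sub>R v"
  by unfold_locales (auto simp: algebra_simps)

text \<open>The difference of the two sums is a relation with coefficients 1 and -1. Were
  \<open>ch j0\<close> not among the \<open>ch'\<close>, its class would contain only coefficients 1
  and have a positive sum, against \<open>char_indep\<close>.\<close>

lemma characters_of_equal_sums:
  fixes ch ch' :: "'i \<Rightarrow> 'b::ab_semigroup_add \<Rightarrow> complex"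
  assumes J: "finite J" "j0 \<in> J"
    and \<Gamma>: "\<And>x y. x \<in> \<Gamma> \<Longrightarrow> y \<in> \<Gamma> \<Longrightarrow> x + y \<in> \<Gamma>"
    and mult: "\<And>j x y. j \<in> J \<Longrightarrow> x \<in> \<Gamma> \<Longrightarrow> y \<in> \<Gamma> \<Longrightarrow> ch j (x + y) = ch j x * ch j y"
      "\<And>j x y. j \<in> J \<Longrightarrow> x \<in> \<Gamma> \<Longrightarrow> y \<in> \<Gamma> \<Longrightarrow> ch' j (x + y) = ch' j x * ch' j y"
    and z: "z \<in> \<Gamma>" "ch j0 z \<noteq> 0"
    and eq: "\<And>x. x \<in> \<Gamma> \<Longrightarrow> (\<Sum>j\<in>J. ch j x) = (\<Sum>j\<in>J. ch' j x)"
  shows "\<exists>j\<in>J. \<forall>x\<in>\<Gamma>. ch' j x = ch j0 x"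
proof (rule ccontr)
  assume neg: "\<not> ?thesis"
  define h where "h i = (if snd i then ch (fst i) else ch' (fst i))" for i :: "'i \<times> bool"
  define a :: "'i \<times> bool \<Rightarrow> complex" where "a i = (if snd i then 1 else -1)" for i
  let ?I = "J \<times> (UNIV :: bool set)"
  let ?C = "{i. i \<in> ?I \<and> (\<forall>x\<in>\<Gamma>. h i x = h (j0, True) x)}"
  have "(\<Sum>i\<in>?C. a i) = 0"
  proof (rule char_indep[of ?I \<Gamma> h z])
    show "(\<Sum>i\<in>?I. a i * h i x) = 0" if "x \<in> \<Gamma>" for x
    proof -
      have "(\<Sum>i\<in>?I. a i * h i x) = (\<Sum>j\<in>J. \<Sum>b\<in>UNIV. a (j, b) * h (j, b) x)"
        by (subst sum.cartesian_product) (rule sum.cong, auto)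
      also have "\<dots> = (\<Sum>j\<in>J. ch j x - ch' j x)" by (simp add: UNIV_bool a_def h_def)
      also have "\<dots> = 0" using eq[OF that] by (simp add: sum_subtractf)
      finally show ?thesis .
    qed
  qed (use J \<Gamma> mult z in \<open>auto simp: h_def\<close>)
  moreover have "(\<Sum>i\<in>?C. a i) = of_nat (card ?C)"
  proof -
    have "a i = 1" if "i \<in> ?C" for i
    proof (cases "snd i")
      case False
      then have "fst i \<in> J" "\<forall>x\<in>\<Gamma>. ch' (fst i) x = ch j0 x" using that by (auto simp: h_def)
      then show ?thesis using neg by blast
    qed (simp add: a_def)
    then have "(\<Sum>i\<in>?C. a i) = (\<Sum>i\<in>?C. 1)" by (rule sum.cong[OF refl])
    then show ?thesis by simp
  qed
  moreover have "(j0, True) \<in> ?C" "finite ?C" using J by auto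
  ultimately show False by (metis (no_types, lifting) card_eq_0_iff empty_iff of_nat_eq_0_iff)
qed

text \<open>The double dual is contained in \<open>L\<close>, where the dual consists of the vectors
  with integral products with \<open>L\<close>; the other inclusion always holds.\<close>

definition dual_closed :: "'a::euclidean_space set \<Rightarrow> bool" where
  "dual_closed L \<longleftrightarrow> (\<forall>z. (\<forall>p. (\<forall>l\<in>L. p \<bullet> l \<in> \<int>) \<longrightarrow> p \<bullet> z \<in> \<int>) \<longrightarrow> z \<in> L)"

lemma cis_2pi_eq_1_iff: "cis (2 * pi * t) = 1 \<longleftrightarrow> t \<in> \<int>"
  using cis_eq_1_iff[of "2 * pi * t"] by simp

text \<open>Let \<open>z\<close> lie in the double dual of the enlarged group. For \<open>p\<close>
  in the dual of the smaller one, the exponential sums over the multiples \<open>j v\<close> and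
  over \<open>j v + z\<close> agree: either \<open>p\<close> is integral on \<open>v\<close>, hence
  on \<open>z\<close>, or both are vanishing geometric sums. Independence of characters then yields
  some \<open>j\<close> for which \<open>j v + z\<close> pairs integrally with that dual and so
  belongs to the smaller group.\<close>

lemma dual_closed_insert_torsion:
  fixes S :: "'a::euclidean_space set"
  assumes S: "dual_closed (int_module.span S)" and N: "N > 0" "of_nat N *\<^sub>R v \<in> int_module.span S"
  shows "dual_closed (int_module.span (insert v S))"
  unfolding dual_closed_def
proof (intro allI impI)
  let ?L = "int_module.span S" and ?L' = "int_module.span (insert v S)"
  fix z :: 'a assume z: "\<forall>p. (\<forall>l\<in>?L'. p \<bullet> l \<in> \<int>) \<longrightarrow> p \<bullet> z \<in> \<int>"
  define G where "G = {p :: 'a. \<forall>l\<in>?L. p \<bullet> l \<in> \<int>}"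
  have sum0: "(\<Sum>j<N. cis (2 * pi * (p \<bullet> (of_nat j *\<^sub>R v)))) = (\<Sum>j<N. cis (2 * pi * (p \<bullet> (of_nat j *\<^sub>R v + z))))"
    if p: "p \<in> G" for p
  proof (cases "p \<bullet> v \<in> \<int>")
    case True
    have "p \<bullet> l \<in> \<int>" if "l \<in> ?L'" for l
    proof -
      obtain k where k: "l - of_int k *\<^sub>R v \<in> ?L" using \<open>l \<in> ?L'\<close> by (auto simp: int_module.span_insert)
      then have "p \<bullet> (l - of_int k *\<^sub>R v) \<in> \<int>" using p by (simp add: G_def)
      then have "p \<bullet> (l - of_int k *\<^sub>R v) + of_int k * (p \<bullet> v) \<in> \<int>" using True by (intro Ints_add Ints_mult) auto
      then show ?thesis by (simp add: inner_diff_right)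
    qed
    then have "p \<bullet> z \<in> \<int>" using z by blast
    then have "cis (2 * pi * (p \<bullet> z)) = 1" by (simp only: cis_2pi_eq_1_iff)
    then show ?thesis by (simp add: inner_add_right distrib_left cis_mult[symmetric])
  next
    case False
    define w where "w = cis (2 * pi * (p \<bullet> v))"
    have w1: "w \<noteq> 1" using False by (simp only: w_def cis_2pi_eq_1_iff) simp
    have wj: "cis (2 * pi * (p \<bullet> (of_nat j *\<^sub>R v))) = w ^ j" for j
      by (simp only: w_def Complex.DeMoivre inner_scaleR_right) (simp only: mult_ac)
    have "p \<bullet> (of_nat N *\<^sub>R v) \<in> \<int>" using p N by (simp only: G_def mem_Collect_eq)
    then have "w ^ N = 1" unfolding wj[symmetric] by (simp only: cis_2pi_eq_1_iff)
    then have "(\<Sum>j<N. w ^ j) = 0" using geometric_sum[OF w1, of N] by simp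
    then have 0: "(\<Sum>j<N. cis (2 * pi * (p \<bullet> (of_nat j *\<^sub>R v)))) = 0" by (simp only: wj)
    have "(\<Sum>j<N. cis (2 * pi * (p \<bullet> (of_nat j *\<^sub>R v + z))))
      = (\<Sum>j<N. cis (2 * pi * (p \<bullet> (of_nat j *\<^sub>R v)))) * cis (2 * pi * (p \<bullet> z))"
      by (simp add: sum_distrib_right inner_add_right distrib_left cis_mult)
    then show ?thesis using 0 by (simp only: mult_zero_left)
  qed
  have "\<exists>j\<in>{..<N}. \<forall>p\<in>G. cis (2 * pi * (p \<bullet> (of_nat j *\<^sub>R v + z))) = cis (2 * pi * (p \<bullet> (of_nat 0 *\<^sub>R v)))"
  proof (rule characters_of_equal_sums[of "{..<N}" 0 G _ _ 0])
    show "(\<Sum>j<N. cis (2 * pi * (p \<bullet> (of_nat j *\<^sub>R v)))) = (\<Sum>j<N. cis (2 * pi * (p \<bullet> (of_nat j *\<^sub>R v + z))))"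
      if "p \<in> G" for p by (rule sum0[OF that])
    show "p + q \<in> G" if "p \<in> G" "q \<in> G" for p q using that by (simp add: G_def inner_add_left)
    show "cis (2 * pi * ((p + q) \<bullet> (of_nat j *\<^sub>R v))) = cis (2 * pi * (p \<bullet> (of_nat j *\<^sub>R v))) * cis (2 * pi * (q \<bullet> (of_nat j *\<^sub>R v)))"
      for p q :: 'a and j by (simp only: cis_mult inner_add_left distrib_left)
    show "cis (2 * pi * ((p + q) \<bullet> (of_nat j *\<^sub>R v + z))) = cis (2 * pi * (p \<bullet> (of_nat j *\<^sub>R v + z))) * cis (2 * pi * (q \<bullet> (of_nat j *\<^sub>R v + z)))"
      for p q :: 'a and j by (simp only: cis_mult inner_add_left distrib_left)
  qed (use N in \<open>auto simp: G_def\<close>)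
  then obtain j where "\<And>p. p \<in> G \<Longrightarrow> cis (2 * pi * (p \<bullet> (of_nat j *\<^sub>R v + z))) = 1" by auto
  then have "\<And>p. p \<in> G \<Longrightarrow> p \<bullet> (of_nat j *\<^sub>R v + z) \<in> \<int>" by (simp only: cis_2pi_eq_1_iff)
  then have "of_nat j *\<^sub>R v + z \<in> ?L" using S unfolding dual_closed_def G_def by blast
  then have "z - of_int (- int j) *\<^sub>R v \<in> ?L" by (simp add: add.commute)
  then show "z \<in> ?L'" unfolding int_module.span_insert by blast
qed

lemma dual_basis_vector:
  fixes B :: "'a::euclidean_space set"
  assumes "independent B" "b \<in> B"
  obtains d where "\<And>c. c \<in> B \<Longrightarrow> d \<bullet> c = (if c = b then 1 else 0)"
proof -
  obtain f :: "'a \<Rightarrow> real" where f: "linear f" "\<And>c. c \<in> B \<Longrightarrow> f c = (if c = b then 1 else 0)"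
    using linear_independent_extend[OF assms(1), of "\<lambda>c. if c = b then 1 else 0"] by auto
  have "adjoint f 1 \<bullet> c = f c" for c
    using adjoint_works[OF f(1), of c 1] by (simp add: inner_commute)
  then show ?thesis using that f(2) by metis
qed

lemma expand_in_dual_basis:
  fixes B :: "'a::euclidean_space set"
  assumes B: "finite B" "span B = UNIV"
    and d: "\<And>b c. b \<in> B \<Longrightarrow> c \<in> B \<Longrightarrow> d b \<bullet> c = (if c = b then 1 else 0)"
  shows "z = (\<Sum>b\<in>B. (d b \<bullet> z) *\<^sub>R b)"
proof -
  have "z \<in> span B" using B by simp
  then obtain u where z: "z = (\<Sum>b\<in>B. u b *\<^sub>R b)" using span_finite[OF B(1)] by auto
  have "d b \<bullet> z = u b" if "b \<in> B" for b
    using that B(1) by (simp add: z inner_sum_right d if_distrib cong: if_cong)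
  then show ?thesis using z by simp
qed

context positive_roots
begin

lemma span_coroots: "span (coroot ` \<Phi>) = UNIV"
proof -
  have "\<Phi> \<subseteq> span (coroot ` \<Phi>)"
  proof
    fix \<alpha> assume \<alpha>: "\<alpha> \<in> \<Phi>"
    then have "\<alpha> = ((\<alpha> \<bullet> \<alpha>) / 2) *\<^sub>R coroot \<alpha>" using root_nz[OF \<alpha>] by (simp add: coroot_def)
    then show "\<alpha> \<in> span (coroot ` \<Phi>)" using \<alpha> by (metis imageI span_base span_scale)
  qed
  then have "span \<Phi> \<subseteq> span (coroot ` \<Phi>)" by (rule span_minimal) simp
  then show ?thesis using span_roots by auto
qed

text \<open>The lattice of a linearly independent set \<open>B\<close> of coroots is its own double
  dual by means of the dual basis, and the other coroots are torsion modulo it, so they can be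
  adjoined one by one. No lattice basis of coroots has to be found.\<close>

lemma coroot_lattice_dual:
  assumes "\<And>p. (\<And>\<alpha>. \<alpha> \<in> \<Phi> \<Longrightarrow> p \<bullet> coroot \<alpha> \<in> \<int>) \<Longrightarrow> p \<bullet> z \<in> \<int>"
  shows "z \<in> int_module.span (coroot ` \<Phi>)"
proof -
  let ?C = "coroot ` \<Phi>"
  obtain B where B: "B \<subseteq> ?C" "independent B" "?C \<subseteq> span B" using maximal_independent_subset[of ?C] by metis
  have finB: "finite B" using B(1) finite_roots by (meson finite_imageI finite_subset)
  have "span ?C \<subseteq> span B" using B(3) by (rule span_minimal) simp
  then have spanB: "span B = UNIV" using span_coroots by auto
  have "\<exists>d. \<forall>b\<in>B. \<forall>c\<in>B. d b \<bullet> c = (if c = b then 1 else 0)"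
    using dual_basis_vector[OF B(2)] by (intro bchoice) metis
  then obtain d where d: "\<And>b c. b \<in> B \<Longrightarrow> c \<in> B \<Longrightarrow> d b \<bullet> c = (if c = b then 1 else 0)" by metis
  note expand = expand_in_dual_basis[OF finB spanB d]
  have int_comb: "(\<Sum>b\<in>B. of_int (m b) *\<^sub>R b) \<in> int_module.span B" for m :: "'a \<Rightarrow> int"
    by (intro int_module.span_sum int_module.span_scale int_module.span_base)
  have base: "dual_closed (int_module.span B)"
    unfolding dual_closed_def
  proof (intro allI impI)
    fix z assume z: "\<forall>p. (\<forall>l\<in>int_module.span B. p \<bullet> l \<in> \<int>) \<longrightarrow> p \<bullet> z \<in> \<int>"
    have "d b \<bullet> z \<in> \<int>" if b: "b \<in> B" for b
    proof -
      have "d b \<bullet> l \<in> \<int>" if "l \<in> int_module.span B" for l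
        using that
      proof (induction rule: int_module.span_induct_alt)
        case (step c x y)
        then show ?case using d[OF b] by (auto simp: inner_add_right intro!: Ints_add Ints_mult)
      qed simp
      then show ?thesis using z by blast
    qed
    then have fl: "of_int \<lfloor>d b \<bullet> z\<rfloor> = d b \<bullet> z" if "b \<in> B" for b using that by simp
    have "(\<Sum>b\<in>B. of_int \<lfloor>d b \<bullet> z\<rfloor> *\<^sub>R b) = (\<Sum>b\<in>B. (d b \<bullet> z) *\<^sub>R b)"
      by (rule sum.cong[OF HOL.refl]) (simp only: fl)
    then show "z \<in> int_module.span B" using int_comb[of "\<lambda>b. \<lfloor>d b \<bullet> z\<rfloor>"] expand[of z] by simp
  qed
  have torsion: "\<exists>N>0. of_nat N *\<^sub>R v \<in> int_module.span B" if v: "v \<in> ?C" for v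
  proof -
    \<comment> \<open>This is \<open>k v\<close> reduced modulo the lattice of \<open>B\<close>. It
      stays bounded and has integral products with the roots, so only finitely many values occur;
      two equal ones give the torsion relation.\<close>
    define y where "y k = of_nat k *\<^sub>R v - (\<Sum>b\<in>B. of_int \<lfloor>of_nat k * (d b \<bullet> v)\<rfloor> *\<^sub>R b)" for k :: nat
    define Y where "Y = {y. norm y \<le> (\<Sum>b\<in>B. norm b) \<and> (\<forall>\<alpha>\<in>\<Phi>. y \<bullet> \<alpha> \<in> \<int>)}"
    have CI: "c \<bullet> \<alpha> \<in> \<int>" if "c \<in> ?C" "\<alpha> \<in> \<Phi>" for c \<alpha> using that coroot_inner_Ints by auto
    have "finite Y"
    proof (rule finite_bounded_inner_values[OF finite_roots span_roots])
      fix \<alpha> assume \<alpha>: "\<alpha> \<in> \<Phi>"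
      have "(\<lambda>y. y \<bullet> \<alpha>) ` Y \<subseteq> {r \<in> \<int>. \<bar>r\<bar> \<le> (\<Sum>b\<in>B. norm b) * norm \<alpha>}"
      proof (intro image_subsetI CollectI conjI)
        fix y assume y: "y \<in> Y"
        then show "y \<bullet> \<alpha> \<in> \<int>" using \<alpha> by (auto simp: Y_def)
        have "\<bar>y \<bullet> \<alpha>\<bar> \<le> norm y * norm \<alpha>" by (rule Cauchy_Schwarz_ineq2)
        also have "\<dots> \<le> (\<Sum>b\<in>B. norm b) * norm \<alpha>" using y by (intro mult_right_mono) (auto simp: Y_def)
        finally show "\<bar>y \<bullet> \<alpha>\<bar> \<le> (\<Sum>b\<in>B. norm b) * norm \<alpha>" .
      qed
      then show "finite ((\<lambda>y. y \<bullet> \<alpha>) ` Y)" by (rule finite_subset) (rule finite_bounded_Ints)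
    qed
    moreover have "range y \<subseteq> Y"
    proof (intro image_subsetI)
      fix k
      have "y k = (\<Sum>b\<in>B. frac (of_nat k * (d b \<bullet> v)) *\<^sub>R b)"
      proof -
        have "of_nat k *\<^sub>R v = (\<Sum>b\<in>B. (of_nat k * (d b \<bullet> v)) *\<^sub>R b)"
        proof -
          have "(\<Sum>b\<in>B. (of_nat k * (d b \<bullet> v)) *\<^sub>R b) = of_nat k *\<^sub>R (\<Sum>b\<in>B. (d b \<bullet> v) *\<^sub>R b)"
            by (simp only: scaleR_sum_right scaleR_scaleR)
          then show ?thesis by (simp only: expand[of v, symmetric])
        qed
        then show ?thesis by (simp add: y_def frac_def scaleR_left_diff_distrib sum_subtractf)
      qed
      then have "norm (y k) \<le> (\<Sum>b\<in>B. norm (frac (of_nat k * (d b \<bullet> v)) *\<^sub>R b))" by (simp only: norm_sum)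
      also have "\<dots> \<le> (\<Sum>b\<in>B. norm b)"
      proof (rule sum_mono)
        fix b
        have "0 \<le> frac (of_nat k * (d b \<bullet> v))" "frac (of_nat k * (d b \<bullet> v)) \<le> 1"
          using frac_ge_0 frac_lt_1 less_imp_le by blast+
        then show "norm (frac (of_nat k * (d b \<bullet> v)) *\<^sub>R b) \<le> norm b" by (simp add: mult_left_le_one_le)
      qed
      finally have "norm (y k) \<le> (\<Sum>b\<in>B. norm b)" .
      moreover have "y k \<bullet> \<alpha> \<in> \<int>" if \<alpha>: "\<alpha> \<in> \<Phi>" for \<alpha>
        unfolding y_def inner_diff_left inner_sum_left inner_scaleR_left
        using CI[OF _ \<alpha>] B(1) v by (intro Ints_diff Ints_sum Ints_mult) auto
      ultimately show "y k \<in> Y" by (simp add: Y_def)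
    qed
    ultimately have "finite (range y)" by (rule finite_subset[rotated])
    then have "\<not> inj y" using finite_imageD by blast
    then obtain i j where "y i = y j" "i \<noteq> j" by (auto simp: inj_def)
    then obtain i j where ij: "y i = y j" "i < j" by (metis linorder_neqE_nat)
    have "of_nat (j - i) *\<^sub>R v = (\<Sum>b\<in>B. of_int (\<lfloor>of_nat j * (d b \<bullet> v)\<rfloor> - \<lfloor>of_nat i * (d b \<bullet> v)\<rfloor>) *\<^sub>R b)"
    proof -
      have "of_nat (j - i) *\<^sub>R v = of_nat j *\<^sub>R v - of_nat i *\<^sub>R v"
        using ij(2) by (simp add: of_nat_diff scaleR_left_diff_distrib)
      also have "\<dots> = (\<Sum>b\<in>B. of_int \<lfloor>of_nat j * (d b \<bullet> v)\<rfloor> *\<^sub>R b) - (\<Sum>b\<in>B. of_int \<lfloor>of_nat i * (d b \<bullet> v)\<rfloor> *\<^sub>R b)"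
        using ij(1) by (simp add: y_def algebra_simps)
      finally show ?thesis by (simp add: scaleR_left_diff_distrib sum_subtractf)
    qed
    then have "of_nat (j - i) *\<^sub>R v \<in> int_module.span B"
      using int_comb[of "\<lambda>b. \<lfloor>of_nat j * (d b \<bullet> v)\<rfloor> - \<lfloor>of_nat i * (d b \<bullet> v)\<rfloor>"] by (simp only:)
    then show ?thesis using ij(2) by (intro exI[of _ "j - i"]) auto
  qed
  have "dual_closed (int_module.span (S \<union> B))" if "finite S" "S \<subseteq> ?C" for S
    using that
  proof (induction S)
    case empty
    then show ?case using base by simp
  next
    case (insert v S)
    obtain N where N: "N > 0" "of_nat N *\<^sub>R v \<in> int_module.span B" using torsion[of v] insert.prems by auto
    have "of_nat N *\<^sub>R v \<in> int_module.span (S \<union> B)" using int_module.span_mono[of B "S \<union> B"] N by auto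
    from dual_closed_insert_torsion[OF _ N(1) this] insert show ?case by simp
  qed
  from this[of ?C] have "dual_closed (int_module.span ?C)"
    using finite_roots B(1) by (simp add: Un_absorb2)
  moreover have "p \<bullet> z \<in> \<int>" if "\<forall>l\<in>int_module.span ?C. p \<bullet> l \<in> \<int>" for p
    using assms that int_module.span_base by blast
  ultimately show ?thesis unfolding dual_closed_def by blast
qed

text \<open>Reflections in the hyperplanes of levels 0 and \<open>c\<close> of the same root compose
  to the translation by \<open>c\<close> times the coroot.\<close>

lemma translation_in_affine_group:
  "z \<in> int_module.span (coroot ` \<Phi>) \<Longrightarrow> (\<lambda>x. x + z) \<in> affine_group"
proof (induction rule: int_module.span_induct_alt)
  case base
  then show ?case using affine_group.id by simp
next
  case (step c x y)
  then obtain \<alpha> where \<alpha>: "\<alpha> \<in> \<Phi>" "x = coroot \<alpha>" by blast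
  have "aff_refl \<alpha> c (aff_refl \<alpha> 0 (u + y)) = u + (of_int c *\<^sub>R x + y)" for u
    using root_nz[OF \<alpha>(1)] by (simp add: aff_refl_eq[of \<alpha> c] \<alpha>(2))
  then show ?case
    using affine_group.refl[OF \<alpha>(1) affine_group.refl[OF \<alpha>(1) step(2), of 0], of c] by simp
qed

section \<open>Weyl-invariant exponential sums separate points of the closed alcove\<close>

inductive_set weyl :: "('a \<Rightarrow> 'a) set" where
  weyl_id: "(\<lambda>x. x) \<in> weyl"
| weyl_refl: "\<beta> \<in> \<Phi> \<Longrightarrow> w \<in> weyl \<Longrightarrow> (\<lambda>x. aff_refl \<beta> 0 (w x)) \<in> weyl"

lemma weyl_linear: "w \<in> weyl \<Longrightarrow> linear w"
proof (induction rule: weyl.induct)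
  case weyl_id
  show ?case by (rule linear_ident)
next
  case (weyl_refl \<beta> w)
  then show ?case using linear_compose[OF weyl_refl(3) linear_refl] by (simp add: o_def)
qed

lemma weyl_roots: "w \<in> weyl \<Longrightarrow> \<alpha> \<in> \<Phi> \<Longrightarrow> w \<alpha> \<in> \<Phi> \<and> w (coroot \<alpha>) = coroot (w \<alpha>)"
  by (induction rule: weyl.induct) (auto simp: root_refl refl_coroot root_nz)

lemma weyl_affine: "w \<in> weyl \<Longrightarrow> w \<in> affine_group"
  by (induction rule: weyl.induct) (auto intro: affine_group.intros)

lemma weyl_refl_right: "w \<in> weyl \<Longrightarrow> \<beta> \<in> \<Phi> \<Longrightarrow> (\<lambda>x. w (aff_refl \<beta> 0 x)) \<in> weyl"
proof (induction rule: weyl.induct)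
  case weyl_id
  then show ?case using weyl.weyl_refl[OF _ weyl.weyl_id] by simp
next
  case (weyl_refl \<gamma> w)
  then show ?case using weyl.weyl_refl[of \<gamma> "\<lambda>x. w (aff_refl \<beta> 0 x)"] by simp
qed

lemma finite_weyl: "finite weyl"
proof (rule inj_on_finite)
  show "inj_on (\<lambda>w. restrict w \<Phi>) weyl"
  proof (rule inj_onI)
    fix w w' assume w: "w \<in> weyl" "w' \<in> weyl" "restrict w \<Phi> = restrict w' \<Phi>"
    have "w x = w' x" for x
      by (rule linear_eq_on_span[OF weyl_linear[OF w(1)] weyl_linear[OF w(2)], of \<Phi>])
        (use w(3) span_roots restrict_apply' in \<open>metis UNIV_I\<close>)+
    then show "w = w'" by (rule ext)
  qed
  show "(\<lambda>w. restrict w \<Phi>) ` weyl \<subseteq> PiE \<Phi> (\<lambda>_. \<Phi>)" using weyl_roots by auto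
  show "finite (PiE \<Phi> (\<lambda>_. \<Phi>))" using finite_roots by (intro finite_PiE)
qed

definition weyl_sum :: "'a \<Rightarrow> 'a \<Rightarrow> complex" where
  "weyl_sum p x = (\<Sum>w\<in>weyl. cis (2 * pi * (p \<bullet> w x)))"

lemma tp_weyl_sum: "weyl_sum p \<in> trig_polynomials"
proof -
  have "cis (2 * pi * (p \<bullet> w x)) = 1 * cis (((2 * pi) *\<^sub>R adjoint w p) \<bullet> x)" if "w \<in> weyl" for w x
    using adjoint_works[OF weyl_linear[OF that], of x p] by (simp add: inner_commute)
  then have "weyl_sum p = (\<lambda>x. \<Sum>w\<in>weyl. 1 * cis (((2 * pi) *\<^sub>R adjoint w p) \<bullet> x))"
    unfolding weyl_sum_def by (intro ext sum.cong HOL.refl)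
  then show ?thesis by (simp only: tp_sum_cis)
qed

text \<open>The linear part of the reflection permutes the summands; its translation part changes
  the phases by integer multiples of \<open>2 * pi\<close>, since \<open>p\<close> is integral on
  coroots.\<close>

lemma weyl_sum_invariant:
  assumes p: "\<And>\<alpha>. \<alpha> \<in> \<Phi> \<Longrightarrow> p \<bullet> coroot \<alpha> \<in> \<int>"
  shows "invariant (weyl_sum p)"
  unfolding invariant_def
proof (intro ballI allI)
  fix \<beta> k x assume \<beta>: "\<beta> \<in> \<Phi>"
  let ?t = "\<lambda>w. (\<lambda>x. w (aff_refl \<beta> 0 x))"
  have inv: "?t (?t w) = w" for w :: "'a \<Rightarrow> 'a" using root_nz[OF \<beta>] by simp
  have "bij_betw ?t weyl weyl"
    by (rule bij_betwI[of _ _ _ ?t]) (use weyl_refl_right \<beta> inv in auto)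
  then have "weyl_sum p x = (\<Sum>w\<in>weyl. cis (2 * pi * (p \<bullet> ?t w x)))"
    unfolding weyl_sum_def by (rule sum.reindex_bij_betw[symmetric])
  also have "\<dots> = weyl_sum p (aff_refl \<beta> k x)"
    unfolding weyl_sum_def
  proof (rule sum.cong[OF HOL.refl])
    fix w assume w: "w \<in> weyl"
    have "p \<bullet> w (coroot \<beta>) \<in> \<int>" using weyl_roots[OF w \<beta>] p by simp
    then have "of_int k * (p \<bullet> w (coroot \<beta>)) \<in> \<int>" by (intro Ints_mult) auto
    then have 1: "cis (2 * pi * (of_int k * (p \<bullet> w (coroot \<beta>)))) = 1" by (simp only: cis_2pi_eq_1_iff)
    have "w (aff_refl \<beta> k x) = w (aff_refl \<beta> 0 x) + of_int k *\<^sub>R w (coroot \<beta>)"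
      using weyl_linear[OF w] by (simp add: aff_refl_eq[of \<beta> k] linear_add linear_cmul)
    then have "cis (2 * pi * (p \<bullet> w (aff_refl \<beta> k x)))
        = cis (2 * pi * (p \<bullet> w (aff_refl \<beta> 0 x))) * cis (2 * pi * (of_int k * (p \<bullet> w (coroot \<beta>))))"
      by (simp add: inner_add_right distrib_left cis_mult)
    then show "cis (2 * pi * (p \<bullet> w (aff_refl \<beta> 0 x))) = cis (2 * pi * (p \<bullet> w (aff_refl \<beta> k x)))"
      using 1 by simp
  qed
  finally show "weyl_sum p (aff_refl \<beta> k x) = weyl_sum p x" by simp
qed

text \<open>As functions of the weight \<open>p\<close>, the summands of \<open>weyl_sum p x\<close>
  are characters. If the sums agreed for \<open>x\<close> and \<open>y\<close> at all weights, some
  character of \<open>w y\<close> would equal that of \<open>x\<close>; by duality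
  \<open>x - w y\<close> is then in the coroot lattice, so \<open>x\<close> and \<open>y\<close>
  share an orbit and coincide.\<close>

lemma separation:
  assumes x: "x \<in> calcove" and y: "y \<in> calcove" and "x \<noteq> y"
  shows "\<exists>p. (\<forall>\<alpha>\<in>\<Phi>. p \<bullet> coroot \<alpha> \<in> \<int>) \<and> weyl_sum p x \<noteq> weyl_sum p y"
proof (rule ccontr)
  assume neg: "\<not> ?thesis"
  define F where "F = {p. \<forall>\<alpha>\<in>\<Phi>. p \<bullet> coroot \<alpha> \<in> \<int>}"
  have eq: "weyl_sum p x = weyl_sum p y" if "p \<in> F" for p using neg that by (auto simp: F_def)
  have "\<exists>w\<in>weyl. \<forall>p\<in>F. cis (2 * pi * (p \<bullet> w y)) = cis (2 * pi * (p \<bullet> x))"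
  proof (rule characters_of_equal_sums[of weyl "\<lambda>x. x" F "\<lambda>w p. cis (2 * pi * (p \<bullet> w x))" _ 0])
    show "finite weyl" "(\<lambda>x. x) \<in> weyl" by (rule finite_weyl, rule weyl_id)
    show "(\<Sum>w\<in>weyl. cis (2 * pi * (p \<bullet> w x))) = (\<Sum>w\<in>weyl. cis (2 * pi * (p \<bullet> w y)))" if "p \<in> F" for p
      using eq[OF that] by (simp only: weyl_sum_def)
  qed (auto simp: F_def inner_add_left distrib_left cis_mult)
  then obtain w where w: "w \<in> weyl" "\<And>p. p \<in> F \<Longrightarrow> cis (2 * pi * (p \<bullet> w y)) = cis (2 * pi * (p \<bullet> x))" by blast
  have "x - w y \<in> int_module.span (coroot ` \<Phi>)"
  proof (rule coroot_lattice_dual)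
    fix p assume "\<And>\<alpha>. \<alpha> \<in> \<Phi> \<Longrightarrow> p \<bullet> coroot \<alpha> \<in> \<int>"
    then have "p \<in> F" by (simp add: F_def)
    have "2 * pi * (p \<bullet> (x - w y)) = 2 * pi * (p \<bullet> x) - 2 * pi * (p \<bullet> w y)"
      by (simp add: inner_diff_right right_diff_distrib)
    then have "cis (2 * pi * (p \<bullet> (x - w y))) = cis (2 * pi * (p \<bullet> x)) / cis (2 * pi * (p \<bullet> w y))"
      by (simp only: cis_divide)
    then have "cis (2 * pi * (p \<bullet> (x - w y))) = 1" using w(2)[OF \<open>p \<in> F\<close>] by simp
    then show "p \<bullet> (x - w y) \<in> \<int>" by (simp only: cis_2pi_eq_1_iff)
  qed
  from affine_group_comp[OF translation_in_affine_group[OF this] weyl_affine[OF w(1)]]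
  have "y = x" by (rule calcove_orbit_unique[OF y x]) simp
  then show False using \<open>x \<noteq> y\<close> by simp
qed

text \<open>Real-valued, because Stone--Weierstrass is applied to real functions; complex ones are
  handled through real and imaginary parts.\<close>

definition real_invariants :: "('a \<Rightarrow> real) set" where
  "real_invariants = {f. (\<lambda>x. complex_of_real (f x)) \<in> trig_polynomials \<and> invariant f}"

lemma real_invariants_dense:
  fixes f :: "'a \<Rightarrow> real"
  assumes "continuous_on calcove f" "0 < e"
  shows "\<exists>g\<in>real_invariants. \<forall>x\<in>calcove. \<bar>f x - g x\<bar> < e"
proof -
  have "\<exists>g. g \<in> real_invariants \<and> (\<forall>x\<in>calcove. \<bar>f x - g x\<bar> < e)"
  proof (rule Stone_Weierstrass_HOL[where P = "\<lambda>g. g \<in> real_invariants", OF compact_calcove])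
    show "(\<lambda>x. c) \<in> real_invariants" for c by (simp add: real_invariants_def invariant_def tp_const)
    show "continuous_on calcove g" if "g \<in> real_invariants" for g
    proof -
      have "continuous_on calcove (\<lambda>x. Re (complex_of_real (g x)))"
        using that by (intro continuous_intros continuous_on_tp) (auto simp: real_invariants_def)
      then show ?thesis by simp
    qed
    show "(\<lambda>x. g x + h x) \<in> real_invariants" "(\<lambda>x. g x * h x) \<in> real_invariants"
      if "g \<in> real_invariants \<and> h \<in> real_invariants" for g h
      using that by (auto simp: real_invariants_def invariant_def tp_add tp_mult)
    show "\<exists>g. g \<in> real_invariants \<and> g x \<noteq> g y" if xy: "x \<in> calcove \<and> y \<in> calcove \<and> x \<noteq> y" for x y
    proof -
      obtain p where p: "\<forall>\<alpha>\<in>\<Phi>. p \<bullet> coroot \<alpha> \<in> \<int>" "weyl_sum p x \<noteq> weyl_sum p y"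
        using separation xy by blast
      have inv: "invariant (weyl_sum p)" using p(1) by (intro weyl_sum_invariant) auto
      have "(\<lambda>x. complex_of_real (Re (weyl_sum p x))) = (\<lambda>x. (1/2) * (weyl_sum p x + cnj (weyl_sum p x)))"
        by (auto simp: complex_eq_iff)
      then have re: "(\<lambda>x. complex_of_real (Re (weyl_sum p x))) \<in> trig_polynomials"
        by (simp only:) (intro tp_cmult tp_add tp_cnj tp_weyl_sum)
      have "(\<lambda>x. complex_of_real (Im (weyl_sum p x))) = (\<lambda>x. (1/(2*\<i>)) * (weyl_sum p x - cnj (weyl_sum p x)))"
        by (auto simp: complex_eq_iff)
      then have im: "(\<lambda>x. complex_of_real (Im (weyl_sum p x))) \<in> trig_polynomials"
        by (simp only:) (intro tp_cmult tp_diff tp_cnj tp_weyl_sum)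
      have "(\<lambda>x. Re (weyl_sum p x)) \<in> real_invariants" "(\<lambda>x. Im (weyl_sum p x)) \<in> real_invariants"
        using inv re im by (auto simp: real_invariants_def invariant_def)
      then show ?thesis using p(2) by (metis complex_eq_iff)
    qed
  qed (use assms in auto)
  then show ?thesis by blast
qed

text \<open>Multiplying an approximation of \<open>v H / (H^2 + \<delta>)\<close> by \<open>H\<close> gives an antisymmetric one of \<open>v\<close>.\<close>

lemma antisymmetric_dense:
  fixes v :: "'a \<Rightarrow> complex"
  assumes v: "continuous_on calcove v" and v0: "\<And>x. x \<in> frontier (alcove P) \<Longrightarrow> v x = 0" and e: "0 < e"
  shows "\<exists>f\<in>trig_polynomials. antisymmetric f \<and> (\<forall>x\<in>calcove. norm (f x - v x) \<le> e)"
proof -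
  let ?h = "sine_product P"
  have h_le: "\<bar>?h x\<bar> \<le> 1" for x
  proof -
    have "\<bar>?h x\<bar> = (\<Prod>\<alpha>\<in>P. \<bar>sin (pi * (x \<bullet> \<alpha>))\<bar>)" by (simp add: sine_product_def abs_prod)
    also have "\<dots> \<le> 1" by (rule prod_le_1) auto
    finally show ?thesis .
  qed
  have h_cont: "continuous_on S ?h" for S unfolding sine_product_def[abs_def] by (intro continuous_intros)
  \<comment> \<open>Where \<open>v\<close> is not small. This compact set avoids the frontier, so
    the square of the sine product has a positive lower bound on it.\<close>
  define K where "K = {x \<in> calcove. e / 4 \<le> norm (v x)}"
  have "closed K"
    unfolding K_def using continuous_closed_preimage[OF continuous_on_norm[OF v] closed_calcove closed_atLeast, of "e / 4"]
    by (simp add: vimage_def Int_def atLeast_def conj_commute)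
  then have "compact K" using bounded_calcove bounded_subset[of calcove K]
    by (auto simp: compact_eq_bounded_closed K_def)
  have Kpos: "(?h x)\<^sup>2 > 0" if "x \<in> K" for x
  proof -
    have "x \<notin> frontier (alcove P)" using that v0 e by (auto simp: K_def)
    then have "x \<in> alcove P" using that by (auto simp: frontier_alcove K_def)
    then show ?thesis using sine_product_positive[of x] by simp
  qed
  obtain c where c: "c > 0" "\<And>x. x \<in> K \<Longrightarrow> c \<le> (?h x)\<^sup>2"
  proof (cases "K = {}")
    case True
    then show ?thesis using that[of 1] by simp
  next
    case False
    obtain x0 where "x0 \<in> K" "\<And>x. x \<in> K \<Longrightarrow> (?h x0)\<^sup>2 \<le> (?h x)\<^sup>2"
      using continuous_attains_inf[OF \<open>compact K\<close> False, of "\<lambda>x. (?h x)\<^sup>2"]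
      by (auto intro: continuous_on_power h_cont)
    then show ?thesis using that[of "(?h x0)\<^sup>2"] Kpos by blast
  qed
  obtain M where M: "M > 0" "\<And>x. x \<in> calcove \<Longrightarrow> norm (v x) \<le> M"
    using compact_imp_bounded[OF compact_continuous_image[OF v compact_calcove]]
    unfolding bounded_pos by auto
  \<comment> \<open>The damping error is the norm of \<open>v x\<close> times
    \<open>\<delta> / (h^2 + \<delta>)\<close>, with \<open>h\<close> the sine product; this value
    makes it at most \<open>M * (\<delta> / c) = e / 4\<close> on \<open>K\<close>.\<close>
  define \<delta> where "\<delta> = c * e / (4 * M)"
  have \<delta>: "\<delta> > 0" using c M e by (simp add: \<delta>_def)
  define G where "G x = v x * of_real (?h x / ((?h x)\<^sup>2 + \<delta>))" for x
  have den: "(?h x)\<^sup>2 + \<delta> > 0" for x using \<delta> by (simp add: add_nonneg_pos)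
  have close1: "norm (H x * G x - v x) \<le> e / 4" if x: "x \<in> calcove" for x
  proof -
    have "?h x * (?h x / ((?h x)\<^sup>2 + \<delta>)) - 1 = - (\<delta> / ((?h x)\<^sup>2 + \<delta>))"
      using den[of x] by (simp add: field_simps power2_eq_square)
    moreover have "H x * G x - v x = v x * of_real (?h x * (?h x / ((?h x)\<^sup>2 + \<delta>)) - 1)"
      by (simp add: G_def H_def algebra_simps)
    ultimately have eq: "norm (H x * G x - v x) = norm (v x) * (\<delta> / ((?h x)\<^sup>2 + \<delta>))"
      using den[of x] \<delta> by (simp only: norm_mult norm_of_real) (simp add: less_imp_le)
    show ?thesis
    proof (cases "x \<in> K")
      case True
      have "norm (v x) * (\<delta> / ((?h x)\<^sup>2 + \<delta>)) \<le> M * (\<delta> / c)"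
        using M(2)[OF x] M(1) \<delta> c(1) c(2)[OF True] den[of x] by (intro mult_mono divide_left_mono mult_pos_pos) auto
      also have "\<dots> = e / 4" using M c by (simp add: \<delta>_def)
      finally show ?thesis using eq by simp
    next
      case False
      have "\<delta> / ((?h x)\<^sup>2 + \<delta>) \<le> 1" using den[of x] by simp
      then have "norm (v x) * (\<delta> / ((?h x)\<^sup>2 + \<delta>)) \<le> norm (v x)" by (intro mult_left_le) auto
      moreover have "norm (v x) < e / 4" using False x by (simp add: K_def)
      ultimately show ?thesis unfolding eq by linarith
    qed
  qed
  have Gc: "continuous_on calcove G"
    unfolding G_def using den by (intro continuous_intros v h_cont) (auto simp: less_imp_neq[symmetric])
  obtain a where a: "a \<in> real_invariants" "\<And>x. x \<in> calcove \<Longrightarrow> \<bar>Re (G x) - a x\<bar> < e / 4"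
    using real_invariants_dense[of "\<lambda>x. Re (G x)" "e / 4"] e Gc by (auto intro: continuous_intros)
  obtain b where b: "b \<in> real_invariants" "\<And>x. x \<in> calcove \<Longrightarrow> \<bar>Im (G x) - b x\<bar> < e / 4"
    using real_invariants_dense[of "\<lambda>x. Im (G x)" "e / 4"] e Gc by (auto intro: continuous_intros)
  define q where "q x = complex_of_real (a x) + \<i> * complex_of_real (b x)" for x
  have q: "q \<in> trig_polynomials" "invariant q"
    using a b unfolding q_def[abs_def] real_invariants_def invariant_def by (auto intro: tp_add tp_cmult)
  have Gq: "norm (q x - G x) \<le> e / 2" if "x \<in> calcove" for x
  proof -
    have "norm (q x - G x) \<le> \<bar>Re (q x - G x)\<bar> + \<bar>Im (q x - G x)\<bar>" by (rule cmod_le)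
    also have "\<dots> \<le> e / 4 + e / 4" using a(2)[OF that] b(2)[OF that] by (simp add: q_def abs_minus_commute)
    finally show ?thesis by simp
  qed
  show ?thesis
  proof (intro bexI[of _ "\<lambda>x. H x * q x"] conjI ballI)
    show "(\<lambda>x. H x * q x) \<in> trig_polynomials" by (intro tp_mult tp_H q)
    show "antisymmetric (\<lambda>x. H x * q x)"
      using antisymmetric_H q(2) by (simp add: antisymmetric_def invariant_def)
    fix x assume x: "x \<in> calcove"
    have "norm (H x * q x - v x) \<le> norm (H x * (q x - G x)) + norm (H x * G x - v x)"
      using norm_triangle_ineq[of "H x * (q x - G x)" "H x * G x - v x"] by (simp add: algebra_simps)
    also have "norm (H x * (q x - G x)) \<le> 1 * (e / 2)"
      unfolding norm_mult using h_le[of x] Gq[OF x] by (intro mult_mono) (auto simp: H_def)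
    finally show "norm (H x * q x - v x) \<le> e" using close1[OF x] e by linarith
  qed
qed

end

section \<open>Eigenfunctions are trigonometric polynomials\<close>

text \<open>Splitting by sign maps the integers into two copies of the naturals, hence twice the
  geometric series.\<close>

lemma sum_power_abs_le:
  fixes r :: real
  assumes "0 \<le> r" "r < 1" "finite F"
  shows "(\<Sum>j\<in>F. r ^ nat \<bar>j::int\<bar>) \<le> 2 / (1 - r)"
proof -
  let ?h = "\<lambda>j::int. (nat \<bar>j\<bar>, j < 0)"
  define N where "N = Suc (Max (insert 0 ((\<lambda>j. nat \<bar>j\<bar>) ` F)))"
  have N: "nat \<bar>j\<bar> < N" if "j \<in> F" for j
    unfolding N_def by (intro le_imp_less_Suc Max_ge) (use that assms(3) in auto)
  have inj: "inj_on ?h F" by (rule inj_onI) auto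
  have "(\<Sum>j\<in>F. r ^ nat \<bar>j\<bar>) = (\<Sum>p\<in>?h ` F. r ^ fst p)"
    by (simp add: sum.reindex[OF inj])
  also have "\<dots> \<le> (\<Sum>p\<in>{..<N} \<times> (UNIV :: bool set). r ^ fst p)"
    by (rule sum_mono2) (use N assms in auto)
  also have "\<dots> = (\<Sum>i<N. \<Sum>b\<in>(UNIV :: bool set). r ^ i)"
    by (subst sum.cartesian_product) (rule sum.cong, auto)
  also have "\<dots> = 2 * (\<Sum>i<N. r ^ i)" by (simp add: sum_distrib_left)
  also have "(\<Sum>i<N. r ^ i) \<le> 1 / (1 - r)"
  proof -
    have "(\<Sum>i<N. r ^ i) = (1 - r ^ N) / (1 - r)" using assms by (simp add: sum_gp_strict)
    also have "\<dots> \<le> 1 / (1 - r)" using assms by (intro divide_right_mono) auto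
    finally show ?thesis .
  qed
  finally show ?thesis by simp
qed

text \<open>A frequency is determined by the integers \<open>k \<xi> c\<close>. By Cauchy--Schwarz,
  averaged over \<open>C\<close>, \<open>\<xi> \<bullet> \<xi>\<close> dominates a multiple of the
  sum of their absolute values, so the Gaussian is bounded by a product of geometric series, one for
  each member of \<open>C\<close>.\<close>

lemma gaussian_lattice_bound:
  fixes C :: "'a::euclidean_space set"
  assumes C: "finite C" "span C = UNIV" "C \<noteq> {}"
    and L: "\<And>\<xi> c. \<xi> \<in> L \<Longrightarrow> c \<in> C \<Longrightarrow> \<xi> \<bullet> c / (2 * pi) \<in> \<int>"
  shows "\<exists>K. \<forall>S. finite S \<and> S \<subseteq> L \<longrightarrow> (\<Sum>\<xi>\<in>S. exp (- (\<xi> \<bullet> \<xi>))) \<le> K"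
proof -
  define M where "M = 1 + (\<Sum>c\<in>C. norm c)"
  have M: "M > 0" "\<And>c. c \<in> C \<Longrightarrow> norm c \<le> M"
  proof -
    show "M > 0" unfolding M_def by (intro add_pos_nonneg sum_nonneg) auto
    show "norm c \<le> M" if "c \<in> C" for c
      using member_le_sum[OF that, of norm] C(1) by (simp add: M_def)
  qed
  define n where "n = real (card C)"
  have n: "n > 0" using C by (simp add: n_def card_gt_0_iff)
  \<comment> \<open>From \<open>4 * pi\<^sup>2 * \<bar>k \<xi> c\<bar> \<le> (\<xi> \<bullet>
    c)\<^sup>2 \<le> M\<^sup>2 * (\<xi> \<bullet> \<xi>)\<close>, where the absolute value of an
    integer is at most its square, summed over the \<open>n\<close> members of
    \<open>C\<close>.\<close>
  define q where "q = 4 * pi\<^sup>2 / (n * M\<^sup>2)"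
  have q: "q > 0" using n M by (simp add: q_def)
  define r where "r = exp (- q)"
  have r: "0 \<le> r" "r < 1" using q by (auto simp: r_def)
  define k where "k \<xi> c = \<lfloor>\<xi> \<bullet> c / (2 * pi)\<rfloor>" for \<xi> c :: 'a
  have k: "\<xi> \<bullet> c = 2 * pi * of_int (k \<xi> c)" if "\<xi> \<in> L" "c \<in> C" for \<xi> c
  proof -
    have "of_int (k \<xi> c) = \<xi> \<bullet> c / (2 * pi)" using L[OF that] by (simp add: k_def)
    then show ?thesis by simp
  qed
  have term_le: "exp (- (\<xi> \<bullet> \<xi>)) \<le> (\<Prod>c\<in>C. r ^ nat \<bar>k \<xi> c\<bar>)" if \<xi>: "\<xi> \<in> L" for \<xi>
  proof -
    have "4 * pi\<^sup>2 * real_of_int \<bar>k \<xi> c\<bar> \<le> M\<^sup>2 * (\<xi> \<bullet> \<xi>)" if c: "c \<in> C" for c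
    proof -
      have "\<bar>k \<xi> c\<bar> \<le> (k \<xi> c)\<^sup>2"
      proof (cases "k \<xi> c = 0")
        case False
        then have "1 * \<bar>k \<xi> c\<bar> \<le> \<bar>k \<xi> c\<bar> * \<bar>k \<xi> c\<bar>" by (intro mult_right_mono) auto
        then show ?thesis by (simp add: power2_eq_square)
      qed simp
      then have "real_of_int \<bar>k \<xi> c\<bar> \<le> (of_int (k \<xi> c))\<^sup>2" by (metis of_int_le_iff of_int_power)
      then have "4 * pi\<^sup>2 * real_of_int \<bar>k \<xi> c\<bar> \<le> 4 * pi\<^sup>2 * (of_int (k \<xi> c))\<^sup>2" by (intro mult_left_mono) auto
      also have "\<dots> = (\<xi> \<bullet> c)\<^sup>2" using k[OF \<xi> c] by (simp add: power2_eq_square)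
      also have "\<dots> \<le> (\<xi> \<bullet> \<xi>) * (c \<bullet> c)" by (rule Cauchy_Schwarz_ineq)
      also have "\<dots> \<le> (\<xi> \<bullet> \<xi>) * M\<^sup>2"
        using M(2)[OF c] by (intro mult_left_mono) (auto simp: dot_square_norm intro: power_mono)
      finally show ?thesis by (simp add: mult.commute)
    qed
    then have "(\<Sum>c\<in>C. 4 * pi\<^sup>2 * real_of_int \<bar>k \<xi> c\<bar>) \<le> (\<Sum>c\<in>C. M\<^sup>2 * (\<xi> \<bullet> \<xi>))" by (rule sum_mono)
    then have "4 * pi\<^sup>2 * (\<Sum>c\<in>C. real_of_int \<bar>k \<xi> c\<bar>) \<le> (n * M\<^sup>2) * (\<xi> \<bullet> \<xi>)"
      by (simp add: sum_distrib_left n_def mult.assoc)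
    then have "4 * pi\<^sup>2 * (\<Sum>c\<in>C. real_of_int \<bar>k \<xi> c\<bar>) / (n * M\<^sup>2) \<le> \<xi> \<bullet> \<xi>"
      using n M by (simp add: divide_le_eq mult.commute)
    then have "q * (\<Sum>c\<in>C. real_of_int \<bar>k \<xi> c\<bar>) \<le> \<xi> \<bullet> \<xi>" by (simp add: q_def)
    then have "exp (- (\<xi> \<bullet> \<xi>)) \<le> exp (\<Sum>c\<in>C. - q * real_of_int \<bar>k \<xi> c\<bar>)"
      by (simp add: sum_distrib_left sum_negf)
    also have "\<dots> = (\<Prod>c\<in>C. exp (- q * real_of_int \<bar>k \<xi> c\<bar>))" by (rule exp_sum[OF C(1)])
    also have "\<dots> = (\<Prod>c\<in>C. r ^ nat \<bar>k \<xi> c\<bar>)"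
    proof (rule prod.cong[OF refl])
      fix c
      have "real_of_int \<bar>k \<xi> c\<bar> = of_nat (nat \<bar>k \<xi> c\<bar>)" by simp
      then have "- q * real_of_int \<bar>k \<xi> c\<bar> = of_nat (nat \<bar>k \<xi> c\<bar>) * (- q)" by (simp only: mult.commute)
      then show "exp (- q * real_of_int \<bar>k \<xi> c\<bar>) = r ^ nat \<bar>k \<xi> c\<bar>"
        by (simp only: r_def exp_of_nat_mult)
    qed
    finally show ?thesis .
  qed
  show ?thesis
  proof (intro exI allI impI)
    fix S assume S: "finite S \<and> S \<subseteq> L"
    let ?h = "\<lambda>\<xi>. restrict (k \<xi>) C"
    define F where "F c = (\<lambda>\<xi>. k \<xi> c) ` S" for c
    have inj: "inj_on ?h S"
    proof (rule inj_onI)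
      fix \<xi> \<eta> assume *: "\<xi> \<in> S" "\<eta> \<in> S" "?h \<xi> = ?h \<eta>"
      have "(\<xi> - \<eta>) \<bullet> c = 0" if "c \<in> C" for c
      proof -
        have "k \<xi> c = k \<eta> c" using fun_cong[OF *(3), of c] that by simp
        moreover have "\<xi> \<in> L" "\<eta> \<in> L" using *(1,2) S by blast+
        ultimately show ?thesis
          by (simp only: inner_diff_left k[OF \<open>\<xi> \<in> L\<close> that] k[OF \<open>\<eta> \<in> L\<close> that] diff_self)
      qed
      then have "\<xi> - \<eta> = 0" by (rule orthogonal_to_spanning[OF C(2)])
      then show "\<xi> = \<eta>" by simp
    qed
    have "(\<Sum>\<xi>\<in>S. exp (- (\<xi> \<bullet> \<xi>))) \<le> (\<Sum>\<xi>\<in>S. \<Prod>c\<in>C. r ^ nat \<bar>k \<xi> c\<bar>)"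
      by (rule sum_mono) (use term_le S in auto)
    also have "\<dots> = (\<Sum>\<kappa>\<in>?h ` S. \<Prod>c\<in>C. r ^ nat \<bar>\<kappa> c\<bar>)"
      by (simp add: sum.reindex[OF inj])
    also have "\<dots> \<le> (\<Sum>\<kappa>\<in>PiE C F. \<Prod>c\<in>C. r ^ nat \<bar>\<kappa> c\<bar>)"
    proof (rule sum_mono2)
      show "finite (PiE C F)" using C S by (intro finite_PiE) (auto simp: F_def)
      show "?h ` S \<subseteq> PiE C F" by (auto simp: F_def)
    qed (use r in \<open>auto intro!: prod_nonneg\<close>)
    also have "\<dots> = (\<Prod>c\<in>C. \<Sum>j\<in>F c. r ^ nat \<bar>j\<bar>)"
      using C(1) S by (subst prod_sum_PiE) (auto simp: F_def)
    also have "\<dots> \<le> (\<Prod>c\<in>C. 2 / (1 - r))"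
      using r S by (intro prod_mono conjI sum_nonneg sum_power_abs_le) (auto simp: F_def)
    finally show "(\<Sum>\<xi>\<in>S. exp (- (\<xi> \<bullet> \<xi>))) \<le> (\<Prod>c\<in>C. 2 / (1 - r))" .
  qed
qed

text \<open>A finite set whose sum is within \<open>e\<close> of the supremum leaves less than
  \<open>e\<close> to any finite set outside it.\<close>

lemma nonneg_sum_tail:
  fixes f :: "'b \<Rightarrow> real"
  assumes K: "\<And>S. finite S \<Longrightarrow> S \<subseteq> L \<Longrightarrow> sum f S \<le> K" and "e > 0"
  shows "\<exists>S0. finite S0 \<and> S0 \<subseteq> L \<and> (\<forall>S. finite S \<and> S \<subseteq> L - S0 \<longrightarrow> sum f S < e)"
proof -
  define X where "X = sum f ` {S. finite S \<and> S \<subseteq> L}"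
  have bdd: "bdd_above X" unfolding X_def by (rule bdd_aboveI2[of _ _ K]) (use K in auto)
  have "X \<noteq> {}" unfolding X_def by auto
  then obtain x where x: "x \<in> X" "Sup X - e < x"
    using less_cSup_iff[OF _ bdd, of "Sup X - e"] \<open>e > 0\<close> by auto
  then obtain S0 where S0: "finite S0" "S0 \<subseteq> L" "x = sum f S0" by (auto simp: X_def)
  have "sum f S < e" if S: "finite S" "S \<subseteq> L - S0" for S
  proof -
    have "sum f (S0 \<union> S) \<in> X" using S S0 by (auto simp: X_def)
    then have "sum f (S0 \<union> S) \<le> Sup X" using bdd by (rule cSup_upper)
    moreover have "sum f (S0 \<union> S) = sum f S0 + sum f S" using S S0 by (intro sum.union_disjoint) auto
    ultimately show ?thesis using x(2) S0(3) by linarith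
  qed
  then show ?thesis using S0 by blast
qed

text \<open>A single time would not determine \<open>\<mu>\<close>, as the complex exponential is
  periodic; derivatives are compared as well, at time 1 because equality is known only for
  \<open>t \<ge> 0\<close> and a two-sided derivative is used.\<close>

lemma exp_eq_imp_eq:
  assumes "\<And>t. t \<ge> 0 \<Longrightarrow> complex_of_real (exp (- (t * a))) = exp (- \<mu> * of_real t)"
  shows "\<mu> = of_real a"
proof -
  have d1: "((\<lambda>t. exp (- \<mu> * complex_of_real t)) has_vector_derivative (- \<mu> * exp (- \<mu> * of_real 1))) (at 1)"
    by (rule exp_has_derivative)
  have "((\<lambda>t. exp (- of_real a * complex_of_real t)) has_vector_derivative (- of_real a * exp (- of_real a * of_real 1))) (at 1)"
    by (rule exp_has_derivative)
  then have "((\<lambda>t. exp (- \<mu> * complex_of_real t)) has_vector_derivative (- of_real a * exp (- of_real a * of_real 1))) (at 1)"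
  proof (rule has_vector_derivative_transform_within_open[of _ _ _ "{0<..}"])
    fix t :: real assume "t \<in> {0<..}"
    then have "exp (- \<mu> * complex_of_real t) = of_real (exp (- (t * a)))" using assms[of t] by simp
    also have "\<dots> = exp (- of_real a * complex_of_real t)" by (simp add: exp_of_real[symmetric] mult.commute)
    finally show "exp (- of_real a * complex_of_real t) = exp (- \<mu> * complex_of_real t)" by simp
  qed auto
  from vector_derivative_unique_at[OF d1 this]
  have "\<mu> * exp (- \<mu>) = of_real a * exp (- of_real a)" by simp
  moreover have "exp (- \<mu>) = exp (- complex_of_real a)" using assms[of 1] by (simp add: exp_of_real[symmetric])
  ultimately show ?thesis by simp
qed

section \<open>From approximation on the alcove to Fourier coefficients and eigenvalues\<close>

context positive_roots
begin

lemma antisymmetric_norm_group: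
  assumes "antisymmetric f" "g \<in> affine_group"
  shows "norm (f (g x)) = norm (f x)"
  using assms(2)
proof (induction rule: affine_group.induct)
  case (refl \<beta> g m)
  then have "f (aff_refl \<beta> m (g x)) = - f (g x)" using assms(1) unfolding antisymmetric_def by blast
  then show ?case using refl by simp
qed simp

text \<open>The group moves every point into the closed alcove without changing
  \<open>norm (f x)\<close>.\<close>

lemma antisymmetric_bound:
  assumes "antisymmetric f" "\<And>x. x \<in> calcove \<Longrightarrow> norm (f x) \<le> M"
  shows "norm (f x) \<le> M"
  using to_calcove[of x] antisymmetric_norm_group[OF assms(1)] assms(2) by metis

lemma antisymmetric_lincomb:
  "antisymmetric f \<Longrightarrow> antisymmetric g \<Longrightarrow> antisymmetric (\<lambda>x. f x - c * g x)"
  by (simp add: antisymmetric_def)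

text \<open>Turns uniform closeness on the closed alcove into closeness of all Fourier coefficients;
  the essential choice of \<open>c\<close> later is the decay factor
  \<open>exp (- \<mu> * of_real t)\<close>.\<close>

lemma antisymmetric_coef_diff_le:
  assumes f: "f \<in> trig_polynomials" "antisymmetric f" and g: "g \<in> trig_polynomials" "antisymmetric g"
    and M: "\<And>x. x \<in> calcove \<Longrightarrow> norm (f x - c * g x) \<le> M"
  shows "norm (coef f \<xi> - c * coef g \<xi>) \<le> M"
proof -
  let ?d = "\<lambda>x. f x - c * g x"
  have d: "?d \<in> trig_polynomials" by (intro tp_diff tp_cmult f g)
  have "norm (?d x) \<le> M" for x
    by (rule antisymmetric_bound[OF antisymmetric_lincomb[OF f(2) g(2), of c]]) (rule M)
  from norm_coef_le[OF d this, of \<xi>] show ?thesis by (simp add: coef_diff coef_cmult tp_cmult f g)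
qed

text \<open>The coefficients of the approximants converge, and \<open>T\<close> is built from the
  limits. The approximants need not have their frequencies in a common finite set, so the limit is
  identified through their heat flow at time 1, where high frequencies are damped.\<close>

lemma dirichlet_eigenfunction_trig:
  assumes v: "dirichlet_eigenpair (alcove P) \<mu> v"
  obtains T where "T \<in> trig_polynomials" "antisymmetric T" "\<And>x. x \<in> calcove \<Longrightarrow> v x = T x"
    "\<And>\<xi>. coef T \<xi> \<noteq> 0 \<Longrightarrow> \<mu> = of_real (\<xi> \<bullet> \<xi>)"
proof -
  have vc: "continuous_on calcove v" and v0: "\<And>x. x \<in> frontier (alcove P) \<Longrightarrow> v x = 0"
    using v by (auto simp: dirichlet_eigenpair_def closure_alcove)
  define e where "e n = 1 / real (Suc n)" for n
  have e: "e n > 0" "e n \<le> 1" for n by (auto simp: e_def)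
  have e0: "e \<longlonglongrightarrow> 0" unfolding e_def[abs_def] by (rule LIMSEQ_Suc[OF lim_1_over_n])
  have "\<exists>f. f \<in> trig_polynomials \<and> antisymmetric f \<and> (\<forall>x\<in>calcove. norm (f x - v x) \<le> e n)" for n
    using antisymmetric_dense[OF vc v0 e(1)] by blast
  then obtain f where f: "\<And>n. f n \<in> trig_polynomials" "\<And>n. antisymmetric (f n)"
    "\<And>n x. x \<in> calcove \<Longrightarrow> norm (f n x - v x) \<le> e n" by metis
  have heat_close: "norm (heat t (f n) x - exp (- \<mu> * of_real t) * v x) \<le> e n" if "x \<in> calcove" "t \<ge> 0" for n t x
  proof (rule heat_maximum_principle[OF open_alcove _ v f(1)])
    show "bounded (alcove P)" by (rule bounded_subset[OF bounded_calcove alcove_subset])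
    show "heat t (f n) x = 0" if "x \<in> frontier (alcove P)" for t x
      by (rule antisymmetric_frontier[OF antisymmetric_heat[OF f(1,2)] that])
  qed (use f(3) that in \<open>auto simp: closure_alcove\<close>)
  define L where "L = {\<xi>. \<forall>c\<in>coroot ` \<Phi>. \<xi> \<bullet> c / (2 * pi) \<in> \<int>}"
  have suppL: "\<xi> \<in> L" if "coef (f n) \<xi> \<noteq> 0" for n \<xi>
    using antisymmetric_frequency[OF f(1,2) _ that] by (auto simp: L_def)
  have "Cauchy (\<lambda>n. coef (f n) \<xi>)" for \<xi>
  proof (rule metric_CauchyI)
    fix d :: real assume "d > 0"
    then have "\<forall>\<^sub>F n in sequentially. e n < d / 2" using order_tendstoD(2)[OF e0, of "d / 2"] by simp
    then obtain N where N: "\<And>n. n \<ge> N \<Longrightarrow> e n < d / 2" by (auto simp: eventually_sequentially)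
    have "dist (coef (f m) \<xi>) (coef (f n) \<xi>) < d" if "m \<ge> N" "n \<ge> N" for m n
    proof -
      have "norm (coef (f m) \<xi> - 1 * coef (f n) \<xi>) \<le> e m + e n"
      proof (rule antisymmetric_coef_diff_le[OF f(1,2) f(1,2)])
        fix x assume x: "x \<in> calcove"
        have "norm (f m x - f n x) \<le> norm (f m x - v x) + norm (f n x - v x)"
          using norm_triangle_ineq4[of "f m x - v x" "f n x - v x"] by simp
        then show "norm (f m x - 1 * f n x) \<le> e m + e n" using f(3)[OF x, of m] f(3)[OF x, of n] by simp
      qed
      then show ?thesis using N[OF that(1)] N[OF that(2)] by (simp add: dist_norm)
    qed
    then show "\<exists>M. \<forall>m\<ge>M. \<forall>n\<ge>M. dist (coef (f m) \<xi>) (coef (f n) \<xi>) < d" by blast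
  qed
  then have "\<exists>c. (\<lambda>n. coef (f n) \<xi>) \<longlonglongrightarrow> c" for \<xi>
    by (simp add: Cauchy_convergent_iff convergent_def)
  then obtain c where c: "\<And>\<xi>. (\<lambda>n. coef (f n) \<xi>) \<longlonglongrightarrow> c \<xi>" by metis
  \<comment> \<open>On the closed alcove \<open>heat t (f n)\<close> and
    \<open>exp (- \<mu> * of_real t)\<close> times \<open>f n\<close> are both close to the decaying
    eigenfunction, so in the limit each coefficient is multiplied by the same amount under
    both.\<close>
  have c\<mu>: "\<mu> = of_real (\<xi> \<bullet> \<xi>)" if c\<xi>: "c \<xi> \<noteq> 0" for \<xi>
  proof (rule exp_eq_imp_eq)
    fix t :: real assume t: "t \<ge> 0"
    let ?m = "complex_of_real (exp (- (t * (\<xi> \<bullet> \<xi>)))) - exp (- \<mu> * of_real t)"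
    let ?b = "1 + norm (exp (- \<mu> * of_real t))"
    have "norm (?m * coef (f n) \<xi>) \<le> e n * ?b" for n
    proof -
      have "norm (coef (heat t (f n)) \<xi> - exp (- \<mu> * of_real t) * coef (f n) \<xi>) \<le> e n * ?b"
      proof (rule antisymmetric_coef_diff_le[OF tp_heat[OF f(1)] antisymmetric_heat[OF f(1,2)] f(1,2)])
        fix x assume x: "x \<in> calcove"
        let ?E = "exp (- \<mu> * of_real t)"
        have "norm (heat t (f n) x - ?E * f n x) \<le> norm (heat t (f n) x - ?E * v x) + norm (?E * (f n x - v x))"
          using norm_triangle_ineq4[of "heat t (f n) x - ?E * v x" "?E * (f n x - v x)"] by (simp add: algebra_simps)
        also have "norm (?E * (f n x - v x)) \<le> norm ?E * e n"
          unfolding norm_mult by (rule mult_left_mono[OF f(3)[OF x]]) simp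
        finally show "norm (heat t (f n) x - ?E * f n x) \<le> e n * ?b"
          using heat_close[OF x t, of n] by (simp add: algebra_simps)
      qed
      then show ?thesis by (simp add: coef_heat[OF f(1)] left_diff_distrib)
    qed
    moreover have "(\<lambda>n. e n * ?b) \<longlonglongrightarrow> 0" by (rule tendsto_mult_left_zero[OF e0])
    ultimately have "(\<lambda>n. ?m * coef (f n) \<xi>) \<longlonglongrightarrow> 0" by (rule Lim_null_comparison[OF always_eventually, rule_format])
    moreover have "(\<lambda>n. ?m * coef (f n) \<xi>) \<longlonglongrightarrow> ?m * c \<xi>" by (intro tendsto_intros c)
    ultimately have "?m * c \<xi> = 0" by (rule LIMSEQ_unique[rotated])
    then show "complex_of_real (exp (- (t * (\<xi> \<bullet> \<xi>)))) = exp (- \<mu> * of_real t)" using c\<xi> by simp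
  qed
  obtain M where M: "M > 0" "\<And>x. x \<in> calcove \<Longrightarrow> norm (v x) \<le> M"
    using compact_imp_bounded[OF compact_continuous_image[OF vc compact_calcove]]
    unfolding bounded_pos by auto
  have coef_le: "norm (coef (f n) \<xi>) \<le> M + 1" for n \<xi>
  proof -
    have "norm (coef (f n) \<xi> - 0 * coef (f n) \<xi>) \<le> M + 1"
    proof (rule antisymmetric_coef_diff_le[OF f(1,2) f(1,2)])
      fix x assume x: "x \<in> calcove"
      have "norm (f n x) \<le> norm (f n x - v x) + norm (v x)" using norm_triangle_ineq[of "f n x - v x" "v x"] by simp
      then show "norm (f n x - 0 * f n x) \<le> M + 1" using f(3)[OF x, of n] M(2)[OF x] e(2)[of n] by simp
    qed
    then show ?thesis by simp
  qed
  obtain K where K': "\<forall>S. finite S \<and> S \<subseteq> L \<longrightarrow> (\<Sum>\<xi>\<in>S. exp (- (\<xi> \<bullet> \<xi>))) \<le> K"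
  proof -
    have "\<exists>K. \<forall>S. finite S \<and> S \<subseteq> L \<longrightarrow> (\<Sum>\<xi>\<in>S. exp (- (\<xi> \<bullet> \<xi>))) \<le> K"
      by (rule gaussian_lattice_bound[OF finite_imageI[OF finite_roots] span_coroots])
        (use nonempty in \<open>auto simp: L_def\<close>)
    then show thesis by (elim exE) (rule that)
  qed
  have tail: "\<exists>S0. finite S0 \<and> S0 \<subseteq> L \<and> (\<forall>S. finite S \<and> S \<subseteq> L - S0 \<longrightarrow> (\<Sum>\<xi>\<in>S. exp (- (\<xi> \<bullet> \<xi>))) < d)"
    if "d > 0" for d
    by (rule nonneg_sum_tail[where K = K, OF _ that]) (simp only: K')
  have cL: "\<xi> \<in> L" if "c \<xi> \<noteq> 0" for \<xi>
  proof (rule ccontr)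
    assume "\<xi> \<notin> L"
    then have "(\<lambda>n. coef (f n) \<xi>) = (\<lambda>n. 0)" using suppL by auto
    then have "c \<xi> = 0" using c[of \<xi>] LIMSEQ_unique[OF _ tendsto_const] by metis
    then show False using that by simp
  qed
  \<comment> \<open>A frequency \<open>\<xi>\<close> outside \<open>S0\<close> would by itself
    contribute \<open>exp (- Re \<mu>)\<close> to the Gaussian sum, since its squared norm is
    \<open>Re \<mu>\<close>.\<close>
  have fin: "finite {\<xi>. c \<xi> \<noteq> 0}"
  proof -
    obtain S0 where S0: "finite S0" "\<And>S. finite S \<Longrightarrow> S \<subseteq> L - S0 \<Longrightarrow> (\<Sum>\<xi>\<in>S. exp (- (\<xi> \<bullet> \<xi>))) < exp (- Re \<mu>)"
      using tail[of "exp (- Re \<mu>)"] by auto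
    have "\<xi> \<in> S0" if "c \<xi> \<noteq> 0" for \<xi>
    proof (rule ccontr)
      assume "\<xi> \<notin> S0"
      then have "(\<Sum>\<xi>\<in>{\<xi>}. exp (- (\<xi> \<bullet> \<xi>))) < exp (- Re \<mu>)" using cL[OF that] by (intro S0(2)) auto
      moreover have "Re \<mu> = \<xi> \<bullet> \<xi>" using arg_cong[OF c\<mu>[OF that], of Re] by simp
      ultimately show False by simp
    qed
    then have "{\<xi>. c \<xi> \<noteq> 0} \<subseteq> S0" by blast
    then show ?thesis using S0(1) by (rule finite_subset)
  qed
  define T where "T = trig_sum c"
  have T: "T \<in> trig_polynomials" "coef T = c"
    using trig_sum_polynomial[OF fin] coef_trig_sum[OF fin] by (auto simp: T_def)
  \<comment> \<open>The coefficients are bounded by \<open>M + 1\<close> for all \<open>n\<close>,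
    so the Gaussian weights make the frequencies outside \<open>S1\<close> contribute at most
    \<open>d / 2\<close>, uniformly in \<open>n\<close>; on the finite set \<open>S1\<close> the
    coefficients converge.\<close>
  have lim: "(\<lambda>n. heat 1 (f n) x) \<longlonglongrightarrow> exp (- \<mu>) * T x" for x
  proof (rule LIMSEQ_I)
    fix d :: real assume d: "d > 0"
    obtain S0 where S0: "finite S0" "S0 \<subseteq> L"
      "\<And>S. finite S \<Longrightarrow> S \<subseteq> L - S0 \<Longrightarrow> (\<Sum>\<xi>\<in>S. exp (- (\<xi> \<bullet> \<xi>))) < d / (2 * (M + 1))"
      using tail[of "d / (2 * (M + 1))"] d M by auto
    define S1 where "S1 = S0 \<union> {\<xi>. c \<xi> \<noteq> 0}"
    have S1: "finite S1" "S0 \<subseteq> S1" "{\<xi>. c \<xi> \<noteq> 0} \<subseteq> S1" using S0 fin by (auto simp: S1_def)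
    let ?g = "\<lambda>\<xi>. complex_of_real (exp (- (\<xi> \<bullet> \<xi>)))"
    define A where "A n = (\<Sum>\<xi>\<in>S1. ?g \<xi> * coef (f n) \<xi> * cis (\<xi> \<bullet> x))" for n
    have rest: "norm (heat 1 (f n) x - A n) \<le> d / 2" for n
    proof -
      let ?R = "{\<xi>. coef (f n) \<xi> \<noteq> 0} - S1"
      have finn: "finite {\<xi>. coef (f n) \<xi> \<noteq> 0}" by (rule finite_coef[OF f(1)])
      have "heat 1 (f n) x = (\<Sum>\<xi>\<in>{\<xi>. coef (f n) \<xi> \<noteq> 0} \<union> S1. ?g \<xi> * coef (f n) \<xi> * cis (\<xi> \<bullet> x))"
        unfolding heat_eq_sum[OF f(1)] by (rule sum.mono_neutral_cong_left) (use finn S1 in auto)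
      also have "{\<xi>. coef (f n) \<xi> \<noteq> 0} \<union> S1 = S1 \<union> ?R" by auto
      also have "(\<Sum>\<xi>\<in>S1 \<union> ?R. ?g \<xi> * coef (f n) \<xi> * cis (\<xi> \<bullet> x)) = A n + (\<Sum>\<xi>\<in>?R. ?g \<xi> * coef (f n) \<xi> * cis (\<xi> \<bullet> x))"
        unfolding A_def by (rule sum.union_disjoint) (use finn S1 in auto)
      finally have "norm (heat 1 (f n) x - A n) = norm (\<Sum>\<xi>\<in>?R. ?g \<xi> * coef (f n) \<xi> * cis (\<xi> \<bullet> x))" by simp
      also have "\<dots> \<le> (\<Sum>\<xi>\<in>?R. exp (- (\<xi> \<bullet> \<xi>)) * (M + 1))"
      proof (rule sum_norm_le)
        fix \<xi>
        show "norm (?g \<xi> * coef (f n) \<xi> * cis (\<xi> \<bullet> x)) \<le> exp (- (\<xi> \<bullet> \<xi>)) * (M + 1)"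
          using coef_le[of n \<xi>] by (simp add: norm_mult)
      qed
      also have "\<dots> = (\<Sum>\<xi>\<in>?R. exp (- (\<xi> \<bullet> \<xi>))) * (M + 1)" by (rule sum_distrib_right[symmetric])
      also have "\<dots> \<le> d / (2 * (M + 1)) * (M + 1)"
      proof (rule mult_right_mono)
        have "(\<Sum>\<xi>\<in>?R. exp (- (\<xi> \<bullet> \<xi>))) < d / (2 * (M + 1))"
          by (rule S0(3)) (use finn suppL S1 in auto)
        then show "(\<Sum>\<xi>\<in>?R. exp (- (\<xi> \<bullet> \<xi>))) \<le> d / (2 * (M + 1))" by simp
      qed (use M in simp)
      also have "\<dots> = d / 2"
      proof -
        have "d / (2 * m) * m = d / 2" if "m \<noteq> 0" for m :: real using that by simp
        from this[of "M + 1"] show ?thesis using M(1) by linarith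
      qed
      finally show ?thesis .
    qed
    have "A \<longlonglongrightarrow> (\<Sum>\<xi>\<in>S1. ?g \<xi> * c \<xi> * cis (\<xi> \<bullet> x))"
      unfolding A_def[abs_def] by (intro tendsto_intros c)
    also have "(\<Sum>\<xi>\<in>S1. ?g \<xi> * c \<xi> * cis (\<xi> \<bullet> x)) = (\<Sum>\<xi>\<in>S1. exp (- \<mu>) * (c \<xi> * cis (\<xi> \<bullet> x)))"
    proof (rule sum.cong[OF HOL.refl])
      fix \<xi>
      show "?g \<xi> * c \<xi> * cis (\<xi> \<bullet> x) = exp (- \<mu>) * (c \<xi> * cis (\<xi> \<bullet> x))"
      proof (cases "c \<xi> = 0")
        case False
        have "?g \<xi> = exp (- \<mu>)" unfolding c\<mu>[OF False] by (simp add: exp_of_real[symmetric])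
        then show ?thesis by simp
      qed simp
    qed
    also have "\<dots> = exp (- \<mu>) * T x"
      unfolding T_def trig_sum_superset[OF S1(1,3)] by (rule sum_distrib_left[symmetric])
    finally have "A \<longlonglongrightarrow> exp (- \<mu>) * T x" .
    from LIMSEQ_D[OF this, of "d / 2"] d obtain N where N: "\<And>n. n \<ge> N \<Longrightarrow> norm (A n - exp (- \<mu>) * T x) < d / 2" by auto
    have "norm (heat 1 (f n) x - exp (- \<mu>) * T x) < d" if "n \<ge> N" for n
      using norm_triangle_ineq[of "heat 1 (f n) x - A n" "A n - exp (- \<mu>) * T x"] rest[of n] N[OF that] by simp
    then show "\<exists>N. \<forall>n\<ge>N. norm (heat 1 (f n) x - exp (- \<mu>) * T x) < d" by blast
  qed
  have "v x = T x" if x: "x \<in> calcove" for x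
  proof -
    have "norm (heat 1 (f n) x - exp (- \<mu>) * v x) \<le> e n" for n using heat_close[OF x, of 1 n] by simp
    then have "(\<lambda>n. heat 1 (f n) x - exp (- \<mu>) * v x) \<longlonglongrightarrow> 0"
      by (rule Lim_null_comparison[OF always_eventually, rule_format]) (rule e0)
    then have "(\<lambda>n. heat 1 (f n) x) \<longlonglongrightarrow> exp (- \<mu>) * v x" by (simp add: LIM_zero_iff)
    from LIMSEQ_unique[OF this lim] show ?thesis by simp
  qed
  \<comment> \<open>The limit \<open>lim\<close> holds at every point, not only in the alcove, so
    the reflection law passes to \<open>T\<close>.\<close>
  moreover have "antisymmetric T"
    unfolding antisymmetric_def
  proof (intro ballI allI)
    fix \<beta> k x assume \<beta>: "\<beta> \<in> \<Phi>"
    have "heat 1 (f n) (aff_refl \<beta> k x) = - heat 1 (f n) x" for n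
      using antisymmetric_heat[OF f(1,2)] \<beta> unfolding antisymmetric_def by blast
    then have "(\<lambda>n. - heat 1 (f n) x) \<longlonglongrightarrow> exp (- \<mu>) * T (aff_refl \<beta> k x)" using lim[of "aff_refl \<beta> k x"] by simp
    from LIMSEQ_unique[OF this tendsto_minus[OF lim[of x]]]
    have "exp (- \<mu>) * T (aff_refl \<beta> k x) = exp (- \<mu>) * (- T x)" by simp
    then show "T (aff_refl \<beta> k x) = - T x" by (simp only: mult_cancel_left exp_not_eq_zero) simp
  qed
  ultimately show ?thesis using that[OF T(1)] c\<mu> T(2) by simp
qed

lemma dirichlet_eigenfunction_multiple:
  assumes v: "dirichlet_eigenpair (alcove P) \<mu> v"
  obtains g where "g \<in> trig_polynomials" "invariant g" "\<And>x. x \<in> calcove \<Longrightarrow> v x = H x * g x"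
    "\<exists>\<xi>. coef g \<xi> \<noteq> 0" "\<And>\<xi>. coef (\<lambda>x. H x * g x) \<xi> \<noteq> 0 \<Longrightarrow> \<mu> = of_real (\<xi> \<bullet> \<xi>)"
proof -
  obtain T where T: "T \<in> trig_polynomials" "antisymmetric T" "\<And>x. x \<in> calcove \<Longrightarrow> v x = T x"
    "\<And>\<xi>. coef T \<xi> \<noteq> 0 \<Longrightarrow> \<mu> = of_real (\<xi> \<bullet> \<xi>)"
    using dirichlet_eigenfunction_trig[OF v] by blast
  obtain g where g: "g \<in> trig_polynomials" "\<And>x. T x = H x * g x" "invariant g"
    using antisymmetric_dvd[OF T(1,2)] by blast
  have Tg: "T = (\<lambda>x. H x * g x)" using g(2) by (rule ext)
  obtain x where x: "x \<in> alcove P" "v x \<noteq> 0" using v by (auto simp: dirichlet_eigenpair_def)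
  have "x \<in> calcove" using x alcove_subset by blast
  then have "g x \<noteq> 0" using T(3)[of x] g(2)[of x] x by auto
  then have "\<exists>\<xi>. coef g \<xi> \<noteq> 0" using trig_poly_eq_0_iff[OF g(1)] by blast
  then show ?thesis using that[OF g(1,3)] T Tg by simp
qed

lemma H_eigenpair:
  assumes l: "\<And>x. laplacian H x = - of_real l * H x"
  shows "dirichlet_eigenpair (alcove P) (of_real l) H"
  unfolding dirichlet_eigenpair_def
proof (intro conjI ballI)
  show "continuous_on (closure (alcove P)) H" by (rule continuous_on_tp[OF tp_H])
  show "C2_on (alcove P) H" by (rule C2_on_tp[OF tp_H])
  show "H x = 0" if "x \<in> frontier (alcove P)" for x by (rule antisymmetric_frontier[OF antisymmetric_H that])
  obtain a where "a \<in> alcove P" using alcove_nonempty by blast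
  then show "\<exists>x\<in>alcove P. H x \<noteq> 0" using sine_product_positive[of a] by (intro bexI[of _ a]) (auto simp: H_def)
  show "- laplacian H x = of_real l * H x" for x using l[of x] by simp
qed

lemma eigenvalue_lower_bound:
  assumes l: "\<And>\<xi>. coef H \<xi> \<noteq> 0 \<Longrightarrow> \<xi> \<bullet> \<xi> = l" and v: "dirichlet_eigenpair (alcove P) \<mu> v"
  shows "l \<le> Re \<mu>"
proof (rule ccontr)
  assume neg: "\<not> l \<le> Re \<mu>"
  obtain g \<xi>0 where g: "g \<in> trig_polynomials" "invariant g" "coef g \<xi>0 \<noteq> 0"
    "\<And>\<xi>. coef (\<lambda>x. H x * g x) \<xi> \<noteq> 0 \<Longrightarrow> \<mu> = of_real (\<xi> \<bullet> \<xi>)"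
    using dirichlet_eigenfunction_multiple[OF v] by metis
  obtain \<rho> where \<rho>: "coef H \<rho> \<noteq> 0" using H_frequency_exists by blast
  have "coef (\<lambda>x. H x * g x) \<rho> \<noteq> 0"
  proof (rule H_frequency_in_multiple[OF g(1-3) \<rho>])
    fix \<xi> assume "coef (\<lambda>x. H x * g x) \<xi> \<noteq> 0"
    from g(4)[OF this] show "\<xi> \<bullet> \<xi> \<le> \<rho> \<bullet> \<rho>" using neg l[OF \<rho>] by simp
  qed
  from g(4)[OF this] show False using neg l[OF \<rho>] by simp
qed

lemma principal_unique:
  assumes l: "\<And>\<xi>. coef H \<xi> \<noteq> 0 \<Longrightarrow> \<xi> \<bullet> \<xi> = l" and v: "dirichlet_eigenpair (alcove P) (of_real l) v"
  shows "\<exists>c. \<forall>x\<in>calcove. v x = c * H x"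
proof -
  obtain g where g: "g \<in> trig_polynomials" "invariant g" "\<And>x. x \<in> calcove \<Longrightarrow> v x = H x * g x"
    "\<And>\<xi>. coef (\<lambda>x. H x * g x) \<xi> \<noteq> 0 \<Longrightarrow> complex_of_real l = of_real (\<xi> \<bullet> \<xi>)"
    using dirichlet_eigenfunction_multiple[OF v] by metis
  obtain \<rho> where \<rho>: "coef H \<rho> \<noteq> 0" using H_frequency_exists by blast
  \<comment> \<open>This makes the coefficient of \<open>H\<close> times \<open>g - c\<close> at
    \<open>\<rho>\<close> zero, while all frequencies of that product stay on the sphere through
    \<open>\<rho>\<close>; \<open>H_frequency_in_multiple\<close> then leaves no frequency for
    \<open>g - c\<close>.\<close>
  define c where "c = coef (\<lambda>x. H x * g x) \<rho> / coef H \<rho>"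
  define g' where "g' x = g x - c" for x
  have g': "g' \<in> trig_polynomials" "invariant g'"
    using g(1,2) tp_diff[OF g(1) tp_const] by (auto simp: g'_def[abs_def] invariant_def)
  have "coef (\<lambda>x. H x * g' x) = coef (\<lambda>x. H x * g x - c * H x)"
    by (rule arg_cong[where f = coef]) (auto simp: g'_def algebra_simps)
  also have "\<dots> = (\<lambda>\<xi>. coef (\<lambda>x. H x * g x) \<xi> - c * coef H \<xi>)"
    by (simp add: coef_diff tp_mult tp_H g(1) tp_cmult coef_cmult)
  finally have eq: "coef (\<lambda>x. H x * g' x) = (\<lambda>\<xi>. coef (\<lambda>x. H x * g x) \<xi> - c * coef H \<xi>)" .
  have "coef g' \<xi> = 0" for \<xi>
  proof (rule ccontr)
    assume "coef g' \<xi> \<noteq> 0"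
    then have "coef (\<lambda>x. H x * g' x) \<rho> \<noteq> 0"
    proof (rule H_frequency_in_multiple[OF g' _ \<rho>])
      fix \<eta> assume "coef (\<lambda>x. H x * g' x) \<eta> \<noteq> 0"
      then have "coef (\<lambda>x. H x * g x) \<eta> \<noteq> 0 \<or> coef H \<eta> \<noteq> 0" unfolding eq by auto
      then have "\<eta> \<bullet> \<eta> = l" using g(4)[of \<eta>] l[of \<eta>] by (metis of_real_eq_iff)
      then show "\<eta> \<bullet> \<eta> \<le> \<rho> \<bullet> \<rho>" using l[OF \<rho>] by simp
    qed
    then show False unfolding eq using \<rho> by (simp add: c_def)
  qed
  then have "g x = c" for x using trig_poly_eq_0_iff[OF g'(1)] by (simp add: g'_def)
  then show ?thesis using g(3) by (intro exI[of _ c]) (simp add: mult.commute)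
qed

end

text \<open>Eigenfunctions are constrained only on the closed alcove, so divisibility is claimed for
  a trigonometric polynomial \<open>T\<close> that agrees with \<open>u\<close> there.\<close>

theorem proposition12:
  fixes \<Phi> P :: "'a::euclidean_space set"
    and H :: "'a \<Rightarrow> complex"
  assumes "root_system \<Phi>"
    and "crystallographic \<Phi>"
    and "irreducible_root_system \<Phi>"
    and "span \<Phi> = UNIV"
    and "positive_system \<Phi> P"
  defines "H \<equiv> (\<lambda>x. complex_of_real (sine_product P x))"
  shows "dirichlet_eigenfunction (alcove P) H \<and>
    (\<forall>x\<in>alcove P. sine_product P x > 0) \<and>
    principal_dirichlet_eigenfunction (alcove P) H \<and>
    (\<forall>u. principal_dirichlet_eigenfunction (alcove P) u \<longrightarrow>
       (\<exists>c. \<forall>x\<in>closure (alcove P). u x = c * H x)) \<and>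
    (\<forall>u. dirichlet_eigenfunction (alcove P) u \<longrightarrow>
       (\<exists>T. (\<forall>x\<in>closure (alcove P). u x = T x) \<and> trig_dvd H T))"
proof -
  interpret R: positive_roots \<Phi> P
    using assms by unfold_locales (auto simp: irreducible_root_system_def)
  have H: "H = R.H" by (rule ext) (simp add: H_def R.H_def)
  obtain l where l: "\<And>\<xi>. coef R.H \<xi> \<noteq> 0 \<Longrightarrow> \<xi> \<bullet> \<xi> = l" "\<And>x. laplacian R.H x = - of_real l * R.H x"
    using R.H_frequencies by blast
  have eig: "dirichlet_eigenpair (alcove P) (of_real l) R.H" by (rule R.H_eigenpair[OF l(2)])
  have low: "l \<le> Re \<mu>" if "dirichlet_eigenpair (alcove P) \<mu> v" for \<mu> v
    by (rule R.eigenvalue_lower_bound[OF l(1) that])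
  have uniq: "\<exists>c. \<forall>x\<in>closure (alcove P). u x = c * R.H x"
    if u: "principal_dirichlet_eigenfunction (alcove P) u" for u
  proof -
    obtain l' :: real where l': "dirichlet_eigenpair (alcove P) (of_real l') u"
      "\<And>\<mu> v. dirichlet_eigenpair (alcove P) \<mu> v \<Longrightarrow> l' \<le> Re \<mu>"
      using u by (auto simp: principal_dirichlet_eigenfunction_def)
    have "l' = l" using l'(2)[OF eig] low[OF l'(1)] by simp
    then show ?thesis using R.principal_unique[OF l(1)] l'(1) by (simp add: R.closure_alcove)
  qed
  have dvd: "\<exists>T. (\<forall>x\<in>closure (alcove P). u x = T x) \<and> trig_dvd R.H T"
    if "dirichlet_eigenfunction (alcove P) u" for u
  proof -
    obtain \<mu> where "dirichlet_eigenpair (alcove P) \<mu> u" using \<open>dirichlet_eigenfunction (alcove P) u\<close>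
      by (auto simp: dirichlet_eigenfunction_def)
    then obtain g where g: "g \<in> trig_polynomials" "\<And>x. x \<in> R.calcove \<Longrightarrow> u x = R.H x * g x"
      using R.dirichlet_eigenfunction_multiple by metis
    have "trig_dvd R.H (\<lambda>x. R.H x * g x)"
      unfolding trig_dvd_def using R.tp_H g(1) tp_mult by blast
    then show ?thesis using g(2) by (intro exI[of _ "\<lambda>x. R.H x * g x"]) (auto simp: R.closure_alcove)
  qed
  show ?thesis
    unfolding H using eig low uniq dvd R.sine_product_positive
    by (auto simp: dirichlet_eigenfunction_def principal_dirichlet_eigenfunction_def)
qed

end
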